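(* The $2^N$-dimensional representation $W^{(N)}(b)$ of the 2BTL algebra is irreducible except at the following points. For $N$ even: $\theta=\pm(-2n-1+\epsilon_1\omega_1+\epsilon_2\omega_2)$ with $n=0,1,\dots,\frac{N-2}{2}$ and $\epsilon_1,\epsilon_2=\pm1$. For $N$ odd: $\theta=\pm(\omega_1+\epsilon\omega_2)$ with $\epsilon=\pm1$, and $\theta=\pm(-2n+\epsilon_1\omega_1+\epsilon_2\omega_2)$ with $n=1,\dots,\frac{N-1}{2}$ and $\epsilon_1,\epsilon_2=\pm1$.
   Context: Let $N$ be a positive integer. Let $\eta,\omega_1,\omega_2,\theta$ be complex parameters; write $q^x=e^{\eta x}$ and $[x]=\frac{q^x-q^{-x}}{q-q^{-1}}$ (with $q\neq q^{-1}$, so that this is defined). The singular points $[\omega_i]=0$ and $[\omega_i+1]=0$ ($i=1,2$) are excluded. The parameter $\theta$ enters only through $q^{\theta}$, and equalities for $\theta$ are understood as equalities of the corresponding values of $q^\theta$. Put $\delta=[2]$, $s_1=\frac{[\omega_1]}{[\omega_1+1]}$, $s_2=\frac{[\omega_2]}{[\omega_2+1]}$. The 2BTL algebra is the unital complex algebra with generators $e_0,\dots,e_N$ and relations $e_i^2=\delta e_i$, $e_ie_{i\pm1}e_i=e_i$ for $1\le i\le N-1$ (with $i\pm1\in\{0,\dots,N\}$), $e_0^2=s_1e_0$, $e_N^2=s_2e_N$, $e_ie_j=e_je_i$ for $|i-j|>1$. For $N$ even set $I_1=e_1e_3\cdots e_{N-1}$, $I_2=e_0e_2\cdots e_N$ and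 $b=\frac{[(\omega_1+\omega_2+1+\theta)/2][(\omega_1+\omega_2+1-\theta)/2]}{[\omega_1+1][\omega_2+1]}$; for $N$ odd set $I_1=e_1e_3\cdots e_N$, $I_2=e_0e_2\cdots e_{N-1}$ and $b=-\frac{[(\omega_1-\omega_2+\theta)/2][(\omega_1-\omega_2-\theta)/2]}{[\omega_1+1][\omega_2+1]}$. The double quotient $\mathcal A_b$ is the quotient of 2BTL by $I_1I_2I_1=bI_1$, $I_2I_1I_2=bI_2$. Define $E_0=1$ and $E_i=s_1^{(-1)^i}E_{i-1}e_{i-1}E_{i-1}$ for $1\le i\le N$ (idempotents). The $2^N$-dimensional module $W^{(N)}(b)$ is realised as the left ideal $\mathcal A_bE_N$. *)

theory Defs
  imports Complex_Main "HOL-Library.Poly_Mapping"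
    "HOL-Algebra.QuotRing" "HOL-Algebra.Embedded_Algebras"
begin

section \<open>Free algebras\<close>

text \<open>Words in the generators, with concatenation written additively, so that the
  convolution product of the monoid algebra \<open>fword \<Rightarrow>\<^sub>0 complex\<close> is the product of
  noncommutative polynomials.\<close>

datatype fword = FWord (letters: "nat list")

instantiation fword :: monoid_add
begin

definition zero_fword :: fword where "zero_fword = FWord []"

definition plus_fword :: "fword \<Rightarrow> fword \<Rightarrow> fword"
  where "plus_fword u v = FWord (letters u @ letters v)"

instance
  by standard (auto simp: zero_fword_def plus_fword_def)

end

type_synonym ncpoly = "fword \<Rightarrow>\<^sub>0 complex"

definition gen :: "nat \<Rightarrow> ncpoly"
  where "gen i = Poly_Mapping.single (FWord [i]) 1"

definition const :: "complex \<Rightarrow> ncpoly"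
  where "const c = Poly_Mapping.single 0 c"

definition free_algebra :: "nat \<Rightarrow> ncpoly ring" where
  "free_algebra N =
    \<lparr>carrier = {p. \<forall>w\<in>Poly_Mapping.keys p. set (letters w) \<subseteq> {0..N}},
     mult = (*), one = 1, zero = 0, add = (+)\<rparr>"

section \<open>The 2BTL algebra and its double quotient\<close>

definition btl_relations :: "nat \<Rightarrow> complex \<Rightarrow> complex \<Rightarrow> complex \<Rightarrow> ncpoly set" where
  "btl_relations N \<delta> s1 s2 =
     {gen i * gen i - const \<delta> * gen i | i. 1 \<le> i \<and> i \<le> N - 1}
   \<union> {gen i * gen j * gen i - gen i | i j. 1 \<le> i \<and> i \<le> N - 1 \<and> (j = i + 1 \<or> j = i - 1)}
   \<union> {gen 0 * gen 0 - const s1 * gen 0, gen N * gen N - const s2 * gen N}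
   \<union> {gen i * gen j - gen j * gen i | i j. i \<le> N \<and> j \<le> N \<and> \<bar>int i - int j\<bar> > 1}"

definition btl_ideal :: "nat \<Rightarrow> complex \<Rightarrow> complex \<Rightarrow> complex \<Rightarrow> ncpoly set" where
  "btl_ideal N \<delta> s1 s2 = genideal (free_algebra N) (btl_relations N \<delta> s1 s2)"

definition two_BTL :: "nat \<Rightarrow> complex \<Rightarrow> complex \<Rightarrow> complex \<Rightarrow> ncpoly set ring" where
  "two_BTL N \<delta> s1 s2 = free_algebra N Quot btl_ideal N \<delta> s1 s2"

definition btl_class :: "nat \<Rightarrow> complex \<Rightarrow> complex \<Rightarrow> complex \<Rightarrow> ncpoly \<Rightarrow> ncpoly set" where
  "btl_class N \<delta> s1 s2 p = btl_ideal N \<delta> s1 s2 +>\<^bsub>free_algebra N\<^esub> p"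

text \<open>The products of the odd and of the even generators among \<open>e\<^sub>0, \<dots>, e\<^sub>N\<close>, in increasing
  order; this covers both parities of \<open>N\<close>.\<close>

definition I1_elem :: "nat \<Rightarrow> ncpoly"
  where "I1_elem N = prod_list (map gen (filter odd [0..<Suc N]))"

definition I2_elem :: "nat \<Rightarrow> ncpoly"
  where "I2_elem N = prod_list (map gen (filter even [0..<Suc N]))"

definition dq_relations ::
  "nat \<Rightarrow> complex \<Rightarrow> complex \<Rightarrow> complex \<Rightarrow> complex \<Rightarrow> ncpoly set set" where
  "dq_relations N \<delta> s1 s2 b =
    {btl_class N \<delta> s1 s2 (I1_elem N * I2_elem N * I1_elem N - const b * I1_elem N),
     btl_class N \<delta> s1 s2 (I2_elem N * I1_elem N * I2_elem N - const b * I2_elem N)}"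

definition dq_ideal ::
  "nat \<Rightarrow> complex \<Rightarrow> complex \<Rightarrow> complex \<Rightarrow> complex \<Rightarrow> ncpoly set set" where
  "dq_ideal N \<delta> s1 s2 b = genideal (two_BTL N \<delta> s1 s2) (dq_relations N \<delta> s1 s2 b)"

definition double_quotient ::
  "nat \<Rightarrow> complex \<Rightarrow> complex \<Rightarrow> complex \<Rightarrow> complex \<Rightarrow> ncpoly set set ring" where
  "double_quotient N \<delta> s1 s2 b = two_BTL N \<delta> s1 s2 Quot dq_ideal N \<delta> s1 s2 b"

definition dq_proj ::
  "nat \<Rightarrow> complex \<Rightarrow> complex \<Rightarrow> complex \<Rightarrow> complex \<Rightarrow> ncpoly set \<Rightarrow> ncpoly set set" where
  "dq_proj N \<delta> s1 s2 b x = dq_ideal N \<delta> s1 s2 b +>\<^bsub>two_BTL N \<delta> s1 s2\<^esub> x"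

definition dq_gen ::
  "nat \<Rightarrow> complex \<Rightarrow> complex \<Rightarrow> complex \<Rightarrow> complex \<Rightarrow> nat \<Rightarrow> ncpoly set set" where
  "dq_gen N \<delta> s1 s2 b i = dq_proj N \<delta> s1 s2 b (btl_class N \<delta> s1 s2 (gen i))"

definition dq_const ::
  "nat \<Rightarrow> complex \<Rightarrow> complex \<Rightarrow> complex \<Rightarrow> complex \<Rightarrow> complex \<Rightarrow> ncpoly set set" where
  "dq_const N \<delta> s1 s2 b c = dq_proj N \<delta> s1 s2 b (btl_class N \<delta> s1 s2 (const c))"

section \<open>The module \<open>W\<close>\<close>

primrec E_idem ::
  "nat \<Rightarrow> complex \<Rightarrow> complex \<Rightarrow> complex \<Rightarrow> complex \<Rightarrow> nat \<Rightarrow> ncpoly set set" where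
  "E_idem N \<delta> s1 s2 b 0 = \<one>\<^bsub>double_quotient N \<delta> s1 s2 b\<^esub>"
| "E_idem N \<delta> s1 s2 b (Suc i) =
     dq_const N \<delta> s1 s2 b (s1 powi ((-1) ^ Suc i))
       \<otimes>\<^bsub>double_quotient N \<delta> s1 s2 b\<^esub> E_idem N \<delta> s1 s2 b i
       \<otimes>\<^bsub>double_quotient N \<delta> s1 s2 b\<^esub> dq_gen N \<delta> s1 s2 b i
       \<otimes>\<^bsub>double_quotient N \<delta> s1 s2 b\<^esub> E_idem N \<delta> s1 s2 b i"

definition W_mod ::
  "nat \<Rightarrow> complex \<Rightarrow> complex \<Rightarrow> complex \<Rightarrow> complex \<Rightarrow> ncpoly set set set" where
  "W_mod N \<delta> s1 s2 b =
    {x \<otimes>\<^bsub>double_quotient N \<delta> s1 s2 b\<^esub> E_idem N \<delta> s1 s2 b N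
      | x. x \<in> carrier (double_quotient N \<delta> s1 s2 b)}"

text \<open>2BTL acts through the projection onto the double quotient. It contains the scalars, so
  stable additive subgroups are complex subspaces.\<close>

definition btl_submodule ::
  "nat \<Rightarrow> complex \<Rightarrow> complex \<Rightarrow> complex \<Rightarrow> complex \<Rightarrow> ncpoly set set set \<Rightarrow> bool" where
  "btl_submodule N \<delta> s1 s2 b U \<longleftrightarrow>
     additive_subgroup U (double_quotient N \<delta> s1 s2 b) \<and>
     (\<forall>a \<in> carrier (two_BTL N \<delta> s1 s2). \<forall>u \<in> U.
        dq_proj N \<delta> s1 s2 b a \<otimes>\<^bsub>double_quotient N \<delta> s1 s2 b\<^esub> u \<in> U)"

definition btl_irreducible ::
  "nat \<Rightarrow> complex \<Rightarrow> complex \<Rightarrow> complex \<Rightarrow> complex \<Rightarrow> ncpoly set set set \<Rightarrow> bool" where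
  "btl_irreducible N \<delta> s1 s2 b M \<longleftrightarrow>
     btl_submodule N \<delta> s1 s2 b M \<and> M \<noteq> {\<zero>\<^bsub>double_quotient N \<delta> s1 s2 b\<^esub>} \<and>
     (\<forall>U. btl_submodule N \<delta> s1 s2 b U \<and> U \<subseteq> M \<longrightarrow>
        U = {\<zero>\<^bsub>double_quotient N \<delta> s1 s2 b\<^esub>} \<or> U = M)"

text \<open>The library's \<open>ring.dimension\<close> measures a subset of a ring over a subfield of that ring;
  here the subfield is the image of the complex numbers in the double quotient.\<close>

definition has_complex_dim ::
  "nat \<Rightarrow> complex \<Rightarrow> complex \<Rightarrow> complex \<Rightarrow> complex \<Rightarrow> nat \<Rightarrow> ncpoly set set set \<Rightarrow> bool" where
  "has_complex_dim N \<delta> s1 s2 b d M \<longleftrightarrow>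
     ring.dimension (double_quotient N \<delta> s1 s2 b) d (range (dq_const N \<delta> s1 s2 b)) M"

section \<open>Parametrisation\<close>

definition qpow :: "complex \<Rightarrow> complex \<Rightarrow> complex"
  where "qpow \<eta> x = exp (\<eta> * x)"

definition qnum :: "complex \<Rightarrow> complex \<Rightarrow> complex"
  where "qnum \<eta> x = (qpow \<eta> x - qpow \<eta> (- x)) / (qpow \<eta> 1 - qpow \<eta> (- 1))"

definition b_param :: "nat \<Rightarrow> complex \<Rightarrow> complex \<Rightarrow> complex \<Rightarrow> complex \<Rightarrow> complex" where
  "b_param N \<eta> \<omega>1 \<omega>2 \<theta> =
    (if even N
     then qnum \<eta> ((\<omega>1 + \<omega>2 + 1 + \<theta>) / 2) * qnum \<eta> ((\<omega>1 + \<omega>2 + 1 - \<theta>) / 2)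
            / (qnum \<eta> (\<omega>1 + 1) * qnum \<eta> (\<omega>2 + 1))
     else - (qnum \<eta> ((\<omega>1 - \<omega>2 + \<theta>) / 2) * qnum \<eta> ((\<omega>1 - \<omega>2 - \<theta>) / 2)
            / (qnum \<eta> (\<omega>1 + 1) * qnum \<eta> (\<omega>2 + 1))))"

section \<open>Well-formedness of the quotients\<close>

lemma keys_gen [simp]: "Poly_Mapping.keys (gen i) = {FWord [i]}"
  by (simp add: gen_def)

lemma keys_const: "Poly_Mapping.keys (const c) \<subseteq> {FWord []}"
  by (simp add: const_def zero_fword_def)

lemma free_algebra_minus:
  "p \<in> carrier (free_algebra N) \<Longrightarrow> q \<in> carrier (free_algebra N) \<Longrightarrow>
    p - q \<in> carrier (free_algebra N)"
  using Poly_Mapping.keys_diff[of p q] by (fastforce simp: free_algebra_def)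

lemma free_algebra_mult:
  assumes "p \<in> carrier (free_algebra N)" "q \<in> carrier (free_algebra N)"
  shows "p * q \<in> carrier (free_algebra N)"
  using assms Poly_Mapping.keys_mult[of p q]
  by (fastforce simp: free_algebra_def plus_fword_def)

lemma gen_carrier: "i \<le> N \<Longrightarrow> gen i \<in> carrier (free_algebra N)"
  by (simp add: free_algebra_def)

lemma const_carrier: "const c \<in> carrier (free_algebra N)"
  using keys_const[of c] by (fastforce simp: free_algebra_def)

lemma one_carrier: "1 \<in> carrier (free_algebra N)"
  by (simp add: free_algebra_def zero_fword_def)

lemma free_algebra_add:
  assumes "p \<in> carrier (free_algebra N)" "q \<in> carrier (free_algebra N)"
  shows "p + q \<in> carrier (free_algebra N)"
  using assms Poly_Mapping.keys_add[of p q] by (fastforce simp: free_algebra_def)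

lemma free_algebra_sel:
  "p \<oplus>\<^bsub>free_algebra N\<^esub> q = p + q" "p \<otimes>\<^bsub>free_algebra N\<^esub> q = p * q"
  "\<zero>\<^bsub>free_algebra N\<^esub> = 0" "\<one>\<^bsub>free_algebra N\<^esub> = 1"
  by (simp_all add: free_algebra_def)

lemma ring_free_algebra: "ring (free_algebra N)"
proof (rule ringI)
  have zero: "0 \<in> carrier (free_algebra N)"
    by (simp add: free_algebra_def)
  show "abelian_group (free_algebra N)"
  proof (rule abelian_groupI, goal_cases)
    case (6 p)
    then have "0 - p \<in> carrier (free_algebra N)"
      by (rule free_algebra_minus[OF zero])
    then show ?case
      by (rule bexI[rotated]) (simp add: free_algebra_sel)
  qed (simp_all add: free_algebra_sel zero free_algebra_add add.assoc add.commute)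
  show "monoid (free_algebra N)"
    by (rule monoidI) (simp_all add: free_algebra_sel free_algebra_mult one_carrier mult.assoc)
qed (simp_all add: free_algebra_sel distrib_left distrib_right)

lemma btl_relations_carrier: "1 \<le> N \<Longrightarrow> btl_relations N \<delta> s1 s2 \<subseteq> carrier (free_algebra N)"
  unfolding btl_relations_def
  by (auto intro!: free_algebra_minus free_algebra_mult gen_carrier const_carrier)

lemma ideal_btl_ideal: "1 \<le> N \<Longrightarrow> ideal (btl_ideal N \<delta> s1 s2) (free_algebra N)"
  unfolding btl_ideal_def
  by (rule ring.genideal_ideal[OF ring_free_algebra btl_relations_carrier])

lemma ring_two_BTL: "1 \<le> N \<Longrightarrow> ring (two_BTL N \<delta> s1 s2)"
  unfolding two_BTL_def by (rule ideal.quotient_is_ring[OF ideal_btl_ideal])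

lemma btl_class_carrier:
  "p \<in> carrier (free_algebra N) \<Longrightarrow> btl_class N \<delta> s1 s2 p \<in> carrier (two_BTL N \<delta> s1 s2)"
  unfolding btl_class_def two_BTL_def FactRing_def A_RCOSETS_def' by auto

lemma prod_list_gen_carrier:
  "\<forall>i\<in>set is. i \<le> N \<Longrightarrow> prod_list (map gen is) \<in> carrier (free_algebra N)"
  by (induction "is") (auto intro!: free_algebra_mult gen_carrier one_carrier)

lemma I_elem_carrier:
  "I1_elem N \<in> carrier (free_algebra N)" "I2_elem N \<in> carrier (free_algebra N)"
  unfolding I1_elem_def I2_elem_def by (rule prod_list_gen_carrier, auto simp del: upt_Suc)+

lemma ideal_dq_ideal: "1 \<le> N \<Longrightarrow> ideal (dq_ideal N \<delta> s1 s2 b) (two_BTL N \<delta> s1 s2)"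
  unfolding dq_ideal_def dq_relations_def
  by (rule ring.genideal_ideal[OF ring_two_BTL])
     (auto intro!: btl_class_carrier free_algebra_minus free_algebra_mult I_elem_carrier
       const_carrier)

lemma ring_double_quotient: "1 \<le> N \<Longrightarrow> ring (double_quotient N \<delta> s1 s2 b)"
  unfolding double_quotient_def by (rule ideal.quotient_is_ring[OF ideal_dq_ideal])

end

theory Submission
  imports Defs
begin

text \<open>The module \<open>\<A>\<^sub>b E\<^sub>N\<close> is spanned by vectors \<open>Y\<^sub>h E\<^sub>N\<close>, where \<open>h\<close> runs over lattice paths of length
  \<open>N\<close> above zero and \<open>Y\<^sub>h\<close> is a word in the generators: \<open>e\<^sub>i\<close> at a valley raises the path,
  elsewhere \<open>e\<^sub>i Y\<^sub>h\<close> is a multiple of some \<open>Y\<^sub>h\<^sub>'\<close>, and a path that stays above height one may be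
  lowered by two at the cost of a factor \<open>b\<close>. So the \<open>2\<^sup>N\<close> paths of minimum zero or one suffice.

  The algebra also acts on a spin chain \<open>(\<complex>\<^sup>2)\<^sup>\<otimes>\<^sup>N\<close> whose boundary operators depend on a
  parameter \<open>t\<close>; the value of \<open>b\<close> is a quadratic function of \<open>t\<close> divided by \<open>t\<close>. On it the
  vectors \<open>Y\<^sub>h \<chi>\<close> are linearly independent unless \<open>t\<close> is in an explicit finite set. The structure
  constants of the span of the \<open>Y\<^sub>h E\<^sub>N\<close> are polynomials in \<open>b\<close>, so by continuity in \<open>t\<close> they define
  a module for every \<open>b\<close>, and the dimension is always \<open>2\<^sup>N\<close>.

  The two parameters \<open>t\<close>, \<open>t'\<close> with the same \<open>b\<close> belong to mutually transpose chains. If the module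
  is irreducible, it embeds into both chains, which makes both parameters regular. If both are
  regular, the module is the chain at \<open>t\<close>, and since the vectors \<open>Y\<^sub>h \<chi>\<close> of the transposed chain
  separate points, every nonzero vector is mapped by some reversed word \<open>Y\<^sub>h\<close> to a nonzero
  multiple of a generator.\<close>

section \<open>The idempotents\<close>

text \<open>The double quotient is given by generators and relations only: spanning is a matter of
  rewriting, while independence of the \<open>2^N\<close> vectors needs a representation. At an
  exceptional \<open>b\<close> the vectors \<open>Y_h chi\<close> may be dependent in both chains
  that belong to it; this is why the limit in \<open>t\<close> is needed.

  The idempotent \<open>E_N\<close> is awkward in a calculus of monomials. A monomial
  \<open>F\<close> with the same image takes its place. It factors as \<open>F = M J\<close>, where
  \<open>J\<close> is the lowest level of every path word, and \<open>J F\<close> is a nonzero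
  multiple of \<open>J\<close>.

  The excluded values of \<open>t\<close> have two origins. A strand joining the two boundaries
  contributes a pairing of boundary vectors. This weight has two values, according to the parity of
  a height, and \<open>b\<close> is their product; when the weight at height zero vanishes, so do
  the vectors of all paths that stay above zero. The other values come from splitting off the last
  site: this makes the system of half diagram vectors block triangular, with a determinant built
  from two by two determinants, each of which vanishes at a single \<open>t\<close>.\<close>

text \<open>A triple \<open>(u, k, w)\<close> stands for the relation \<open>e\<^sub>u = k e\<^sub>w\<close> between monomials. As all relations
  have this form, they make sense for operators on a set with scalars: on the quotient ring (where
  the operators are left multiplications), on spin chains, and on families of spin chains.\<close>

definition btl_rel :: "nat \<Rightarrow> complex \<Rightarrow> complex \<Rightarrow> complex \<Rightarrow> (nat list \<times> complex \<times> nat list) set" where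
  "btl_rel N \<delta> s1 s2 =
     {([i, i], \<delta>, [i]) | i. 1 \<le> i \<and> i \<le> N - 1}
   \<union> {([i, j, i], 1, [i]) | i j. 1 \<le> i \<and> i \<le> N - 1 \<and> (j = i + 1 \<or> j = i - 1)}
   \<union> {([0, 0], s1, [0]), ([N, N], s2, [N])}
   \<union> {([i, j], 1, [j, i]) | i j. i \<le> N \<and> j \<le> N \<and> \<bar>int i - int j\<bar> > 1}"

definition I1_word :: "nat \<Rightarrow> nat list" where "I1_word N = filter odd [0..<Suc N]"
definition I2_word :: "nat \<Rightarrow> nat list" where "I2_word N = filter even [0..<Suc N]"

definition dq_rel :: "nat \<Rightarrow> complex \<Rightarrow> (nat list \<times> complex \<times> nat list) set" where
  "dq_rel N b = {(I1_word N @ I2_word N @ I1_word N, b, I1_word N),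
                 (I2_word N @ I1_word N @ I2_word N, b, I2_word N)}"

section \<open>Operators that satisfy the relations, and their idempotents\<close>

locale btl_act =
  fixes N :: nat and e :: "nat \<Rightarrow> 'v \<Rightarrow> 'v" and sc :: "complex \<Rightarrow> 'v \<Rightarrow> 'v"
    and \<delta> s1 s2 :: complex
  assumes N_pos: "1 \<le> N"
    and sc_sc [simp]: "sc c (sc d v) = sc (c * d) v"
    and sc_one [simp]: "sc 1 v = v"
    and e_sc [simp]: "i \<le> N \<Longrightarrow> e i (sc c v) = sc c (e i v)"
    and rel: "(u, k, w) \<in> btl_rel N \<delta> s1 s2 \<Longrightarrow> foldr e u v = sc k (foldr e w v)"
begin

definition loop_wt :: "nat \<Rightarrow> complex" where
  "loop_wt i = (if i = 0 then s1 else if i = N then s2 else \<delta>)"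

lemma e_idem: "i \<le> N \<Longrightarrow> e i (e i v) = sc (loop_wt i) (e i v)"
  using rel[of "[i, i]" "loop_wt i" "[i]" v] N_pos
  by (auto simp: btl_rel_def loop_wt_def)

lemma e_tl: "1 \<le> i \<Longrightarrow> i < N \<Longrightarrow> j = Suc i \<or> Suc j = i \<Longrightarrow> e i (e j (e i v)) = e i v"
  using rel[of "[i, j, i]" 1 "[i]" v] by (auto simp: btl_rel_def)

lemma e_comm: "i \<le> N \<Longrightarrow> j \<le> N \<Longrightarrow> Suc i < j \<or> Suc j < i \<Longrightarrow> e i (e j v) = e j (e i v)"
  using rel[of "[i, j]" 1 "[j, i]" v] by (auto simp: btl_rel_def)

lemma word_sc [simp]: "set u \<subseteq> {..N} \<Longrightarrow> foldr e u (sc c v) = sc c (foldr e u v)"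
  by (induction u) auto

lemma e_comm_word:
  "i \<le> N \<Longrightarrow> (\<And>j. j \<in> set u \<Longrightarrow> j \<le> N \<and> (Suc i < j \<or> Suc j < i)) \<Longrightarrow>
    e i (foldr e u v) = foldr e u (e i v)"
  by (induction u) (auto simp: e_comm)

definition cf :: "nat \<Rightarrow> complex" where "cf k = s1 powi ((-1) ^ k)"

primrec Eop :: "nat \<Rightarrow> 'v \<Rightarrow> 'v" where
  "Eop 0 v = v"
| "Eop (Suc k) v = sc (cf (Suc k)) (Eop k (e k (Eop k v)))"

lemma Eop_sc [simp]: "k \<le> Suc N \<Longrightarrow> Eop k (sc c v) = sc c (Eop k v)"
  by (induction k arbitrary: v) (auto simp: mult.commute)

lemma e_Eop: "k < i \<Longrightarrow> i \<le> N \<Longrightarrow> e i (Eop k v) = Eop k (e i v)"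
proof (induction k arbitrary: v)
  case (Suc k)
  then show ?case
    using e_comm[of i k "Eop k v"] by simp
qed simp

end

locale btl_act_nz = btl_act +
  assumes s1_nz: "s1 \<noteq> 0"
begin

lemma cf_Suc: "cf k * cf (Suc k) = 1" "cf (Suc k) * cf k = 1"
  using s1_nz by (cases "even k"; simp add: cf_def)+

lemma cf_nz: "cf k \<noteq> 0"
  using s1_nz by (simp add: cf_def)

text \<open>The parts need each other. In the square of \<open>Eop (Suc k)\<close> the middle factor
  \<open>e_k E_k e_k\<close> collapses by \<open>e_k e_(k-1) e_k = e_k\<close>, which leaves the
  coefficients \<open>cf k\<close> and \<open>cf (Suc k)\<close>; the alternating exponent of
  \<open>s1\<close> makes their product 1.\<close>

lemma Eop_facts:
  "k \<le> N \<Longrightarrow> (0 < k \<longrightarrow> Eop k (Eop (k - 1) v) = Eop k v \<and> Eop (k - 1) (Eop k v) = Eop k v)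
     \<and> (0 < k \<longrightarrow> k < N \<longrightarrow> e k (Eop k (e k v)) = sc (cf k) (e k (Eop (k - 1) v)))
     \<and> Eop k (Eop k v) = Eop k v"
proof (induction k arbitrary: v)
  case (Suc k)
  have IH1: "Eop k (Eop k v) = Eop k v" for v
    using Suc by simp
  have IH2: "e k (Eop k (e k v)) = sc (cf k) (e k (Eop (k - 1) v))"
    "Eop k (Eop (k - 1) v) = Eop k v" "Eop (k - 1) (Eop k v) = Eop k v" if "0 < k" for v
    using Suc that by auto
  have k: "k < N" using Suc.prems by simp
  have a: "Eop (Suc k) (Eop k v) = Eop (Suc k) v" "Eop k (Eop (Suc k) v) = Eop (Suc k) v" for v
    using k by (simp_all add: IH1)
  have b: "Eop (Suc k) (Eop (Suc k) v) = Eop (Suc k) v" for v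
  proof (cases "k = 0")
    case True
    then show ?thesis
      using cf_Suc[of 0] e_idem[of 0] by (simp add: loop_wt_def cf_def s1_nz)
  next
    case False
    then have "e k (Eop k (e k (Eop k v))) = sc (cf k) (e k (Eop k v))"
      using IH2 by simp
    then show ?thesis
      using k cf_Suc[of k] by (simp add: IH1 mult.assoc)
  qed
  have c: "e (Suc k) (Eop (Suc k) (e (Suc k) v)) = sc (cf (Suc k)) (e (Suc k) (Eop k v))"
    if "Suc k < N"
  proof -
    have "e (Suc k) (Eop (Suc k) (e (Suc k) v))
        = sc (cf (Suc k)) (Eop k (e (Suc k) (e k (e (Suc k) (Eop k v)))))"
      using that k by (simp add: e_Eop)
    also have "e (Suc k) (e k (e (Suc k) (Eop k v))) = e (Suc k) (Eop k v)"
      using that by (intro e_tl) auto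
    finally show ?thesis
      using that k by (simp add: e_Eop IH1)
  qed
  show ?case using a b c by simp
qed simp

lemma Eop_idem: "k \<le> N \<Longrightarrow> Eop k (Eop k v) = Eop k v"
  using Eop_facts by blast

lemma Eop_Suc_left: "k < N \<Longrightarrow> Eop k (Eop (Suc k) v) = Eop (Suc k) v"
  using Eop_facts[of "Suc k" v] by simp

lemma Eop_absorb: "j \<le> k \<Longrightarrow> k \<le> N \<Longrightarrow> Eop j (Eop k v) = Eop k v"
proof (induction k arbitrary: v)
  case (Suc k)
  then show ?case
    using Eop_Suc_left[of k v] Eop_idem[of "Suc k" v]
    by (metis Suc_leD Suc_le_lessD le_Suc_eq)
qed simp

lemma e_Eop_e: "0 < k \<Longrightarrow> k < N \<Longrightarrow> e k (Eop k (e k v)) = sc (cf k) (e k (Eop (k - 1) v))"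
  using Eop_facts[of k v] by simp

lemma e_Eop_Suc: "k < N \<Longrightarrow> e k (Eop (Suc k) v) = e k (Eop k v)"
proof (cases "k = 0")
  case True
  then show ?thesis
    using N_pos e_idem[of 0] s1_nz by (simp add: cf_def loop_wt_def)
next
  case False
  assume k: "k < N"
  then have "e k (Eop (Suc k) v) = sc (cf (Suc k) * cf k) (e k (Eop (k - 1) (Eop k v)))"
    using False e_Eop_e[of k "Eop k v"] by simp
  also have "Eop (k - 1) (Eop k v) = Eop k v"
    using k by (intro Eop_absorb) auto
  finally show ?thesis by (simp add: cf_Suc)
qed

text \<open>The stairs \<open>e\<^sub>0\<cdots>e\<^sub>k\<close> shift the boundary strands, so they turn \<open>E\<^sub>k\<close> into a
  nonzero multiple of \<open>E\<^sub>k\<^sub>+\<^sub>1\<close>.\<close>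

lemma stairs_Eop: "k < N \<Longrightarrow> \<exists>g. g \<noteq> 0 \<and> (\<forall>v. foldr e [0..<Suc k] (Eop k v) = sc g (Eop (Suc k) v))"
proof (induction k)
  case 0
  have "e 0 v = sc s1 (Eop (Suc 0) v)" for v
    using s1_nz by (simp add: cf_def)
  then show ?case using s1_nz by auto
next
  case (Suc k)
  then obtain g where g: "g \<noteq> 0" "\<And>v. foldr e [0..<Suc k] (Eop k v) = sc g (Eop (Suc k) v)"
    by auto
  have "foldr e [0..<Suc (Suc k)] (Eop (Suc k) v) = sc (g * cf (Suc k)) (Eop (Suc (Suc k)) v)" for v
  proof -
    have "foldr e [0..<Suc (Suc k)] (Eop (Suc k) v)
        = foldr e [0..<Suc k] (e (Suc k) (Eop k (Eop (Suc k) v)))"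
      using Suc.prems by (simp add: Eop_Suc_left del: Eop.simps)
    also have "\<dots> = foldr e [0..<Suc k] (Eop k (e (Suc k) (Eop (Suc k) v)))"
      using Suc.prems by (simp add: e_Eop del: Eop.simps)
    also have "\<dots> = sc g (Eop (Suc k) (e (Suc k) (Eop (Suc k) v)))"
      by (rule g(2))
    also have "\<dots> = sc (g * cf (Suc k)) (Eop (Suc (Suc k)) v)"
      by (simp only: Eop.simps(2)[of "Suc k"] sc_sc mult.assoc cf_Suc mult_1_right)
    finally show ?thesis .
  qed
  then show ?case using g(1) cf_nz by (metis mult_eq_0_iff)
qed

end

section \<open>A monomial in place of the idempotent\<close>

fun Fw :: "nat \<Rightarrow> nat list" where
  "Fw 0 = []" | "Fw (Suc 0) = [0]" | "Fw (Suc (Suc k)) = [0..<Suc (Suc k)] @ Fw k"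

text \<open>\<open>Fw k\<close> is a product of stairs of lengths \<open>k\<close>,
  \<open>k - 2\<close>, and so on; \<open>Jw\<close> collects the last letters of the stairs,
  \<open>Mw\<close> the others.\<close>

fun Mw :: "nat \<Rightarrow> nat list" where
  "Mw 0 = []" | "Mw (Suc 0) = []" | "Mw (Suc (Suc k)) = [0..<Suc k] @ Mw k"

fun Jw :: "nat \<Rightarrow> nat list" where
  "Jw 0 = []" | "Jw (Suc 0) = [0]" | "Jw (Suc (Suc k)) = Jw k @ [Suc k]"

lemma Fw_less: "i \<in> set (Fw k) \<Longrightarrow> i < k"
  by (induction k rule: Fw.induct) (auto simp: less_Suc_eq)

lemma Mw_less: "i \<in> set (Mw k) \<Longrightarrow> Suc i < k"
  by (induction k rule: Mw.induct) (auto simp: less_Suc_eq)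

lemma Jw_less: "i \<in> set (Jw k) \<Longrightarrow> i < k"
  by (induction k rule: Jw.induct) (auto simp: less_Suc_eq)

context btl_act_nz
begin

text \<open>The last letter \<open>Suc k\<close> of the longest stair is at distance at least two
  from all letters of the shorter ones, so it moves to the right end.\<close>

lemma Fw_eq: "k \<le> N \<Longrightarrow> foldr e (Fw k) v = foldr e (Mw k) (foldr e (Jw k) v)"
proof (induction k arbitrary: v rule: Fw.induct)
  case (3 k)
  have "foldr e (Fw (Suc (Suc k))) v = foldr e [0..<Suc k] (e (Suc k) (foldr e (Mw k) (foldr e (Jw k) v)))"
    using 3 by simp
  also have "e (Suc k) (foldr e (Mw k) (foldr e (Jw k) v)) = foldr e (Mw k @ Jw k) (e (Suc k) v)"
    using 3(2) by (subst foldr_append[symmetric, unfolded comp_def], subst e_comm_word)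
      (auto dest: Mw_less Jw_less)
  finally show ?case by simp
qed auto

text \<open>The letter \<open>Suc k\<close> commutes with \<open>Eop k\<close>, so the absorbed
  \<open>Eop k\<close> can be moved up to the stair, which turns it into
  \<open>Eop (Suc k)\<close>.\<close>

lemma stairs_Fw:
  assumes "Suc (Suc k) \<le> N" "\<And>v. Eop k (foldr e (Fw k) v) = foldr e (Fw k) v"
  shows "\<exists>g. g \<noteq> 0 \<and> (\<forall>v. foldr e (Fw (Suc (Suc k))) v = sc g (Eop (Suc k) (e (Suc k) (foldr e (Fw k) v))))"
proof -
  obtain g where g: "g \<noteq> 0" "\<And>v. foldr e [0..<Suc k] (Eop k v) = sc g (Eop (Suc k) v)"
    using stairs_Eop[of k] assms(1) by auto
  have "foldr e (Fw (Suc (Suc k))) v = sc g (Eop (Suc k) (e (Suc k) (foldr e (Fw k) v)))" for v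
  proof -
    have "foldr e (Fw (Suc (Suc k))) v = foldr e [0..<Suc k] (e (Suc k) (Eop k (foldr e (Fw k) v)))"
      by (simp add: assms(2))
    also have "\<dots> = foldr e [0..<Suc k] (Eop k (e (Suc k) (foldr e (Fw k) v)))"
      using assms(1) by (simp add: e_Eop)
    finally show ?thesis by (simp only: g(2))
  qed
  with g(1) show ?thesis by blast
qed

text \<open>Together with \<open>Fw_Eop\<close> this says that the word \<open>Fw k\<close> and the
  idempotent \<open>Eop k\<close> have the same image.\<close>

lemma Eop_Fw: "k \<le> N \<Longrightarrow> Eop k (foldr e (Fw k) v) = foldr e (Fw k) v"
proof (induction k arbitrary: v rule: Fw.induct)
  case 2
  then show ?case
    using e_idem[of 0 v] s1_nz by (simp add: cf_def loop_wt_def)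
next
  case (3 k)
  then have IH: "Eop k (foldr e (Fw k) v) = foldr e (Fw k) v" for v by simp
  obtain g where g: "g \<noteq> 0"
    "\<And>v. foldr e (Fw (Suc (Suc k))) v = sc g (Eop (Suc k) (e (Suc k) (foldr e (Fw k) v)))"
    using stairs_Fw[OF 3(2) IH] by auto
  have "Eop (Suc (Suc k)) (foldr e (Fw (Suc (Suc k))) v)
      = sc (cf (Suc (Suc k)) * g) (Eop (Suc k) (e (Suc k) (Eop (Suc k) (e (Suc k) (foldr e (Fw k) v)))))"
    using 3(2) by (simp add: g(2) Eop_idem del: Eop.simps Fw.simps)
      (simp add: Eop_idem Eop.simps(2)[of "Suc k"] mult.commute del: Eop.simps)
  also have "e (Suc k) (Eop (Suc k) (e (Suc k) (foldr e (Fw k) v)))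
      = sc (cf (Suc k)) (e (Suc k) (foldr e (Fw k) v))"
    using 3(2) IH e_Eop_e[of "Suc k"] by simp
  finally show ?case
    using 3(2) cf_Suc[of "Suc k"] by (simp add: g(2) mult.commute mult.left_commute del: Eop.simps Fw.simps)
qed simp

lemma Fw_Eop: "k \<le> N \<Longrightarrow> \<exists>f. f \<noteq> 0 \<and> (\<forall>v. foldr e (Fw k) (Eop k v) = sc f (Eop k v))"
proof (induction k rule: Fw.induct)
  case 1
  show ?case by (rule exI[of _ 1]) simp
next
  case 2
  have "e 0 (Eop (Suc 0) v) = sc s1 (Eop (Suc 0) v)" for v
    using N_pos e_idem[of 0 v] s1_nz by (simp add: cf_def loop_wt_def)
  then show ?case using s1_nz by auto
next
  case (3 k)
  then obtain f where f: "f \<noteq> 0" "\<And>v. foldr e (Fw k) (Eop k v) = sc f (Eop k v)"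
    by auto
  obtain g where g: "g \<noteq> 0"
    "\<And>v. foldr e [0..<Suc (Suc k)] (Eop (Suc k) v) = sc g (Eop (Suc (Suc k)) v)"
    using stairs_Eop[of "Suc k"] 3(2) by auto
  have sub: "set [0..<Suc (Suc k)] \<subseteq> {..N}"
    using 3(2) by auto
  have "foldr e (Fw (Suc (Suc k))) (Eop (Suc (Suc k)) v) = sc (f * g) (Eop (Suc (Suc k)) v)" for v
  proof -
    have "foldr e (Fw k) (Eop (Suc (Suc k)) v) = sc f (Eop (Suc (Suc k)) v)"
      using 3(2) f(2)[of "Eop (Suc (Suc k)) v"] by (simp add: Eop_absorb[of k "Suc (Suc k)"] del: Eop.simps)
    then have "foldr e (Fw (Suc (Suc k))) (Eop (Suc (Suc k)) v)
        = sc f (foldr e [0..<Suc (Suc k)] (Eop (Suc (Suc k)) v))"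
      using sub by (simp only: Fw.simps foldr_append comp_def word_sc)
    also have "foldr e [0..<Suc (Suc k)] (Eop (Suc (Suc k)) v) = foldr e [0..<Suc k] (e (Suc k) (Eop (Suc k) v))"
      using 3(2) e_Eop_Suc[of "Suc k" v] by (simp del: Eop.simps)
    also have "\<dots> = foldr e [0..<Suc (Suc k)] (Eop (Suc k) v)"
      by (simp del: Eop.simps)
    also have "sc f \<dots> = sc (f * g) (Eop (Suc (Suc k)) v)"
      by (simp only: g(2) sc_sc)
    finally show ?thesis .
  qed
  then show ?case using f(1) g(1) by (metis mult_eq_0_iff)
qed

text \<open>Every path word ends in \<open>Jw N\<close>. By this fact it acts on
  \<open>foldr e (Fw N) v\<close>, which the idempotent fixes, as on \<open>v\<close> itself, up to
  one nonzero factor.\<close>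

lemma Jw_Fw: "k \<le> N \<Longrightarrow> \<exists>c. c \<noteq> 0 \<and> (\<forall>v. foldr e (Jw k) (foldr e (Fw k) v) = sc c (foldr e (Jw k) v))"
proof (induction k rule: Fw.induct)
  case 1
  show ?case by (rule exI[of _ 1]) simp
next
  case 2
  have "e 0 (e 0 v) = sc s1 (e 0 v)" for v
    using N_pos e_idem[of 0 v] by (simp add: loop_wt_def)
  then show ?case using s1_nz by auto
next
  case (3 k)
  then obtain c where c: "c \<noteq> 0" "\<And>v. foldr e (Jw k) (foldr e (Fw k) v) = sc c (foldr e (Jw k) v)"
    by auto
  have EF: "Eop k (foldr e (Fw k) v) = foldr e (Fw k) v" for v
    using 3(2) by (intro Eop_Fw) simp
  obtain g where g: "g \<noteq> 0"
    "\<And>v. foldr e (Fw (Suc (Suc k))) v = sc g (Eop (Suc k) (e (Suc k) (foldr e (Fw k) v)))"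
    using stairs_Fw[OF 3(2) EF] by auto
  have sub: "set (Jw k) \<subseteq> {..N}"
    using 3(2) by (auto dest!: Jw_less)
  have "foldr e (Jw (Suc (Suc k))) (foldr e (Fw (Suc (Suc k))) v)
      = sc (g * cf (Suc k) * c) (foldr e (Jw (Suc (Suc k))) v)" for v
  proof -
    have "foldr e (Jw (Suc (Suc k))) (foldr e (Fw (Suc (Suc k))) v)
        = sc g (foldr e (Jw k) (e (Suc k) (Eop (Suc k) (e (Suc k) (foldr e (Fw k) v)))))"
      using 3(2) sub by (simp add: g(2) del: Eop.simps Fw.simps)
    also have "e (Suc k) (Eop (Suc k) (e (Suc k) (foldr e (Fw k) v)))
      = sc (cf (Suc k)) (e (Suc k) (foldr e (Fw k) v))"
      using 3(2) EF e_Eop_e[of "Suc k"] by simp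
    also have "e (Suc k) (foldr e (Fw k) v) = foldr e (Fw k) (e (Suc k) v)"
      using 3(2) by (intro e_comm_word) (auto dest!: Fw_less)
    finally show ?thesis
      using 3(2) sub by (simp add: c(2) mult.assoc)
  qed
  then show ?case using c(1) g(1) cf_nz by (metis mult_eq_0_iff)
qed

end

section \<open>Lattice paths\<close>

text \<open>A half diagram is a path \<open>h\<close> of heights at the points \<open>0, \<dots>, N\<close>; its word \<open>Yw\<close> is a product of
  levels, level \<open>k\<close> collecting the commuting generators \<open>e\<^sub>j\<close> under the path at height \<open>k\<close>. Level one,
  the rightmost, is the word \<open>Jw\<close> for every path.\<close>

definition valid :: "nat \<Rightarrow> (nat \<Rightarrow> nat) \<Rightarrow> bool" where
  "valid N h \<longleftrightarrow> (\<forall>j<N. h (Suc j) = Suc (h j) \<or> h j = Suc (h (Suc j))) \<and> even (h N)"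

definition nbr :: "nat \<Rightarrow> nat \<Rightarrow> nat \<Rightarrow> bool" where
  "nbr N i j \<longleftrightarrow> j \<le> N \<and> (j = Suc i \<or> Suc j = i)"

definition valley :: "nat \<Rightarrow> (nat \<Rightarrow> nat) \<Rightarrow> nat \<Rightarrow> bool" where
  "valley N h i \<longleftrightarrow> (\<forall>j. nbr N i j \<longrightarrow> h j = Suc (h i))"

definition peak :: "nat \<Rightarrow> (nat \<Rightarrow> nat) \<Rightarrow> nat \<Rightarrow> bool" where
  "peak N h i \<longleftrightarrow> (\<forall>j. nbr N i j \<longrightarrow> h i = Suc (h j))"

text \<open>In a valid path the parity condition says that \<open>k\<close> and \<open>h j\<close>
  agree modulo 2, so the letter \<open>j\<close> occurs in the levels \<open>h j\<close>,
  \<open>h j - 2\<close>, down to 1 or 2.\<close>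

definition lev :: "nat \<Rightarrow> (nat \<Rightarrow> nat) \<Rightarrow> nat \<Rightarrow> nat list" where
  "lev N h k = filter (\<lambda>j. k \<le> h j \<and> even (j + N + k)) [0..<Suc N]"

lemma set_lev: "set (lev N h k) = {j. j \<le> N \<and> k \<le> h j \<and> even (j + N + k)}"
  by (auto simp: lev_def simp del: upt_Suc)

primrec Yu :: "nat \<Rightarrow> (nat \<Rightarrow> nat) \<Rightarrow> nat \<Rightarrow> nat list" where
  "Yu N h 0 = []"
| "Yu N h (Suc H) = lev N h (Suc H) @ Yu N h H"

definition hsz :: "nat \<Rightarrow> (nat \<Rightarrow> nat) \<Rightarrow> nat" where "hsz N h = (\<Sum>j\<le>N. h j)"

text \<open>The area \<open>hsz\<close> bounds all heights, and the levels above the top are empty.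
  The same number is the measure in the inductions over paths.\<close>

definition Yw :: "nat \<Rightarrow> (nat \<Rightarrow> nat) \<Rightarrow> nat list" where "Yw N h = Yu N h (hsz N h)"

lemma valid_nbr: "valid N h \<Longrightarrow> i \<le> N \<Longrightarrow> nbr N i j \<Longrightarrow> h j = Suc (h i) \<or> h i = Suc (h j)"
  unfolding valid_def nbr_def by (metis Suc_le_lessD)

lemma valid_parity:
  assumes "valid N h" "j \<le> N"
  shows "even (h j + j + N)"
  using assms(2)
proof (induction "N - j" arbitrary: j)
  case 0
  then show ?case using assms(1) by (simp add: valid_def)
next
  case (Suc d)
  then have "even (h (Suc j) + Suc j + N)" by (intro Suc.hyps) auto
  moreover have "h (Suc j) = Suc (h j) \<or> h j = Suc (h (Suc j))"
    using assms(1) Suc by (auto simp: valid_def)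
  ultimately show ?case by auto
qed

lemma h_le_hsz: "j \<le> N \<Longrightarrow> h j \<le> hsz N h"
  unfolding hsz_def by (rule member_le_sum) auto

lemma hsz_upd: "i \<le> N \<Longrightarrow> hsz N (h(i := x)) + h i = hsz N h + x"
  unfolding hsz_def by (simp add: sum.remove[of "{..N}" i] ac_simps)

lemma lev_empty: "hsz N h < k \<Longrightarrow> lev N h k = []"
proof -
  assume k: "hsz N h < k"
  have "j \<notin> set (lev N h k)" for j
    using h_le_hsz[of j N h] k by (auto simp: set_lev)
  then show ?thesis by (metis list.set_intros(1) neq_Nil_conv)
qed

lemma Yu_stable: "hsz N h \<le> H \<Longrightarrow> Yu N h H = Yw N h"
proof (induction H)
  case (Suc H)
  then show ?case
    by (cases "hsz N h = Suc H") (auto simp: Yw_def lev_empty)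
qed (simp add: Yw_def)

lemma Yu_subset: "set (Yu N h H) \<subseteq> {..N}"
  by (induction H) (auto simp: lev_def)

lemma Yw_subset: "set (Yw N h) \<subseteq> {..N}"
  by (simp add: Yw_def Yu_subset)

lemma valid_upd:
  assumes "valid N h" "i \<le> N" "even x = even (h i)"
    "\<And>j. nbr N i j \<Longrightarrow> x = Suc (h j) \<or> h j = Suc x"
  shows "valid N (h(i := x))"
  unfolding valid_def
proof (intro conjI allI impI)
  fix j assume "j < N"
  then show "(h(i := x)) (Suc j) = Suc ((h(i := x)) j) \<or> (h(i := x)) j = Suc ((h(i := x)) (Suc j))"
    using assms(1) assms(4)[of j] assms(4)[of "Suc j"] by (auto simp: valid_def nbr_def)
next
  show "even ((h(i := x)) N)"
    using assms(1,3) by (auto simp: valid_def)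
qed

lemma valid_raise:
  assumes "valid N h" "i \<le> N" "valley N h i"
  shows "valid N (h(i := h i + 2))"
  using assms by (intro valid_upd) (auto simp: valley_def)

lemma valid_lower:
  assumes "valid N h" "i \<le> N" "peak N h i" "2 \<le> h i"
  shows "valid N (h(i := h i - 2))"
  using assms by (intro valid_upd) (auto simp: peak_def)

lemma Jw_eq_filter: "Jw N = filter (\<lambda>j. odd (j + N)) [0..<Suc N]"
  by (induction N rule: Jw.induct) auto

lemma lev_one: "valid N h \<Longrightarrow> lev N h 1 = Jw N"
  unfolding lev_def Jw_eq_filter
proof (intro filter_cong refl)
  fix j assume "valid N h" "j \<in> set [0..<Suc N]"
  then have "even (h j + j + N)" by (intro valid_parity) auto
  then show "(1 \<le> h j \<and> even (j + N + 1)) = odd (j + N)"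
    by (cases "h j") auto
qed

lemma lev_upd_ne:
  assumes "even (i + N + h i)" "k \<noteq> h i" "1 \<le> k"
  shows "lev N (h(i := h i - 2)) k = lev N h k"
  unfolding lev_def
proof (intro filter_cong refl)
  fix j
  show "(k \<le> (h(i := h i - 2)) j \<and> even (j + N + k)) = (k \<le> h j \<and> even (j + N + k))"
  proof (cases "j = i")
    case True
    then show ?thesis using assms by simp presburger
  qed simp
qed

lemma lev_upd_eq:
  assumes "i \<le> N" "even (i + N + h i)" "1 \<le> h i"
  obtains u v where "lev N h (h i) = u @ i # v" "lev N (h(i := h i - 2)) (h i) = u @ v"
proof -
  have "[0..<Suc N] = [0..<i] @ i # [Suc i..<Suc N]"
    using assms(1) by (metis less_Suc_eq_le upt_conv_Cons upt_add_eq_append zero_le le_add_diff_inverse less_imp_le_nat)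
  moreover have "filter (\<lambda>j. h i \<le> (h(i := h i - 2)) j \<and> even (j + N + h i)) xs
      = filter (\<lambda>j. h i \<le> h j \<and> even (j + N + h i)) xs" if "i \<notin> set xs" for xs
    using that by (intro filter_cong) auto
  ultimately show thesis
    using assms that unfolding lev_def by auto
qed

text \<open>Lowering a peak deletes the letter \<open>i\<close> from level \<open>h i\<close>. This
  letter moves to the front: its neighbours are lower, hence absent from the levels above, and
  within one level all letters have the same parity. The height may be 1; the truncated difference
  is then 0 and the lowered function is not a valid path, hence the formulation with
  \<open>Yu\<close>.\<close>

lemma (in btl_act) Yu_front:
  assumes "i \<le> N" "even (i + N + h i)" "1 \<le> h i" "peak N h i" "h i \<le> H"
  shows "foldr e (Yu N h H) v = e i (foldr e (Yu N (h(i := h i - 2)) H) v)"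
  using assms(5)
proof (induction H arbitrary: v)
  case 0
  with assms(3) show ?case by simp
next
  case (Suc H)
  let ?h = "h(i := h i - 2)"
  show ?case
  proof (cases "h i = Suc H")
    case False
    have "e i (foldr e (lev N h (Suc H)) w) = foldr e (lev N h (Suc H)) (e i w)" for w
    proof (rule e_comm_word[OF assms(1)])
      fix j assume "j \<in> set (lev N h (Suc H))"
      then have j: "j \<le> N" "Suc H \<le> h j" unfolding set_lev by blast+
      moreover have "\<not> nbr N i j"
      proof
        assume "nbr N i j"
        then have "h i = Suc (h j)" using assms(4) by (simp add: peak_def)
        then show False using j(2) Suc.prems by linarith
      qed
      moreover have "j \<noteq> i" using j False Suc.prems by auto
      ultimately show "j \<le> N \<and> (Suc i < j \<or> Suc j < i)"
        unfolding nbr_def by linarith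
    qed
    moreover have "lev N ?h (Suc H) = lev N h (Suc H)"
      using assms(2) False by (intro lev_upd_ne) auto
    ultimately show ?thesis
      using Suc.IH Suc.prems False by (simp del: fun_upd_apply)
  next
    case True
    obtain u w where uw: "lev N h (h i) = u @ i # w" "lev N ?h (h i) = u @ w"
      using lev_upd_eq[of i N h] assms by blast
    have low: "k < h i \<Longrightarrow> Yu N ?h k = Yu N h k" for k
    proof (induction k)
      case (Suc k)
      then show ?case
        using lev_upd_ne[of i N h "Suc k"] assms(2) by (simp del: fun_upd_apply)
    qed simp
    have dist: "distinct (lev N h (h i))" unfolding lev_def by (simp del: upt_Suc)
    have "e i (foldr e u z) = foldr e u (e i z)" for z
    proof (rule e_comm_word[OF assms(1)])
      fix j assume j: "j \<in> set u"
      then have "j \<in> set (lev N h (h i))" using uw by simp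
      then have "j \<le> N" "even (j + N + h i)" unfolding set_lev by blast+
      moreover have "j \<noteq> i" using dist j uw by auto
      moreover have "j \<noteq> Suc i \<and> Suc j \<noteq> i"
        using \<open>even (j + N + h i)\<close> assms(2) by auto
      ultimately show "j \<le> N \<and> (Suc i < j \<or> Suc j < i)" by auto
    qed
    then show ?thesis
      using uw low[of H] True by (simp del: fun_upd_apply)
  qed
qed

section \<open>The generators acting on path words\<close>

context btl_act
begin

lemma Y_front:
  assumes "valid N h" "i \<le> N" "peak N h i"
  shows "foldr e (Yw N h) v = e i (foldr e (Yu N (h(i := h i - 2)) (hsz N h)) v)"
proof -
  have "1 \<le> h i"
  proof -
    have "nbr N i (if i = 0 then 1 else i - 1)"
      using N_pos assms(2) by (auto simp: nbr_def)
    then show ?thesis using assms(3) by (fastforce simp: peak_def)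
  qed
  then show ?thesis
    unfolding Yw_def using assms valid_parity[OF assms(1,2)] h_le_hsz[OF assms(2), of h]
    by (intro Yu_front) (auto simp: add.commute add.left_commute)
qed

lemma Y_lower:
  assumes "valid N h" "i \<le> N" "peak N h i" "2 \<le> h i"
  shows "foldr e (Yw N h) v = e i (foldr e (Yw N (h(i := h i - 2))) v)"
proof -
  have "hsz N (h(i := h i - 2)) \<le> hsz N h"
    using hsz_upd[OF assms(2), of h "h i - 2"] assms(4) by linarith
  then show ?thesis
    using Y_front[OF assms(1-3)] by (simp only: Yu_stable)
qed

lemma Y_raise:
  assumes "valid N h" "i \<le> N" "valley N h i"
  shows "e i (foldr e (Yw N h) v) = foldr e (Yw N (h(i := h i + 2))) v"
proof -
  let ?h = "h(i := h i + 2)"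
  have "peak N ?h i"
    unfolding peak_def
  proof (intro allI impI)
    fix j assume j: "nbr N i j"
    then have "j \<noteq> i" by (auto simp: nbr_def)
    then show "?h i = Suc (?h j)" using assms(3) j by (simp add: valley_def)
  qed
  moreover have "2 \<le> ?h i" by simp
  moreover have "?h(i := ?h i - 2) = h" by simp
  ultimately show ?thesis
    using Y_lower[OF valid_raise[OF assms] assms(2)] by metis
qed

lemma Y_peak:
  assumes "valid N h" "i \<le> N" "peak N h i"
  shows "e i (foldr e (Yw N h) v) = sc (loop_wt i) (foldr e (Yw N h) v)"
  by (simp only: Y_front[OF assms] e_idem[OF assms(2)])

text \<open>Lowering the peak \<open>j\<close> turns the slope point \<open>i\<close> into a peak.
  So the letters \<open>j\<close> and \<open>i\<close> both come to the front, and
  \<open>e_i e_j e_i = e_i\<close> applies.\<close>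

lemma Y_zigzag:
  assumes "valid N h" "1 \<le> i" "i < N" "nbr N i j" "\<not> valley N h i" "peak N h j" "2 \<le> h j"
  shows "e i (foldr e (Yw N h) v) = foldr e (Yw N (h(j := h j - 2))) v"
proof -
  have j: "j \<le> N" "j = Suc i \<or> Suc j = i" using assms(4) by (auto simp: nbr_def)
  let ?h = "h(j := h j - 2)"
  have v: "valid N ?h" using assms j by (intro valid_lower)
  have hj: "h j = Suc (h i)"
    using assms(4,6) j assms(3) unfolding peak_def nbr_def by auto
  have pk: "peak N ?h i"
    unfolding peak_def
  proof (intro allI impI)
    fix k assume k: "nbr N i k"
    show "?h i = Suc (?h k)"
    proof (cases "k = j")
      case False
      from assms(5) obtain k' where k': "nbr N i k'" "h k' \<noteq> Suc (h i)"
        by (auto simp: valley_def)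
      then have "k' \<noteq> j" using hj by auto
      then have "k' = k" using k k' assms(4) False by (auto simp: nbr_def)
      then have "h i = Suc (h k)"
        using valid_nbr[OF assms(1) _ k'(1)] k' assms(3) by auto
      then show ?thesis using False assms(4) by (auto simp: nbr_def)
    next
      case True
      moreover have "i \<noteq> j" using assms(4) by (auto simp: nbr_def)
      ultimately show ?thesis using hj assms(7) by simp
    qed
  qed
  have "foldr e (Yw N h) v = e j (foldr e (Yw N ?h) v)"
    using assms j by (intro Y_lower) auto
  also have "foldr e (Yw N ?h) v = e i (foldr e (Yu N (?h(i := ?h i - 2)) (hsz N ?h)) v)"
    using v pk assms(3) by (intro Y_front) auto
  finally have "e i (foldr e (Yw N h) v) = e i (e j (e i (foldr e (Yu N (?h(i := ?h i - 2)) (hsz N ?h)) v)))"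
    by simp
  also have "\<dots> = e i (foldr e (Yu N (?h(i := ?h i - 2)) (hsz N ?h)) v)"
    using assms(2,3) j by (intro e_tl) auto
  also have "\<dots> = foldr e (Yw N ?h) v"
    using v pk assms(3) by (intro Y_front[symmetric]) auto
  finally show ?thesis .
qed

lemma exists_top_peak:
  assumes "valid N h"
  obtains j where "j \<le> N" "peak N h j" "\<And>k. k \<le> N \<Longrightarrow> h k \<le> h j"
proof -
  have "Max (h ` {..N}) \<in> h ` {..N}" by (rule Max_in) auto
  then obtain j where "j \<le> N" "h j = Max (h ` {..N})"
    unfolding image_iff by (metis atMost_iff)
  then have j: "j \<le> N" "\<And>k. k \<le> N \<Longrightarrow> h k \<le> h j"
    by (auto intro: Max_ge)
  moreover have "peak N h j"
    unfolding peak_def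
  proof (intro allI impI)
    fix k assume "nbr N j k"
    then show "h j = Suc (h k)"
      using valid_nbr[OF assms j(1), of k] j(2)[of k] by (simp add: nbr_def)
  qed
  ultimately show thesis using that by blast
qed

text \<open>The constant and the path depend only on the relations, not on the vector: on the product of
  several representations this makes the structure constants uniform.\<close>

lemma Y_reduce:
  assumes "valid N h" "i \<le> N" "\<not> valley N h i"
  shows "\<exists>c h'. valid N h' \<and> hsz N h' \<le> hsz N h \<and> (\<forall>v. e i (foldr e (Yw N h) v) = sc c (foldr e (Yw N h') v))"
  using assms
proof (induction "hsz N h" arbitrary: h i rule: less_induct)
  case less
  show ?case
  proof (cases "peak N h i")
    case True
    then show ?thesis using Y_peak less.prems by blast
  next
    case False
    then obtain k1 k2 where k: "nbr N i k1" "h i \<noteq> Suc (h k1)" "nbr N i k2" "h k2 \<noteq> Suc (h i)"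
      using less.prems(3) by (auto simp: peak_def valley_def)
    then have hk: "h k1 = Suc (h i)" "h i = Suc (h k2)"
      using valid_nbr[OF less.prems(1,2)] by auto
    then have i: "1 \<le> i" "i < N"
      using k by (auto simp: nbr_def)
    obtain j where j: "j \<le> N" "peak N h j" "\<And>k. k \<le> N \<Longrightarrow> h k \<le> h j"
      using exists_top_peak[OF less.prems(1)] by blast
    have hj: "2 \<le> h j" using j(3)[of k1] k(1) hk by (auto simp: nbr_def)
    have ji: "j \<noteq> i" using False j by auto
    let ?h = "h(j := h j - 2)"
    have v: "valid N ?h" using less.prems j hj by (intro valid_lower)
    have sz: "hsz N ?h + 2 = hsz N h" using hsz_upd[OF j(1), of h "h j - 2"] hj by simp
    show ?thesis
    proof (cases "nbr N i j")
      case True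
      have "\<forall>v. e i (foldr e (Yw N h) v) = sc 1 (foldr e (Yw N ?h) v)"
        using Y_zigzag[OF less.prems(1) i True less.prems(3) j(2) hj] by simp
      then show ?thesis
        using v sz by (intro exI[of _ 1] exI[of _ ?h]) auto
    next
      \<comment> \<open>The top peak is away from \<open>i\<close>, so \<open>e i\<close> passes
        \<open>e j\<close> and acts on the lowered path, where \<open>i\<close> is still no valley.
        Putting \<open>e j\<close> back adds at most 2 to the area, so the bound by
        \<open>hsz N h\<close> survives.\<close>
      case False
      then have far: "Suc i < j \<or> Suc j < i" using ji j(1) by (auto simp: nbr_def)
      have "k2 \<noteq> j" using False k(3) by auto
      then have "\<not> valley N ?h i"
        using k(3,4) ji by (auto simp: valley_def)
      then obtain c h' where c: "valid N h'" "hsz N h' \<le> hsz N ?h"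
          "\<And>v. e i (foldr e (Yw N ?h) v) = sc c (foldr e (Yw N h') v)"
      proof -
        have "hsz N ?h < hsz N h" using sz by linarith
        from less.hyps[OF this v less.prems(2) \<open>\<not> valley N ?h i\<close>] that show thesis by blast
      qed
      have step: "e i (foldr e (Yw N h) v) = sc c (e j (foldr e (Yw N h') v))" for v
        using Y_lower[OF less.prems(1) j(1,2) hj, of v] e_comm[OF less.prems(2) j(1) far] c(3) j(1)
        by simp
      show ?thesis
      proof (cases "valley N h' j")
        case True
        have "hsz N (h'(j := h' j + 2)) \<le> hsz N h"
          using hsz_upd[OF j(1), of h' "h' j + 2"] c(2) sz by simp
        then show ?thesis
          using step Y_raise[OF c(1) j(1) True] valid_raise[OF c(1) j(1) True] by metis
      next
        case False
        obtain c' h'' where c': "valid N h''" "hsz N h'' \<le> hsz N h'"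
            "\<And>v. e j (foldr e (Yw N h') v) = sc c' (foldr e (Yw N h'') v)"
        proof -
          have "hsz N h' < hsz N h" using c(2) sz by linarith
          from less.hyps[OF this c(1) j(1) False] that show thesis by blast
        qed
        have "\<forall>v. e i (foldr e (Yw N h) v) = sc (c * c') (foldr e (Yw N h'') v)"
          using step c'(3) by simp
        moreover have "hsz N h'' \<le> hsz N h" using c'(2) c(2) sz by linarith
        ultimately show ?thesis using c'(1) by blast
      qed
    qed
  qed
qed

lemma Y_closed:
  assumes "valid N h" "i \<le> N"
  shows "\<exists>c h'. valid N h' \<and> (\<forall>v. e i (foldr e (Yw N h) v) = sc c (foldr e (Yw N h') v))"
proof (cases "valley N h i")
  case True
  have "\<forall>v. e i (foldr e (Yw N h) v) = sc 1 (foldr e (Yw N (h(i := h i + 2))) v)"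
    using Y_raise[OF assms True] by simp
  then show ?thesis using valid_raise[OF assms True] by blast
next
  case False
  then show ?thesis using Y_reduce[OF assms False] by blast
qed

end


lemma Yu_low: "(\<And>j. j \<le> N \<Longrightarrow> h j \<le> 1) \<Longrightarrow> Yu N h (Suc H) = lev N h 1"
proof (induction H)
  case (Suc H)
  have "\<not> Suc (Suc H) \<le> h j" if "j \<le> N" for j using Suc.prems[OF that] by simp
  then have "set (lev N h (Suc (Suc H))) = {}" by (auto simp: set_lev)
  with Suc show ?case by simp
qed simp

lemma Yu_cong: "(\<And>j. j \<le> N \<Longrightarrow> h j = h' j) \<Longrightarrow> Yu N h H = Yu N h' H"
proof (induction H)
  case (Suc H)
  then have "lev N h (Suc H) = lev N h' (Suc H)"
    unfolding lev_def by (intro filter_cong) auto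
  with Suc show ?case by simp
qed simp

lemma Yw_cong: "(\<And>j. j \<le> N \<Longrightarrow> h j = h' j) \<Longrightarrow> Yw N h = Yw N h'"
  unfolding Yw_def hsz_def using Yu_cong[of N h h'] by simp

section \<open>Lowering a whole path at the cost of a factor\<close>

locale btl_dq = btl_act_nz +
  fixes b :: complex
  assumes dq: "(u, k, w) \<in> dq_rel N b \<Longrightarrow> foldr e u v = sc k (foldr e w v)"
begin

text \<open>The three lowest levels of a path of heights at least 2 are full parity classes:
  \<open>Jw N\<close>, the other class, \<open>Jw N\<close>. The defining relation of the double
  quotient collapses them, and every higher level equals the level two below of the lowered
  path.\<close>

lemma Yu_shift:
  assumes "valid N h" "\<And>j. j \<le> N \<Longrightarrow> 2 \<le> h j"
  shows "foldr e (Yu N h (Suc (Suc (Suc H)))) v = sc b (foldr e (Yu N (\<lambda>j. h j - 2) (Suc H)) v)"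
proof (induction H)
  case 0
  define J' where "J' = filter (\<lambda>j. even (j + N)) [0..<Suc N]"
  have par: "even (h j + j + N) \<and> 2 \<le> h j" if "j \<in> set [0..<Suc N]" for j
    using valid_parity[OF assms(1), of j] assms(2)[of j] that by (simp del: upt_Suc)
  have "lev N h (Suc (Suc (Suc 0))) = Jw N" "lev N (\<lambda>j. h j - 2) (Suc 0) = Jw N" "lev N h (Suc (Suc 0)) = J'"
    unfolding lev_def Jw_eq_filter J'_def
    by (intro filter_cong refl; drule par; presburger)+
  moreover have "lev N h (Suc 0) = Jw N"
    using lev_one[OF assms(1)] by simp
  moreover have "(Jw N @ J' @ Jw N, b, Jw N) \<in> dq_rel N b"
    unfolding Jw_eq_filter J'_def dq_rel_def I1_word_def I2_word_def by (cases "even N") simp_all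
  ultimately show ?case
    using dq[of "Jw N @ J' @ Jw N" b "Jw N" v] by simp
next
  case (Suc H)
  have "lev N h (Suc (Suc (Suc (Suc H)))) = lev N (\<lambda>j. h j - 2) (Suc (Suc H))"
    unfolding lev_def using assms(2) by (intro filter_cong refl) fastforce
  moreover have "set (lev N (\<lambda>j. h j - 2) (Suc (Suc H))) \<subseteq> {..N}"
    by (auto simp: set_lev)
  ultimately show ?case
    using Suc by (simp add: Yu.simps(2)[of N _ "Suc H"] Yu.simps(2)[of N _ "Suc (Suc (Suc H))"] del: Yu.simps)
qed

lemma Y_shift:
  assumes "valid N h" "\<And>j. j \<le> N \<Longrightarrow> 2 \<le> h j"
  shows "foldr e (Yw N h) v = sc b (foldr e (Yw N (\<lambda>j. h j - 2)) v)"
proof -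
  have "hsz N (\<lambda>j. h j - 2) \<le> hsz N h"
    unfolding hsz_def by (intro sum_mono) auto
  then show ?thesis
    using Yu_shift[OF assms, of "hsz N h" v] by (simp only: Yu_stable le_SucI order_refl)
qed

lemma Y_shifts:
  assumes "valid N h" "\<And>j. j \<le> N \<Longrightarrow> h j = h' j + 2 * k"
  shows "foldr e (Yw N h) v = sc (b ^ k) (foldr e (Yw N h') v)"
  using assms
proof (induction k arbitrary: h)
  case 0
  then show ?case using Yw_cong[of N h h'] by simp
next
  case (Suc k)
  have "foldr e (Yw N h) v = sc b (foldr e (Yw N (\<lambda>j. h j - 2)) v)"
    using Suc.prems by (intro Y_shift) auto
  also have "foldr e (Yw N (\<lambda>j. h j - 2)) v = sc (b ^ k) (foldr e (Yw N h') v)"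
  proof (rule Suc.IH)
    show "valid N (\<lambda>j. h j - 2)"
      using Suc.prems by (fastforce simp: valid_def)
  qed (use Suc.prems(2) in auto)
  finally show ?case by simp
qed

end

section \<open>Paths of minimum zero or one\<close>

definition ups :: "bool list \<Rightarrow> nat \<Rightarrow> int" where
  "ups w j = (\<Sum>k<j. if w ! k then 1 else -1)"

definition minup :: "bool list \<Rightarrow> int" where
  "minup w = Min (ups w ` {..length w})"

text \<open>The last summand is the parity correction that makes the final height even; it is also
  the minimum of the path.\<close>

definition can :: "bool list \<Rightarrow> nat \<Rightarrow> nat" where
  "can w j = nat (ups w j - minup w + (ups w (length w) - minup w) mod 2)"

definition wd :: "nat \<Rightarrow> (nat \<Rightarrow> nat) \<Rightarrow> bool list" where
  "wd N h = map (\<lambda>j. h j < h (Suc j)) [0..<N]"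

lemma length_wd [simp]: "length (wd N h) = N"
  by (simp add: wd_def)

lemma ups_Suc: "ups w (Suc j) = ups w j + (if w ! j then 1 else -1)"
  by (simp add: ups_def)

lemma minup_le: "j \<le> length w \<Longrightarrow> minup w \<le> ups w j"
  by (simp add: minup_def)

lemma int_can: "j \<le> length w \<Longrightarrow>
    int (can w j) = ups w j - minup w + (ups w (length w) - minup w) mod 2"
  using minup_le[of j w] by (simp add: can_def)

lemma valid_can: "valid (length w) (can w)"
  unfolding valid_def
proof (intro conjI allI impI)
  fix j assume "j < length w"
  then have "int (can w (Suc j)) = int (can w j) + (if w ! j then 1 else -1)"
    by (simp add: int_can ups_Suc)
  then show "can w (Suc j) = Suc (can w j) \<or> can w j = Suc (can w (Suc j))"
    by (simp split: if_splits)
next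
  have "even (int (can w (length w)))"
    by (simp add: int_can)
  then show "even (can w (length w))" by simp
qed

lemma wd_can: "wd (length w) (can w) = w"
proof (rule nth_equalityI)
  fix j assume "j < length (wd (length w) (can w))"
  then have j: "j < length w" by simp
  then have "int (can w (Suc j)) = int (can w j) + (if w ! j then 1 else -1)"
    by (simp add: int_can ups_Suc)
  with j show "wd (length w) (can w) ! j = w ! j"
    by (simp add: wd_def split: if_splits)
qed simp

lemma ups_wd:
  assumes "valid N h" "j \<le> N"
  shows "ups (wd N h) j = int (h j) - int (h 0)"
  using assms(2)
proof (induction j)
  case (Suc j)
  then have "h (Suc j) = Suc (h j) \<or> h j = Suc (h (Suc j))"
    using assms(1) by (auto simp: valid_def)
  with Suc show ?case by (auto simp: ups_Suc wd_def)
qed (simp add: ups_def)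

lemma can_min: "\<exists>j\<le>length w. can w j = nat ((ups w (length w) - minup w) mod 2)"
proof -
  have "minup w \<in> ups w ` {..length w}"
    unfolding minup_def by (rule Min_in) auto
  then obtain j where "j \<le> length w" "ups w j = minup w"
    unfolding image_iff by (metis atMost_iff)
  then show ?thesis
    by (intro exI[of _ j]) (simp add: can_def)
qed

lemma valid_eq_can_shift:
  assumes "valid N h"
  shows "\<exists>k. \<forall>j\<le>N. h j = can (wd N h) j + 2 * k"
proof -
  let ?w = "wd N h"
  obtain j where j: "j \<le> N" "can ?w j = nat ((ups ?w N - minup ?w) mod 2)"
    using can_min[of ?w] by auto
  define d where "d = int (h 0) + minup ?w - (ups ?w N - minup ?w) mod 2"
  have d: "int (h i) = int (can ?w i) + d" if "i \<le> N" for i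
    using int_can[of i ?w] ups_wd[OF assms that] that by (simp add: d_def)
  have "even (can ?w N)" "even (h N)"
    using valid_can[of ?w] assms by (auto simp: valid_def)
  moreover have "d = int (h N) - int (can ?w N)" using d[of N] by simp
  ultimately have "even d" by simp
  \<comment> \<open>At a lowest point the canonical path has height 0 or 1, which bounds
    \<open>d\<close> below by -1; evenness excludes -1.\<close>
  moreover have "-1 \<le> d" using d[OF j(1)] j(2) by simp
  ultimately have "0 \<le> d" by presburger
  then obtain k where "d = 2 * int k"
    using \<open>even d\<close> that[of "nat (d div 2)"] by simp
  then show ?thesis
    using d by (intro exI[of _ k]) (auto simp flip: of_nat_eq_iff[where 'a=int])
qed

section \<open>The spin chain\<close>

text \<open>The cup on two neighbouring sites. The matching cap has weight \<open>1 / q\<close> on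
  \<open>False\<close>, \<open>True\<close> and 1 on \<open>True\<close>, \<open>False\<close>, so
  that a closed loop counts \<open>q + 1 / q\<close>.\<close>

definition uu :: "complex \<Rightarrow> bool \<Rightarrow> bool \<Rightarrow> complex" where
  "uu q a b = (if a = b then 0 else if b then 1 else q)"

lemma btl_relE:
  assumes "(u, k, w) \<in> btl_rel N \<delta> s1 s2" "1 \<le> N"
  obtains (idem) i where "1 \<le> i" "i < N" "u = [i, i]" "k = \<delta>" "w = [i]"
    | (tl) i j where "1 \<le> i" "i < N" "j = Suc i \<or> i = Suc j" "u = [i, j, i]" "k = 1" "w = [i]"
    | (left) "u = [0, 0]" "k = s1" "w = [0]"
    | (right) "u = [N, N]" "k = s2" "w = [N]"
    | (comm) i j where "i \<le> N" "j \<le> N" "Suc i < j \<or> Suc j < i" "u = [i, j]" "k = 1" "w = [j, i]"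
  using assms(1) unfolding btl_rel_def
proof (elim UnE, goal_cases)
  case 1
  then obtain i where "1 \<le> i" "i \<le> N - 1" "u = [i, i]" "k = \<delta>" "w = [i]" by blast
  with assms(2) show ?case by (intro idem) auto
next
  case 2
  then obtain i j where "1 \<le> i" "i \<le> N - 1" "j = i + 1 \<or> j = i - 1" "u = [i, j, i]" "k = 1" "w = [i]"
    by blast
  with assms(2) show ?case by (intro tl[of i j]) auto
next
  case 3
  with left right show ?case by blast
next
  case 4
  then obtain i j where "i \<le> N" "j \<le> N" "\<bar>int i - int j\<bar> > 1" "u = [i, j]" "k = 1" "w = [j, i]"
    by blast
  then show ?case by (intro comm[of i j]) linarith+
qed

text \<open>A function that does not see the sites in \<open>S\<close> behaves like a scalar for
  operators acting on \<open>S\<close>.\<close>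

definition indep :: "nat set \<Rightarrow> ((nat \<Rightarrow> bool) \<Rightarrow> complex) \<Rightarrow> bool" where
  "indep S f \<longleftrightarrow> (\<forall>x k s. k \<in> S \<longrightarrow> f (x(k := s)) = f x)"

text \<open>The bulk generators act by the Temperley--Lieb operators, \<open>e\<^sub>0\<close> and \<open>e\<^sub>N\<close> by operators of rank one
  and trace \<open>a\<^sub>i + d\<^sub>i\<close> on the first and on the last site. A diagonal gauge transformation shows that
  only the product of \<open>lt\<close> and \<open>rt\<close> matters.\<close>

locale spin =
  fixes N :: nat and q a1 d1 a2 d2 lt rt :: complex
  assumes N_pos: "1 \<le> N"
    and nz: "q \<noteq> 0" "q\<^sup>2 \<noteq> 1" "a1 \<noteq> 0" "d1 \<noteq> 0" "a2 \<noteq> 0" "d2 \<noteq> 0" "lt \<noteq> 0" "rt \<noteq> 0"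
    and s1_nz: "a1 + d1 \<noteq> 0"
    and bl: "a1 / q + q * d1 = 1" and br: "a2 / q + q * d2 = 1"
begin

text \<open>The vectors on strands tied to the left boundary, counted from the left.
  \<open>lv 0\<close> is the vector created by \<open>e_0\<close>; \<open>lv 1\<close> is what
  remains on the other leg when the covector of \<open>e_0\<close> is contracted with a cup.\<close>

definition lv :: "nat \<Rightarrow> bool \<Rightarrow> complex" where
  "lv n s = (if even n then (if s then lt else 1) else (if s then a1 else q * d1 / lt))"

text \<open>The mirror image of \<open>lv\<close>, with strands counted from the right.\<close>

definition rv :: "nat \<Rightarrow> bool \<Rightarrow> complex" where
  "rv k s = (if even k then (if s then 1 else rt) else (if s then q * d2 / rt else a2))"

definition loc :: "nat \<Rightarrow> (nat \<Rightarrow> bool) \<Rightarrow> complex" where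
  "loc i x = (if i = 0 then lv 0 (x 0) else if i = N then rv 0 (x (N - 1)) else uu q (x (i - 1)) (x i))"

definition ctr :: "nat \<Rightarrow> ((nat \<Rightarrow> bool) \<Rightarrow> complex) \<Rightarrow> (nat \<Rightarrow> bool) \<Rightarrow> complex" where
  "ctr i f x = (if i = 0 then a1 * f (x(0 := False)) + d1 / lt * f (x(0 := True))
     else if i = N then d2 / rt * f (x(N - 1 := False)) + a2 * f (x(N - 1 := True))
     else f (x(i - 1 := False, i := True)) / q + f (x(i - 1 := True, i := False)))"

definition sop :: "nat \<Rightarrow> ((nat \<Rightarrow> bool) \<Rightarrow> complex) \<Rightarrow> (nat \<Rightarrow> bool) \<Rightarrow> complex" where
  "sop i f x = loc i x * ctr i f x"

definition sites :: "nat \<Rightarrow> nat set" where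
  "sites i = (if i = 0 then {0} else if i = N then {N - 1} else {i - 1, i})"

abbreviation fsc :: "complex \<Rightarrow> ((nat \<Rightarrow> bool) \<Rightarrow> complex) \<Rightarrow> (nat \<Rightarrow> bool) \<Rightarrow> complex" where
  "fsc c f \<equiv> \<lambda>x. c * f x"

lemma sites_disjoint: "i \<le> N \<Longrightarrow> j \<le> N \<Longrightarrow> Suc i < j \<or> Suc j < i \<Longrightarrow> sites i \<inter> sites j = {}"
  by (auto simp: sites_def)

lemma loc_indep: "i \<le> N \<Longrightarrow> j \<le> N \<Longrightarrow> Suc i < j \<or> Suc j < i \<Longrightarrow> indep (sites i) (loc j)"
  using sites_disjoint[of i j] N_pos by (auto simp: indep_def loc_def sites_def)

lemma ctr_indep_own: "indep (sites i) (ctr i f)"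
proof -
  have "x(i - 1 := s, i - 1 := a, i := b) = x(i - 1 := a, i := b)"
    "x(i := s, i - 1 := a, i := b) = x(i - 1 := a, i := b)" for x :: "nat \<Rightarrow> bool" and s a b
    by auto
  then show ?thesis by (auto simp: indep_def ctr_def sites_def)
qed

lemma ctr_indep: "indep S f \<Longrightarrow> indep S (ctr i f)"
proof (unfold indep_def, intro allI impI)
  fix x k s assume S: "\<forall>x k s. k \<in> S \<longrightarrow> f (x(k := s)) = f x" "k \<in> S"
  have e1: "f ((x(k := s))(j := a)) = f (x(j := a))" for j a
    using S by (cases "j = k") (simp_all add: fun_upd_twist)
  have e2: "f ((x(k := s))(j := a, i := b)) = f (x(j := a, i := b))" for j a b
  proof (cases "k = i")
    case True
    then show ?thesis by (cases "j = i") (simp_all add: fun_upd_twist)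
  next
    case False
    have "f ((x(k := s))(j := a, i := b)) = f ((x(i := b, j := a))(k := s))" if "j \<noteq> k" "j \<noteq> i"
      using that False by (metis fun_upd_twist)
    then show ?thesis
      using S False by (cases "j = k"; cases "j = i") (simp_all add: fun_upd_twist)
  qed
  show "ctr i f (x(k := s)) = ctr i f x"
    unfolding ctr_def using e1 e2 by simp
qed

lemma ctr_mult:
  assumes "indep (sites i) h"
  shows "ctr i (\<lambda>x. h x * f x) x = h x * ctr i f x"
proof -
  have "h (x(i - 1 := a, i := b)) = h x" if "i \<noteq> 0" "i \<noteq> N" for a b
    using assms that by (simp add: indep_def sites_def)
  moreover have "h (x(0 := a)) = h x" if "i = 0" for a
    using assms that by (simp add: indep_def sites_def)
  moreover have "h (x(N - 1 := a)) = h x" if "i = N" for a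
    using assms that N_pos by (simp add: indep_def sites_def)
  ultimately show ?thesis
    by (simp add: ctr_def algebra_simps)
qed

lemma sop_mult: "indep (sites i) h \<Longrightarrow> sop i (\<lambda>x. h x * f x) = (\<lambda>x. h x * sop i f x)"
  by (simp add: sop_def ctr_mult fun_eq_iff)

lemma indep_const: "indep S (\<lambda>x. c)"
  by (simp add: indep_def)

lemma sop_sc: "sop i (fsc c f) = fsc c (sop i f)"
  by (rule sop_mult[OF indep_const])

lemma sop_add: "sop i (\<lambda>x. f x + g x) = (\<lambda>x. sop i f x + sop i g x)"
  by (simp add: sop_def ctr_def fun_eq_iff algebra_simps add_divide_distrib)

lemma ctr_comm:
  assumes "i \<le> N" "j \<le> N" "Suc i < j"
  shows "ctr i (ctr j f) = ctr j (ctr i f)"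
proof
  fix x :: "nat \<Rightarrow> bool"
  have t2: "x(i - 1 := s, i := s', j - 1 := s'', j := s''') = x(j - 1 := s'', j := s''', i - 1 := s, i := s')"
    for s s' s'' s'''
    using assms by (auto simp: fun_eq_iff)
  have t3: "x(i - 1 := s, i := s', j - 1 := s'') = x(j - 1 := s'', i - 1 := s, i := s')" for s s' s''
    using assms by (auto simp: fun_eq_iff)
  have t4: "x(0 := s, j - 1 := s'', j := s''') = x(j - 1 := s'', j := s''', 0 := s)" for s s'' s'''
    using assms by (auto simp: fun_eq_iff)
  have t5: "x(0 := s, j - 1 := s'') = x(j - 1 := s'', 0 := s)" for s s''
    using assms by (auto simp: fun_eq_iff)
  show "ctr i (ctr j f) x = ctr j (ctr i f) x"
    using assms t2 t3 t4 t5
    by (cases "i = 0"; cases "j = N") (simp_all add: ctr_def algebra_simps add_divide_distrib)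
qed

lemma sop_comm:
  assumes "i \<le> N" "j \<le> N" "Suc i < j \<or> Suc j < i"
  shows "sop i (sop j f) = sop j (sop i f)"
proof -
  have "sop i (sop j f) = sop j (sop i f)" if "i \<le> N" "j \<le> N" "Suc i < j" for i j
  proof
    fix x
    have "sop i (sop j f) x = loc i x * (loc j x * ctr i (ctr j f) x)"
      unfolding sop_def[of i] using that loc_indep[of i j] by (simp add: sop_def[abs_def] ctr_mult)
    also have "\<dots> = loc j x * (loc i x * ctr j (ctr i f) x)"
      by (simp add: ctr_comm[OF that])
    also have "\<dots> = sop j (sop i f) x"
      unfolding sop_def[of j] using that loc_indep[of j i] by (simp add: sop_def[abs_def] ctr_mult)
    finally show "sop i (sop j f) x = sop j (sop i f) x" .
  qed
  then show ?thesis using assms by metis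
qed

lemma sop_idem_bulk: "1 \<le> i \<Longrightarrow> i < N \<Longrightarrow> sop i (sop i f) = fsc (q + 1 / q) (sop i f)"
  using nz by (auto simp: fun_eq_iff sop_def loc_def ctr_def uu_def fun_upd_twist field_simps)

lemma sop_idem_left: "sop 0 (sop 0 f) = fsc (a1 + d1) (sop 0 f)"
  using nz by (auto simp: fun_eq_iff sop_def loc_def ctr_def lv_def field_simps)

lemma sop_idem_right: "sop N (sop N f) = fsc (a2 + d2) (sop N f)"
  using nz N_pos by (auto simp: fun_eq_iff sop_def loc_def ctr_def rv_def field_simps)

lemma ctr_eq:
  assumes "\<And>m. m \<notin> sites i \<Longrightarrow> w m = x m"
  shows "ctr i f w = ctr i f x"
proof -
  have "w(i - 1 := s, i := s') = x(i - 1 := s, i := s')" if "i \<noteq> 0" "i \<noteq> N" for s s'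
    using assms that by (auto simp: fun_eq_iff sites_def)
  moreover have "w(0 := s) = x(0 := s)" if "i = 0" for s
    using assms that by (auto simp: fun_eq_iff sites_def)
  moreover have "w(N - 1 := s) = x(N - 1 := s)" if "i = N" for s
    using assms that N_pos by (auto simp: fun_eq_iff sites_def)
  ultimately show ?thesis by (simp add: ctr_def)
qed

lemma sop_bulk: "1 \<le> i \<Longrightarrow> i < N \<Longrightarrow> sop i g x =
    uu q (x (i - 1)) (x i) * (g (x(i - 1 := False, i := True)) / q + g (x(i - 1 := True, i := False)))"
  and sop_left: "sop 0 g x = lv 0 (x 0) * (a1 * g (x(0 := False)) + d1 / lt * g (x(0 := True)))"
  and sop_right: "sop N g x = rv 0 (x (N - 1)) * (d2 / rt * g (x(N - 1 := False)) + a2 * g (x(N - 1 := True)))"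
  using N_pos by (auto simp: sop_def loc_def ctr_def)

lemma sop_tl_up:
  assumes "1 \<le> i" "i < N" "j = Suc i"
  shows "sop i (sop j (sop i f)) = sop i f"
proof
  fix x
  define k where "k = i - 1"
  have k: "i = Suc k" "j = Suc (Suc k)" "1 \<le> i" "i < N"
    using assms by (auto simp: k_def)
  define g where "g = ctr i f"
  have f: "sop i f = (\<lambda>x. uu q (x k) (x i) * g x)"
    using assms by (auto simp: sop_def loc_def k_def g_def fun_eq_iff)
  have G: "g (x(k := a, Suc k := b, Suc (Suc k) := c)) = g x" if "x j = c" for a b c
    using that k unfolding g_def by (intro ctr_eq) (auto simp: sites_def)
  have G0: "g (x(k := a, Suc k := b)) = g x" for a b
    using k unfolding g_def by (intro ctr_eq) (auto simp: sites_def)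
  \<comment> \<open>The normalisation \<open>br\<close>, solved for \<open>a2\<close>, is what makes
    \<open>e_i e_N e_i = e_i\<close> hold next to the right boundary.\<close>
  have b: "a2 = q - q\<^sup>2 * d2" using br nz by (simp add: field_simps power2_eq_square)
  show "sop i (sop j (sop i f)) x = sop i f x"
  proof (cases "j = N")
    case True
    have "sop i (sop N (\<lambda>x. uu q (x k) (x i) * g x)) x = uu q (x k) (x i) * g x"
    proof -
      have "N - Suc 0 = Suc k" using k True by simp
      then show ?thesis
        using k(1,3,4) nz G0 by (simp add: sop_bulk sop_right rv_def uu_def)
          (simp add: b field_simps power2_eq_square)
    qed
    then show ?thesis using f True by simp
  next
    case False
    have "sop i (sop j (\<lambda>x. uu q (x k) (x i) * g x)) x = uu q (x k) (x i) * g x"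
      using k False nz G[of True] G[of False]
      by (cases "x j") (simp_all add: sop_bulk uu_def)
    then show ?thesis using f by simp
  qed
qed

lemma sop_tl_down:
  assumes "1 \<le> i" "i < N" "i = Suc j"
  shows "sop i (sop j (sop i f)) = sop i f"
proof
  fix x
  define g where "g = ctr i f"
  have f: "sop i f = (\<lambda>x. uu q (x j) (x i) * g x)"
    using assms by (auto simp: sop_def loc_def g_def fun_eq_iff)
  \<comment> \<open>The same for the left boundary.\<close>
  have b: "a1 = q - q\<^sup>2 * d1" using bl nz by (simp add: field_simps power2_eq_square)
  show "sop i (sop j (sop i f)) x = sop i f x"
  proof (cases j)
    case 0
    have G0: "g (x(Suc 0 := b, 0 := a)) = g x" for a b
      using assms 0 unfolding g_def by (intro ctr_eq) (auto simp: sites_def)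
    have "sop i (sop 0 (\<lambda>x. uu q (x j) (x i) * g x)) x = uu q (x j) (x i) * g x"
      using 0 assms nz G0 by (simp add: sop_bulk sop_left lv_def uu_def)
        (simp add: b field_simps power2_eq_square)
    then show ?thesis using f 0 by simp
  next
    case (Suc k)
    have G: "g (x(Suc (Suc k) := b, k := c, Suc k := a)) = g x" if "x k = c" for a b c
      using that assms Suc unfolding g_def by (intro ctr_eq) (auto simp: sites_def)
    have "sop i (sop j (\<lambda>x. uu q (x j) (x i) * g x)) x = uu q (x j) (x i) * g x"
      using assms Suc nz G[of True] G[of False]
      by (cases "x k") (simp_all add: sop_bulk uu_def)
    then show ?thesis using f by simp
  qed
qed

sublocale btl_act_nz N sop fsc "q + 1 / q" "a1 + d1" "a2 + d2"
proof
  show "1 \<le> N" by (rule N_pos)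
  show "sop i (fsc c v) = fsc c (sop i v)" for i c v by (rule sop_sc)
  fix u k w v assume "(u, k, w) \<in> btl_rel N (q + 1 / q) (a1 + d1) (a2 + d2)"
  from this N_pos show "foldr sop u v = fsc k (foldr sop w v)"
  proof (cases rule: btl_relE)
    case idem then show ?thesis by (simp add: sop_idem_bulk)
  next
    case tl then show ?thesis using sop_tl_up sop_tl_down by auto
  next
    case left then show ?thesis by (simp add: sop_idem_left)
  next
    case right then show ?thesis by (simp add: sop_idem_right)
  next
    case comm then show ?thesis using sop_comm by simp
  qed
qed (simp_all add: fun_eq_iff s1_nz)

definition gap :: "nat list \<Rightarrow> bool" where
  "gap js \<longleftrightarrow> sorted_wrt (\<lambda>i j. Suc i < j) js"

text \<open>Generators that are far apart act on disjoint sites, so each contraction ignores the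
  local vectors created by the others.\<close>

lemma foldr_sop_ctr:
  assumes "gap js" "set js \<subseteq> {..N}"
  shows "foldr sop js f x = (\<Prod>i\<leftarrow>js. loc i x) * foldr ctr js f x"
  using assms
proof (induction js arbitrary: x)
  case (Cons i js)
  have "indep (sites i) (\<lambda>x. \<Prod>i\<leftarrow>js. loc i x)"
    using Cons.prems
  proof (induction js)
    case (Cons j js)
    then have "indep (sites i) (loc j)" by (intro loc_indep) (auto simp: gap_def)
    with Cons show ?case by (auto simp: indep_def gap_def)
  qed (simp add: indep_def)
  moreover have "foldr sop js f = (\<lambda>x. (\<Prod>i\<leftarrow>js. loc i x) * foldr ctr js f x)"
    using Cons by (auto simp: gap_def)
  ultimately show ?case
    by (simp add: sop_mult) (simp add: sop_def)
qed simp

lemma foldr_ctr_indep: "j \<in> set js \<Longrightarrow> indep (sites j) (foldr ctr js f)"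
proof (induction js)
  case (Cons i js)
  then show ?case
    by (cases "j = i") (auto intro: ctr_indep_own ctr_indep)
qed simp

end

section \<open>Vectors of parenthesis words\<close>

fun rprod :: "(nat \<Rightarrow> bool \<Rightarrow> complex) \<Rightarrow> bool list \<Rightarrow> complex" where
  "rprod r [] = 1"
| "rprod r (s # st) = r 0 s * rprod (\<lambda>k. r (Suc k)) st"

text \<open>The vector of a half diagram, read off a word of parentheses (\<open>True\<close> opens): \<open>st\<close> holds the
  spins of the pending openings, \<open>n\<close> counts the strands already tied to the left boundary.
  Unmatched closings are tied to the left boundary and unmatched openings to the right one.\<close>

fun ev :: "complex \<Rightarrow> (nat \<Rightarrow> bool \<Rightarrow> complex) \<Rightarrow> (nat \<Rightarrow> bool \<Rightarrow> complex) \<Rightarrow> nat \<Rightarrow>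
    bool list \<Rightarrow> bool list \<Rightarrow> bool list \<Rightarrow> complex" where
  "ev q l r n st [] xs = rprod r st"
| "ev q l r n st (c # w) [] = 0"
| "ev q l r n st (True # w) (x # xs) = ev q l r n (x # st) w xs"
| "ev q l r n (s # st) (False # w) (x # xs) = uu q s x * ev q l r n st w xs"
| "ev q l r n [] (False # w) (x # xs) = l n x * ev q l r (Suc n) [] w xs"

text \<open>The number of pending openings after the word has been read, starting with
  \<open>d\<close> of them. The truncated difference is intended: a closing without partner goes to
  the left boundary.\<close>

fun fin :: "nat \<Rightarrow> bool list \<Rightarrow> nat" where
  "fin d [] = d" | "fin d (c # w) = fin (if c then Suc d else d - 1) w"

text \<open>Whether an opening buried under \<open>d\<close> others finds its partner in the
  word.\<close>

fun pops :: "nat \<Rightarrow> bool list \<Rightarrow> bool" where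
  "pops d [] = False" | "pops d (c # w) = (if c then pops (Suc d) w else d = 0 \<or> pops (d - 1) w)"

definition periodic :: "(nat \<Rightarrow> 'b) \<Rightarrow> bool" where
  "periodic f \<longleftrightarrow> (\<forall>k. f (Suc (Suc k)) = f k)"

lemma periodic_parity: "periodic f \<Longrightarrow> even (n + m) \<Longrightarrow> f n = f m"
proof -
  assume p: "periodic f"
  have "f k = f (k mod 2)" for k
  proof (induction k rule: less_induct)
    case (less k)
    show ?case
    proof (cases "k < 2")
      case False
      then obtain j where "k = Suc (Suc j)" by (metis One_nat_def Suc_1 add_2_eq_Suc le_Suc_ex not_less)
      then show ?thesis using less[of j] p by (simp add: periodic_def)
    qed simp
  qed
  moreover assume "even (n + m)"
  then have "n mod 2 = m mod 2" by presburger
  ultimately show ?thesis by metis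
qed

lemma rprod_append: "rprod r (st @ [s]) = rprod r st * r (length st) s"
  by (induction st arbitrary: r) auto

text \<open>Reading a prefix leaves only a scalar, a counter and a stack, whatever the right vectors
  and the rest of the word are. The parity of the counter is recorded because the boundary vectors
  have period two.\<close>

lemma ev_prefix:
  assumes "length p = length xp"
  shows "\<exists>c n' st'. length st' = fin (length st) p \<and> even (n' + length st' + n + length st + length p) \<and>
    (\<forall>r v ys. ev q l r n st (p @ v) (xp @ ys) = c * ev q l r n' st' v ys)"
  using assms
proof (induction p xp arbitrary: n st rule: list_induct2)
  case Nil
  show ?case by (rule exI[of _ "1::complex"], rule exI[of _ n], rule exI[of _ st]) auto
next
  case (Cons c p x xp)
  consider "c" | s st0 where "\<not> c" "st = s # st0" | "\<not> c" "st = []"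
    by (cases st) auto
  then show ?case
  proof cases
    case 1
    with Cons.IH[of "x # st" n] show ?thesis by auto
  next
    case 2
    obtain c' n' st' where "length st' = fin (length st0) p" "even (n' + length st' + n + length st0 + length p)"
        "\<And>r v ys. ev q l r n st0 (p @ v) (xp @ ys) = c' * ev q l r n' st' v ys"
      using Cons.IH[of st0 n] by blast
    with 2 show ?thesis
      by (intro exI[of _ "uu q s x * c'"] exI[of _ n'] exI[of _ st']) simp
  next
    case 3
    obtain c' n' st' where "length st' = fin (length ([] :: bool list)) p" "even (n' + length st' + Suc n + length ([] :: bool list) + length p)"
        "\<And>r v ys. ev q l r (Suc n) [] (p @ v) (xp @ ys) = c' * ev q l r n' st' v ys"
      using Cons.IH[of "[]" "Suc n"] by blast
    with 3 show ?thesis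
      by (intro exI[of _ "l n x * c'"] exI[of _ n'] exI[of _ st']) simp
  qed
qed

lemma ev_parity:
  assumes "periodic l" "even (n + m)"
  shows "ev q l r n st w xs = ev q l r m st w xs"
  using assms
proof (induction q l r n st w xs arbitrary: m rule: ev.induct)
  case (5 q l r n w x xs)
  have "l n = l m" by (rule periodic_parity[OF 5(2,3)])
  with 5 show ?case by simp
qed auto

text \<open>Bringing a pending spin at the bottom of the stack to the left boundary.\<close>

lemma ev_bottom:
  assumes "periodic l" "odd (n + n')" "length s = length ys"
    and "\<And>y. \<alpha> False * uu q False y + \<alpha> True * uu q True y = l n' y"
  shows "\<alpha> False * ev q l r n (st @ [False]) s ys + \<alpha> True * ev q l r n (st @ [True]) s ys
    = (if pops (length st) s then 1
       else \<alpha> False * r (fin (length st) s) False + \<alpha> True * r (fin (length st) s) True)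
      * ev q l r n' st s ys"
  using assms(3)
proof (induction s ys arbitrary: st rule: list_induct2)
  case Nil
  show ?case by (simp add: rprod_append algebra_simps)
next
  case (Cons c s y ys)
  consider "c" | a st0 where "\<not> c" "st = a # st0" | "\<not> c" "st = []"
    by (cases st) auto
  then show ?case
  proof cases
    case 1
    with Cons.IH[of "y # st"] show ?thesis by simp
  next
    case 2
    have "\<alpha> False * (u * A) + \<alpha> True * (u * B) = u * (\<alpha> False * A + \<alpha> True * B)" for u A B
      by (simp add: algebra_simps)
    with 2 Cons.IH[of st0] show ?thesis by simp
  next
    case 3
    \<comment> \<open>The strand now tied to the left boundary takes the number \<open>n'\<close>
      and advances the counter; \<open>n\<close> and \<open>Suc n'\<close> have the same
      parity.\<close>
    have "ev q l r n [] s ys = ev q l r (Suc n') [] s ys"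
      using assms(1,2) by (intro ev_parity) auto
    with 3 show ?thesis
      by (simp add: assms(4)[symmetric] algebra_simps)
  qed
qed

lemma ev_last_True:
  "length w = length xs \<Longrightarrow> ev q l r n st (w @ [True]) (xs @ [z]) = r 0 z * ev q l (\<lambda>k. r (Suc k)) n st w xs"
proof (induction w xs arbitrary: n st rule: list_induct2)
  case (Cons c w x xs)
  then show ?case by (cases c; cases st) auto
qed simp

lemma ev_contract_left:
  assumes "periodic l" "length s = length ys"
    and "\<And>y. \<alpha> False * uu q False y + \<alpha> True * uu q True y = l 1 y"
  shows "\<alpha> False * ev q l r 0 [] (True # s) (False # ys) + \<alpha> True * ev q l r 0 [] (True # s) (True # ys)
    = (if pops 0 s then 1 else \<alpha> False * r (fin 0 s) False + \<alpha> True * r (fin 0 s) True)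
      * ev q l r 1 [] s ys"
  using ev_bottom[OF assms(1) _ assms(2,3), of 0 r "[]"] by simp

text \<open>The cap joins the partner of the closing to the partner of the opening. A scalar appears
  only if both partners are boundaries: the stack is empty and the opening is never closed.\<close>

lemma ev_contract_bulk:
  assumes "periodic l" "q \<noteq> 0" "length s = length ys"
  shows "ev q l r n st (False # True # s) (False # True # ys) / q + ev q l r n st (False # True # s) (True # False # ys)
    = (if st = [] \<and> \<not> pops 0 s then l n False * r (fin 0 s) True / q + l n True * r (fin 0 s) False else 1)
      * ev q l r n st s ys"
proof (cases st)
  case Nil
  define \<alpha> where "\<alpha> z = (if z then l n False / q else l n True)" for z
  have "\<alpha> False * uu q False y + \<alpha> True * uu q True y = l n y" for y
    using assms(2) by (simp add: \<alpha>_def uu_def)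
  from ev_bottom[OF assms(1) _ assms(3) this, of "Suc n" r "[]"] show ?thesis
    using Nil by (simp add: \<alpha>_def algebra_simps)
next
  case (Cons a st')
  with assms(2) show ?thesis by (cases a) (simp_all add: uu_def)
qed

lemma ev_contract_right:
  assumes "periodic r" "length p = length xp"
    and "\<And>x. uu q x False * \<rho> False + uu q x True * \<rho> True = r 1 x"
  shows "\<exists>n'. (fin (length st) p = 0 \<longrightarrow> even (n' + n + length st + length p)) \<and>
     \<rho> False * ev q l r n st (p @ [False]) (xp @ [False]) + \<rho> True * ev q l r n st (p @ [False]) (xp @ [True])
    = (if fin (length st) p = 0 then \<rho> False * l n' False + \<rho> True * l n' True else 1)
      * ev q l (\<lambda>k. r (Suc k)) n st p xp"
proof -
  obtain c n' st' where c: "length st' = fin (length st) p" "even (n' + length st' + n + length st + length p)"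
    "\<And>r v ys. ev q l r n st (p @ v) (xp @ ys) = c * ev q l r n' st' v ys"
    using ev_prefix[OF assms(2)] by blast
  have p: "ev q l (\<lambda>k. r (Suc k)) n st p xp = c * rprod (\<lambda>k. r (Suc k)) st'"
    using c(3)[of "\<lambda>k. r (Suc k)" "[]" "[]"] by simp
  have r2: "(\<lambda>k. r (Suc (Suc k))) = r"
    using assms(1) by (auto simp: periodic_def)
  show ?thesis
  proof (cases st')
    case Nil
    then show ?thesis
      using c p by (intro exI[of _ n']) (simp add: algebra_simps)
  next
    case (Cons a st0)
    have "\<rho> False * (c * (uu q a False * R)) + \<rho> True * (c * (uu q a True * R)) = c * (r 1 a * R)" for R
      unfolding assms(3)[symmetric] by (simp add: algebra_simps)
    then show ?thesis
      using c p Cons r2 by (intro exI[of _ n']) simp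
  qed
qed

lemma fin_parity: "\<not> pops d s \<Longrightarrow> even (fin d s + d + length s)"
  by (induction d s rule: fin.induct) (auto split: if_splits)

section \<open>Stack conditions in terms of heights\<close>

context
  fixes h :: "nat \<Rightarrow> nat"
begin

lemma fin_path:
  assumes "a \<le> b" "\<And>j. a \<le> j \<Longrightarrow> j < b \<Longrightarrow> h (Suc j) = Suc (h j) \<or> h j = Suc (h (Suc j))"
  shows "fin d (map (\<lambda>j. h j < h (Suc j)) [a..<b]) = 0 \<longleftrightarrow> (\<forall>j\<in>{a..b}. h b \<le> h j) \<and> d + h b \<le> h a"
  using assms
proof (induction a arbitrary: d rule: inc_induct)
  case base
  show ?case by auto
next
  case (step a)
  have IH: "fin d (map (\<lambda>j. h j < h (Suc j)) [Suc a..<b]) = 0 \<longleftrightarrow> (\<forall>j\<in>{Suc a..b}. h b \<le> h j) \<and> d + h b \<le> h (Suc a)" for d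
    using step by auto
  have "{a..b} = insert a {Suc a..b}" using step.hyps by auto
  then have split: "(\<forall>j\<in>{a..b}. h b \<le> h j) \<longleftrightarrow> h b \<le> h a \<and> (\<forall>j\<in>{Suc a..b}. h b \<le> h j)"
    by simp
  define Q where "Q \<longleftrightarrow> (\<forall>j\<in>{Suc a..b}. h b \<le> h j)"
  have "Q \<Longrightarrow> h b \<le> h (Suc a)" using step.hyps by (simp add: Q_def)
  moreover have "h (Suc a) = Suc (h a) \<or> h a = Suc (h (Suc a))"
    using step.prems[of a] step.hyps by auto
  ultimately show ?case
    unfolding upt_conv_Cons[OF step.hyps(2)] split list.map fin.simps IH Q_def[symmetric]
    by (cases d; cases Q) auto
qed

lemma pops_path:
  assumes "a \<le> b" "\<And>j. a \<le> j \<Longrightarrow> j < b \<Longrightarrow> h (Suc j) = Suc (h j) \<or> h j = Suc (h (Suc j))"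
  shows "pops d (map (\<lambda>j. h j < h (Suc j)) [a..<b]) \<longleftrightarrow> (\<exists>j\<in>{a..b}. d + h j < h a)"
  using assms
proof (induction a arbitrary: d rule: inc_induct)
  case base
  show ?case by auto
next
  case (step a)
  have IH: "pops d (map (\<lambda>j. h j < h (Suc j)) [Suc a..<b]) \<longleftrightarrow> (\<exists>j\<in>{Suc a..b}. d + h j < h (Suc a))" for d
    using step by auto
  have "{a..b} = insert a {Suc a..b}" using step.hyps by auto
  then have split: "(\<exists>j\<in>{a..b}. P j) \<longleftrightarrow> P a \<or> (\<exists>j\<in>{Suc a..b}. P j)" for P
    by simp
  have mem: "Suc a \<in> {Suc a..b}" using step.hyps by auto
  consider "h (Suc a) = Suc (h a)" | "h a = Suc (h (Suc a))" "d = 0"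
    | d' where "h a = Suc (h (Suc a))" "d = Suc d'"
    using step.prems[of a] step.hyps by (cases d) auto
  then show ?case
    unfolding upt_conv_Cons[OF step.hyps(2)] split list.map pops.simps IH
  proof cases
    case 2
    then have "\<exists>j\<in>{Suc a..b}. d + h j < h a" using mem by (intro bexI[of _ "Suc a"]) simp
    then show "(if h a < h (Suc a) then \<exists>j\<in>{Suc a..b}. Suc d + h j < h (Suc a)
      else d = 0 \<or> (\<exists>j\<in>{Suc a..b}. d - 1 + h j < h (Suc a))) =
      (d + h a < h a \<or> (\<exists>j\<in>{Suc a..b}. d + h j < h a))"
      using 2 by simp
  qed simp_all
qed

end

lemma mu_mem: "Min (h ` {..N::nat}) \<in> h ` {..N}" for h :: "nat \<Rightarrow> nat"
  by (rule Min_in) auto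

definition mu :: "nat \<Rightarrow> (nat \<Rightarrow> nat) \<Rightarrow> nat" where "mu N h = Min (h ` {..N})"

lemma mu_le: "j \<le> N \<Longrightarrow> mu N h \<le> h j"
  by (simp add: mu_def)

lemma mu_eqI: "(\<And>j. j \<le> N \<Longrightarrow> m \<le> h j) \<Longrightarrow> j \<le> N \<Longrightarrow> h j = m \<Longrightarrow> mu N h = m"
  unfolding mu_def by (rule Min_eqI) auto

lemma mu_attained: "\<exists>j\<le>N. h j = mu N h"
  using mu_mem[of h N] unfolding mu_def image_iff by (metis atMost_iff)

text \<open>Only raising the unique lowest point changes the minimum, and by one, since the
  neighbours of a valley are one higher.\<close>

lemma mu_raise:
  assumes "1 \<le> N" "i \<le> N" "valley N h i"
  shows "mu N (h(i := h i + 2)) = mu N h + (if \<forall>j\<le>N. j \<noteq> i \<longrightarrow> h i < h j then 1 else 0)"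
    and "(\<forall>j\<le>N. j \<noteq> i \<longrightarrow> h i < h j) \<Longrightarrow> mu N h = h i"
proof -
  show m: "mu N h = h i" if "\<forall>j\<le>N. j \<noteq> i \<longrightarrow> h i < h j"
    using that assms(2) by (intro mu_eqI[of N "h i" h i]) (metis less_imp_le order_refl, auto)
  show "mu N (h(i := h i + 2)) = mu N h + (if \<forall>j\<le>N. j \<noteq> i \<longrightarrow> h i < h j then 1 else 0)"
  proof (cases "\<forall>j\<le>N. j \<noteq> i \<longrightarrow> h i < h j")
    case True
    obtain k where k: "nbr N i k" "k \<le> N" "k \<noteq> i"
    proof -
      show thesis
        using that[of 1] that[of "i - 1"] assms(1,2) by (cases "i = 0") (auto simp: nbr_def)
    qed
    then have "(h(i := h i + 2)) k = Suc (h i)" using assms(3) by (simp add: valley_def)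
    moreover have "Suc (h i) \<le> (h(i := h i + 2)) j" if "j \<le> N" for j
      using True that by (simp add: Suc_le_eq)
    ultimately have "mu N (h(i := h i + 2)) = Suc (h i)"
      using k(2) by (intro mu_eqI)
    then show ?thesis using True m[OF True] by simp
  next
    case False
    then obtain j where j: "j \<le> N" "j \<noteq> i" "h j \<le> h i" by (meson not_le)
    obtain k where k: "k \<le> N" "h k = mu N h" using mu_attained by blast
    have "\<exists>k\<le>N. k \<noteq> i \<and> h k = mu N h"
    proof (cases "k = i")
      case True
      then have "h j = mu N h" using j k mu_le[OF j(1), of h] by simp
      with j show ?thesis by blast
    qed (use k in auto)
    then obtain k where k: "k \<le> N" "k \<noteq> i" "h k = mu N h" by blast
    have "mu N h \<le> (h(i := h i + 2)) j" if "j \<le> N" for j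
      using mu_le[OF that, of h] by auto
    then have "mu N (h(i := h i + 2)) = mu N h"
      using k by (intro mu_eqI[of N _ _ k]) auto
    then show ?thesis using False by simp
  qed
qed

lemma gap_filter_parity: "sorted_wrt (\<lambda>i j. Suc i < j) (filter (\<lambda>i. even (i + c)) [0..<n])" for c :: nat
proof -
  have "sorted_wrt (<) (filter (\<lambda>i. even (i + c)) [0..<n])"
    by (intro sorted_wrt_filter) simp
  then show ?thesis
  proof (rule sorted_wrt_mono_rel[rotated])
    fix i j assume "i \<in> set (filter (\<lambda>i. even (i + c)) [0..<n])" "j \<in> set (filter (\<lambda>i. even (i + c)) [0..<n])" "i < j"
    then have "even (i + c)" "even (j + c)" "i < j" by auto
    then show "Suc i < j" by presburger
  qed
qed

definition cls :: "nat \<Rightarrow> nat \<Rightarrow> nat list" where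
  "cls N c = filter (\<lambda>i. even (i + c)) [0..<Suc N]"

text \<open>Of the two zigzags between \<open>m\<close> and \<open>Suc m\<close> this is the one
  with even height at \<open>N\<close>.\<close>

definition zz :: "nat \<Rightarrow> nat \<Rightarrow> nat \<Rightarrow> nat" where
  "zz N m j = (if even (j + N + m) then m else Suc m)"

lemma set_cls: "set (cls N c) = {i. i \<le> N \<and> even (i + c)}"
  by (auto simp: cls_def simp del: upt_Suc)

lemma Jw_cls: "Jw N = cls N (Suc N)"
  unfolding Jw_eq_filter cls_def by simp

lemma valid_zz: "valid N (zz N m)"
  by (auto simp: valid_def zz_def)

lemma mu_zz: "1 \<le> N \<Longrightarrow> mu N (zz N m) = m"
  by (rule mu_eqI[of N m _ "if even (N + m) then 0 else 1"]) (auto simp: zz_def)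

section \<open>The generators acting on half diagram vectors\<close>

context spin
begin

definition Psi :: "bool list \<Rightarrow> (nat \<Rightarrow> bool) \<Rightarrow> complex" where
  "Psi w x = ev q lv rv 0 [] w (map x [0..<N])"

lemma periodic_lv: "periodic lv" and periodic_rv: "periodic rv"
  by (auto simp: periodic_def lv_def rv_def fun_eq_iff)

text \<open>The cap applied to the left boundary vector \<open>n\<close> and the right boundary
  vector \<open>k\<close>: the weight of a strand joining the two boundaries.\<close>

definition pr :: "nat \<Rightarrow> nat \<Rightarrow> complex" where
  "pr n k = lv n False * rv k True / q + lv n True * rv k False"

text \<open>The weight released when a unique lowest point of height \<open>m\<close> is
  raised.\<close>

definition KK :: "nat \<Rightarrow> complex" where "KK m = pr (N + m + 1) (m + 1)"

lemma pr_parity: "even (n + n') \<Longrightarrow> even (k + k') \<Longrightarrow> pr n k = pr n' k'"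
  unfolding pr_def using periodic_parity[OF periodic_lv, of n n'] periodic_parity[OF periodic_rv, of k k'] by simp

lemma pr_left: "a1 * rv k False + d1 / lt * rv k True = pr 1 k"
  using nz by (simp add: pr_def lv_def)

lemma pr_right: "d2 / rt * lv n False + a2 * lv n True = pr n 1"
  using nz by (simp add: pr_def rv_def)

lemma KK_parity: "even (m + m') \<Longrightarrow> KK m = KK m'"
  unfolding KK_def by (rule pr_parity) auto

text \<open>In the bulk, raising a valley replaces a closing followed by an opening by an opening
  followed by a closing, and the cap connects the former partners. They are the left and the right
  boundary exactly when \<open>i\<close> is the unique lowest point, so only then does a weight
  appear. At an end of the chain the boundary covector takes the place of the cap.\<close>

lemma sop_Psi:
  assumes "valid N h" "i \<le> N" "valley N h i"
  shows "sop i (Psi (wd N h)) x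
    = (if \<forall>j\<le>N. j \<noteq> i \<longrightarrow> h i < h j then KK (h i) else 1) * Psi (wd N (h(i := h i + 2))) x"
proof -
  define W where "W a b = map (\<lambda>j. h j < h (Suc j)) [a..<b]" for a b
  define h' where "h' = h(i := h i + 2)"
  define U where "U \<longleftrightarrow> (\<forall>j\<le>N. j \<noteq> i \<longrightarrow> h i < h j)"
  have par: "even (h i + i + N)" using valid_parity[OF assms(1,2)] .
  have stp: "h (Suc j) = Suc (h j) \<or> h j = Suc (h (Suc j))" if "j < N" for j
    using assms(1) that by (auto simp: valid_def)
  have W': "map (\<lambda>j. h' j < h' (Suc j)) [a..<b] = W a b" if "b < i \<or> i < a" for a b
    unfolding W_def using that by (intro map_cong refl) (auto simp: h'_def)
  consider (left) "i = 0" | (right) "i = N" | (bulk) "1 \<le> i" "i < N" using assms(2) N_pos by linarith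
  then have "sop i (Psi (wd N h)) x
    = (if \<forall>j\<le>N. j \<noteq> i \<longrightarrow> h i < h j then KK (h i) else 1) * Psi (wd N h') x"
  proof cases
    case left
    have up: "h (Suc 0) = Suc (h 0)" using assms(3) left N_pos by (simp add: valley_def nbr_def)
    have split: "[0..<N] = 0 # [Suc 0..<N]" using N_pos by (simp add: upt_conv_Cons)
    have w: "wd N h = True # W (Suc 0) N" "wd N h' = False # W (Suc 0) N"
      unfolding wd_def split list.map using W'[of N "Suc 0"] left up by (auto simp: W_def h'_def)
    define ys where "ys = map x [Suc 0..<N]"
    have m: "map (x(0 := s)) [0..<N] = s # ys" for s
      unfolding split list.map ys_def by auto
    have pops: "pops 0 (W (Suc 0) N) \<longleftrightarrow> \<not> (\<forall>j\<le>N. j \<noteq> i \<longrightarrow> h i < h j)"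
      unfolding W_def using stp N_pos left up by (subst pops_path) (auto simp: not_less Suc_le_eq less_Suc_eq_le)
    have fn: "\<not> pops 0 (W (Suc 0) N) \<Longrightarrow> pr 1 (fin 0 (W (Suc 0) N)) = KK (h i)"
      using fin_parity[of 0 "W (Suc 0) N"] par left N_pos unfolding KK_def
      by (intro pr_parity) (auto simp: W_def)
    have lv1: "a1 * uu q False y + d1 / lt * uu q True y = lv 1 y" for y
      using nz by (simp add: uu_def lv_def)
    have len: "length (W (Suc 0) N) = length ys" by (simp add: W_def ys_def)
    have "a1 * Psi (wd N h) (x(0 := False)) + d1 / lt * Psi (wd N h) (x(0 := True))
      = (if pops 0 (W (Suc 0) N) then 1 else pr 1 (fin 0 (W (Suc 0) N))) * ev q lv rv 1 [] (W (Suc 0) N) ys"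
      using ev_contract_left[OF periodic_lv len, of "\<lambda>s. if s then d1 / lt else a1" q rv,
          unfolded if_True if_False pr_left, OF lv1]
      by (simp only: Psi_def w m)
    moreover have "Psi (wd N h') x = lv 0 (x 0) * ev q lv rv 1 [] (W (Suc 0) N) ys"
      using m[of "x 0"] by (simp add: Psi_def w)
    ultimately show ?thesis
      using pops fn left unfolding U_def[symmetric] by (simp add: sop_left)
  next
    case right
    then have N: "N = Suc (N - 1)" "N - 1 < N" using N_pos by auto
    define k where "k = N - 1"
    have k: "N = Suc k" using N by (simp add: k_def)
    have dn: "h k = Suc (h N)" using assms(3) right k by (simp add: valley_def nbr_def)
    have split: "[0..<N] = [0..<k] @ [k]" using k by simp
    have w: "wd N h = W 0 k @ [False]" "wd N h' = W 0 k @ [True]"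
      unfolding wd_def split map_append list.map using W'[of k 0] right dn k by (auto simp: W_def h'_def)
    define xp where "xp = map x [0..<k]"
    have m: "map (x(k := s)) [0..<N] = xp @ [s]" for s
      unfolding split map_append list.map xp_def by auto
    have fin0: "fin 0 (W 0 k) = 0 \<longleftrightarrow> (\<forall>j\<le>N. j \<noteq> i \<longrightarrow> h i < h j)"
    proof -
      have "fin 0 (W 0 k) = 0 \<longleftrightarrow> (\<forall>j\<le>k. h k \<le> h j)"
        unfolding W_def using stp k by (subst fin_path) auto
      also have "\<dots> \<longleftrightarrow> (\<forall>j\<le>N. j \<noteq> i \<longrightarrow> h i < h j)"
        using right dn k by (auto simp: Suc_le_eq le_Suc_eq)
      finally show ?thesis .
    qed
    have rv1: "uu q s False * (d2 / rt) + uu q s True * a2 = rv 1 s" for s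
      using nz by (simp add: uu_def rv_def)
    have len: "length (W 0 k) = length xp" by (simp add: W_def xp_def)
    have "\<exists>n'. (fin 0 (W 0 k) = 0 \<longrightarrow> even (n' + length (W 0 k))) \<and>
      d2 / rt * ev q lv rv 0 [] (W 0 k @ [False]) (xp @ [False]) + a2 * ev q lv rv 0 [] (W 0 k @ [False]) (xp @ [True])
       = (if fin 0 (W 0 k) = 0 then pr n' 1 else 1) * ev q lv (\<lambda>k. rv (Suc k)) 0 [] (W 0 k) xp"
      using ev_contract_right[OF periodic_rv len, of q "\<lambda>s. if s then a2 else d2 / rt" "[]" 0 lv,
          unfolded if_True if_False pr_right list.size add_0_right, OF rv1] by blast
    then obtain n' where n': "fin 0 (W 0 k) = 0 \<longrightarrow> even (n' + length (W 0 k))"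
      "d2 / rt * ev q lv rv 0 [] (W 0 k @ [False]) (xp @ [False]) + a2 * ev q lv rv 0 [] (W 0 k @ [False]) (xp @ [True])
       = (if fin 0 (W 0 k) = 0 then pr n' 1 else 1) * ev q lv (\<lambda>k. rv (Suc k)) 0 [] (W 0 k) xp"
      using that by (elim exE conjE)
    have fn: "fin 0 (W 0 k) = 0 \<Longrightarrow> pr n' 1 = KK (h i)"
      using n'(1) par right k unfolding KK_def by (intro pr_parity) (auto simp: W_def)
    have "Psi (wd N h') x = rv 0 (x k) * ev q lv (\<lambda>k. rv (Suc k)) 0 [] (W 0 k) xp"
      using m[of "x k"] ev_last_True[OF len] by (simp add: Psi_def w)
    moreover have "d2 / rt * Psi (wd N h) (x(k := False)) + a2 * Psi (wd N h) (x(k := True))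
       = (if fin 0 (W 0 k) = 0 then pr n' 1 else 1) * ev q lv (\<lambda>k. rv (Suc k)) 0 [] (W 0 k) xp"
      unfolding n'(2)[symmetric] by (simp add: Psi_def w m)
    ultimately show ?thesis
      using fin0 fn right unfolding U_def[symmetric]
      by (simp add: sop_right[of "Psi (wd N h)" x, folded k_def])
  next
    case bulk
    define k where "k = i - 1"
    have k: "i = Suc k" "k < N" using bulk by (auto simp: k_def)
    have nb: "h k = Suc (h i)" "h (Suc i) = Suc (h i)"
      using assms(3) bulk k by (auto simp: valley_def nbr_def)
    have split: "[0..<N] = [0..<k] @ [k, i] @ [Suc i..<N]"
      using k bulk upt_add_eq_append[of 0 k "N - k"] upt_conv_Cons[of k N] upt_conv_Cons[of i N] by simp
    have w: "wd N h = W 0 k @ [False, True] @ W (Suc i) N" "wd N h' = W 0 k @ [True, False] @ W (Suc i) N"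
      unfolding wd_def split map_append list.map using W'[of k 0] W'[of N "Suc i"] k nb by (auto simp: W_def h'_def)
    define xp ys where "xp = map x [0..<k]" and "ys = map x [Suc i..<N]"
    have m: "map (x(k := s, i := s')) [0..<N] = xp @ [s, s'] @ ys" for s s'
      unfolding split map_append list.map xp_def ys_def using k by auto
    have lenp: "length (W 0 k) = length xp" and len: "length (W (Suc i) N) = length ys"
      by (simp_all add: W_def xp_def ys_def)
    obtain c n' st' where c: "length st' = fin 0 (W 0 k)" "even (n' + length st' + length (W 0 k))"
      "\<And>v ys. ev q lv rv 0 [] (W 0 k @ v) (xp @ ys) = c * ev q lv rv n' st' v ys"
      using ev_prefix[OF lenp, of "[]" 0 q lv, unfolded list.size add_0_right] by blast
    have fin0: "st' = [] \<longleftrightarrow> (\<forall>j<i. h i < h j)"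
    proof -
      have "st' = [] \<longleftrightarrow> fin 0 (W 0 k) = 0" using c(1) by (metis length_0_conv)
      also have "\<dots> \<longleftrightarrow> (\<forall>j\<le>k. h k \<le> h j)"
        unfolding W_def using stp k by (subst fin_path) auto
      finally show ?thesis using k nb by (auto simp: Suc_le_eq less_Suc_eq_le)
    qed
    have pops: "\<not> pops 0 (W (Suc i) N) \<longleftrightarrow> (\<forall>j\<in>{Suc i..N}. h i < h j)"
      unfolding W_def using stp bulk nb by (subst pops_path) (auto simp: not_less Suc_le_eq)
    have uniq: "(\<forall>j\<le>N. j \<noteq> i \<longrightarrow> h i < h j) \<longleftrightarrow> st' = [] \<and> \<not> pops 0 (W (Suc i) N)"
      unfolding fin0 pops using bulk by (auto simp: Suc_le_eq)
    have fn: "st' = [] \<and> \<not> pops 0 (W (Suc i) N) \<Longrightarrow> pr n' (fin 0 (W (Suc i) N)) = KK (h i)"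
      using fin_parity[of 0 "W (Suc i) N"] par bulk k c(2) unfolding KK_def
      by (intro pr_parity) (auto simp: W_def)
    have "Psi (wd N h) (x(k := False, i := True)) / q + Psi (wd N h) (x(k := True, i := False))
      = c * (ev q lv rv n' st' (False # True # W (Suc i) N) (False # True # ys) / q
           + ev q lv rv n' st' (False # True # W (Suc i) N) (True # False # ys))"
      unfolding Psi_def w m c(3) by (simp add: algebra_simps)
    also have "\<dots> = c * ((if st' = [] \<and> \<not> pops 0 (W (Suc i) N) then pr n' (fin 0 (W (Suc i) N)) else 1)
        * ev q lv rv n' st' (W (Suc i) N) ys)"
      using ev_contract_bulk[OF periodic_lv _ len, of q rv n' st'] nz by (simp add: pr_def)
    finally have A: "Psi (wd N h) (x(k := False, i := True)) / q + Psi (wd N h) (x(k := True, i := False))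
      = c * ((if st' = [] \<and> \<not> pops 0 (W (Suc i) N) then pr n' (fin 0 (W (Suc i) N)) else 1)
        * ev q lv rv n' st' (W (Suc i) N) ys)" .
    have B: "Psi (wd N h') x = c * (uu q (x k) (x i) * ev q lv rv n' st' (W (Suc i) N) ys)"
      using m[of "x k" "x i"] by (simp add: Psi_def w c(3))
    show ?thesis
      using A B uniq fn unfolding U_def[symmetric]
      by (simp add: sop_bulk[OF bulk, of "Psi (wd N h)" x, folded k_def])
  qed
  then show ?thesis by (simp only: h'_def)
qed

text \<open>The weights gathered while the minimum grows from \<open>m0\<close> to \<open>m\<close>.
  Including them in \<open>Phi\<close> absorbs the weight of \<open>sop_Psi\<close>: a generator at
  a valley just raises the path.\<close>

definition kap :: "nat \<Rightarrow> nat \<Rightarrow> complex" where "kap m0 m = (\<Prod>k=m0..<m. KK k)"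

definition Phi :: "nat \<Rightarrow> (nat \<Rightarrow> nat) \<Rightarrow> (nat \<Rightarrow> bool) \<Rightarrow> complex" where
  "Phi m0 h = fsc (kap m0 (mu N h)) (Psi (wd N h))"

lemma sop_Phi:
  assumes "valid N h" "i \<le> N" "valley N h i" "m0 \<le> mu N h"
  shows "sop i (Phi m0 h) = Phi m0 (h(i := h i + 2))"
proof
  fix x
  have "sop i (Phi m0 h) x = kap m0 (mu N h) * sop i (Psi (wd N h)) x"
    unfolding Phi_def sop_sc by simp
  also have "\<dots> = Phi m0 (h(i := h i + 2)) x"
  proof (cases "\<forall>j\<le>N. j \<noteq> i \<longrightarrow> h i < h j")
    case True
    then have "kap m0 (mu N (h(i := h i + 2))) = kap m0 (mu N h) * KK (h i)"
      using mu_raise[OF N_pos assms(2,3)] assms(4) by (simp add: kap_def)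
    then show ?thesis
      unfolding sop_Psi[OF assms(1-3)] Phi_def using True by simp
  next
    case False
    then have "mu N (h(i := h i + 2)) = mu N h"
      using mu_raise(1)[OF N_pos assms(2,3)] by simp
    then show ?thesis
      unfolding sop_Psi[OF assms(1-3)] Phi_def if_not_P[OF False] by simp
  qed
  finally show "sop i (Phi m0 h) x = Phi m0 (h(i := h i + 2)) x" .
qed

lemma sop_local: "i \<le> N \<Longrightarrow> sites i \<subseteq> {..<N}"
  using N_pos by (auto simp: sites_def)

lemma indep_mono: "indep S f \<Longrightarrow> T \<subseteq> S \<Longrightarrow> indep T f"
  unfolding indep_def by blast

lemma foldr_sop_mult:
  "indep {..<N} g \<Longrightarrow> set js \<subseteq> {..N} \<Longrightarrow> foldr sop js (\<lambda>x. g x * f x) = (\<lambda>x. g x * foldr sop js f x)"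
proof (induction js)
  case (Cons i js)
  have i: "indep (sites i) g"
    using Cons.prems by (intro indep_mono[OF Cons.prems(1)] sop_local) simp
  have js: "set js \<subseteq> {..N}" using Cons.prems(2) by simp
  show ?case
    by (simp only: foldr_Cons comp_def Cons.IH[OF Cons.prems(1) js] sop_mult[OF i])
qed simp

lemma foldr_sop_Phi:
  assumes "gap js" "set js \<subseteq> {..N}" "valid N h" "m0 \<le> mu N h" "\<And>i. i \<in> set js \<Longrightarrow> valley N h i"
  shows "foldr sop js (Phi m0 h) = Phi m0 (\<lambda>j. if j \<in> set js then h j + 2 else h j)
    \<and> valid N (\<lambda>j. if j \<in> set js then h j + 2 else h j)"
  using assms
proof (induction js)
  case Nil
  then show ?case by (simp add: Phi_def)
next
  case (Cons i js)
  let ?h = "\<lambda>j. if j \<in> set js then h j + 2 else h j"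
  have IH: "foldr sop js (Phi m0 h) = Phi m0 ?h" "valid N ?h"
    using Cons by (auto simp: gap_def)
  have i: "i \<notin> set js" "\<And>j. j \<in> set js \<Longrightarrow> \<not> nbr N i j" "i \<le> N"
    using Cons.prems(1,2) by (auto simp: gap_def nbr_def)
  have v: "valley N ?h i"
    unfolding valley_def
  proof (intro allI impI)
    fix j assume j: "nbr N i j"
    then have "j \<notin> set js" using i(2) by blast
    moreover have "h j = Suc (h i)" using Cons.prems(5)[of i] j by (simp add: valley_def)
    ultimately show "?h j = Suc (?h i)" using i(1) by simp
  qed
  obtain k where k: "k \<le> N" "?h k = mu N ?h" using mu_attained[of N ?h] by blast
  have "mu N h \<le> h k" using k(1) by (rule mu_le)
  also have "\<dots> \<le> ?h k" by simp
  finally have "m0 \<le> mu N ?h" using Cons.prems(4) k(2) by simp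
  then have "sop i (Phi m0 ?h) = Phi m0 (?h(i := ?h i + 2))" "valid N (?h(i := ?h i + 2))"
    using sop_Phi[OF IH(2) i(3) v] valid_raise[OF IH(2) i(3) v] by auto
  moreover have "?h(i := ?h i + 2) = (\<lambda>j. if j \<in> set (i # js) then h j + 2 else h j)"
    using i(1) by (auto simp: fun_eq_iff)
  ultimately show ?case using IH(1) by simp
qed

lemma gap_cls: "gap (cls N c)"
  unfolding gap_def cls_def by (rule gap_filter_parity)

lemma Phi_cong: "(\<And>j. j \<le> N \<Longrightarrow> h j = h' j) \<Longrightarrow> Phi m0 h = Phi m0 h'"
proof -
  assume a: "\<And>j. j \<le> N \<Longrightarrow> h j = h' j"
  have "h ` {..N} = h' ` {..N}" using a by (intro image_cong) auto
  then have "mu N h = mu N h'" by (simp add: mu_def)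
  moreover have "wd N h = wd N h'" unfolding wd_def using a by (intro map_cong refl) auto
  ultimately show ?thesis by (simp add: Phi_def)
qed

text \<open>The parity class consists of all low points of the zigzag, so the product raises each of
  them by two.\<close>

lemma foldr_sop_zz:
  assumes "m0 \<le> m"
  shows "foldr sop (cls N (N + m)) (Phi m0 (zz N m)) = Phi m0 (zz N (Suc m))"
proof -
  have "foldr sop (cls N (N + m)) (Phi m0 (zz N m))
      = Phi m0 (\<lambda>j. if j \<in> set (cls N (N + m)) then zz N m j + 2 else zz N m j)"
    using assms mu_zz[OF N_pos, of m]
    by (intro conjunct1[OF foldr_sop_Phi] gap_cls valid_zz) (auto simp: set_cls valley_def nbr_def zz_def)
  also have "\<dots> = Phi m0 (zz N (Suc m))"
    by (rule Phi_cong) (auto simp: set_cls zz_def)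
  finally show ?thesis .
qed

definition alt :: "nat \<Rightarrow> bool list" where "alt c = map (\<lambda>j. even (Suc j + c)) [0..<N]"

lemma wd_zz: "wd N (zz N m) = alt (Suc (N + m))"
  unfolding wd_def alt_def by (intro map_cong refl) (auto simp: zz_def)

lemma ev_alt:
  assumes "j \<le> N" "even (Suc j + c)"
  shows "ev q lv rv n [] (map (\<lambda>j. even (Suc j + c)) [j..<N]) (map x [j..<N])
    = (\<Prod>i\<leftarrow>filter (\<lambda>i. even (i + c)) [Suc j..<Suc N]. loc i x)"
  using assms
proof (induction "N - j" arbitrary: j rule: less_induct)
  case less
  consider "j = N" | "Suc j = N" | "Suc (Suc j) \<le> N" using less.prems(1) by linarith
  then show ?case
  proof cases
    case 2
    then have s: "[j..<N] = [j]" "[Suc j..<Suc N] = [N]" by auto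
    have t: "map (\<lambda>j. even (Suc j + c)) [j] = [True]" using less.prems(2) by simp
    have "even (N + c)" "N - 1 = j" using less.prems(2) 2 by auto
    then show ?thesis
      unfolding s t using N_pos by (simp add: loc_def)
  next
    case 3
    then have s: "[j..<N] = j # Suc j # [Suc (Suc j)..<N]"
        "[Suc j..<Suc N] = Suc j # Suc (Suc j) # [Suc (Suc (Suc j))..<Suc N]"
      using upt_conv_Cons[of j N] upt_conv_Cons[of "Suc j" N] upt_conv_Cons[of "Suc j" "Suc N"]
        upt_conv_Cons[of "Suc (Suc j)" "Suc N"] by auto
    have IH: "ev q lv rv n [] (map (\<lambda>j. even (Suc j + c)) [Suc (Suc j)..<N]) (map x [Suc (Suc j)..<N])
      = (\<Prod>i\<leftarrow>filter (\<lambda>i. even (i + c)) [Suc (Suc (Suc j))..<Suc N]. loc i x)"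
      using less.prems 3 by (intro less.hyps) auto
    have e: "even (Suc j + c) = True" "even (Suc (Suc j) + c) = False" using less.prems(2) by auto
    have l: "loc (Suc j) x = uu q (x j) (x (Suc j))" using 3 by (simp add: loc_def)
    show ?thesis
      unfolding s list.map e ev.simps filter.simps if_True if_False IH l by simp
  qed simp
qed

lemma Psi_alt: "Psi (alt c) x = (\<Prod>i\<leftarrow>cls N c. loc i x)"
proof (cases "even c")
  case False
  have "[0..<Suc N] = 0 # [Suc 0..<Suc N]" by (simp add: upt_conv_Cons del: upt_Suc)
  then show ?thesis
    using ev_alt[of 0 c 0 x] False by (simp add: Psi_def alt_def cls_def del: upt_Suc)
next
  case True
  have s: "[0..<Suc N] = 0 # Suc 0 # [Suc (Suc 0)..<Suc N]" "[0..<N] = 0 # [Suc 0..<N]"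
    using N_pos by (simp_all add: upt_conv_Cons del: upt_Suc)
  show ?thesis
    using ev_alt[of 1 c 1 x] True N_pos unfolding Psi_def alt_def cls_def s
    by (simp add: loc_def[of 0] del: upt_Suc)
qed

text \<open>The supports of the generators in one parity class cover all sites, so contracting
  leaves nothing that depends on a spin of the chain.\<close>

lemma ctr_cls_indep: "indep {..<N} (foldr ctr (cls N c) f)"
proof -
  have "\<exists>i\<in>set (cls N c). k \<in> sites i" if k: "k < N" for k
  proof (cases "even (k + c)")
    case True
    then show ?thesis using k by (intro bexI[of _ k]) (auto simp: sites_def set_cls)
  next
    case False
    then show ?thesis using k by (intro bexI[of _ "Suc k"]) (auto simp: sites_def set_cls)
  qed
  then show ?thesis
    using foldr_ctr_indep[of _ "cls N c" f] unfolding indep_def by blast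
qed

text \<open>The odd and the even generators multiply to operators of rank one.\<close>

lemma foldr_sop_cls: "foldr sop (cls N c) f = (\<lambda>x. foldr ctr (cls N c) f x * Psi (alt c) x)"
proof -
  have "set (cls N c) \<subseteq> {..N}" by (auto simp: set_cls)
  then show ?thesis
    by (simp add: fun_eq_iff foldr_sop_ctr[OF gap_cls] Psi_alt mult.commute)
qed

lemma cls_parity: "even (c + c') \<Longrightarrow> cls N c = cls N c'"
  unfolding cls_def by (intro filter_cong) auto

lemma alt_parity: "even (c + c') \<Longrightarrow> alt c = alt c'"
  unfolding alt_def by (intro map_cong) auto

lemma Phi_zz: "Phi m0 (zz N m) = fsc (kap m0 m) (Psi (alt (Suc (N + m))))"
  by (simp add: Phi_def mu_zz[OF N_pos] wd_zz)

text \<open>On \<open>Psi (alt c)\<close> two classes raise a zigzag by two. This gathers the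
  weights of both parities and gives the same word back. The rank one form of the class applied to
  \<open>f\<close> extends the identity to all \<open>f\<close>.\<close>

lemma three_cls: "foldr sop (cls N c @ cls N (Suc c) @ cls N c) f = fsc (KK 0 * KK 1) (foldr sop (cls N c) f)"
proof -
  \<comment> \<open>The height, 0 or 1, of the zigzag whose word is \<open>alt c\<close>.\<close>
  define m where "m = (if even (c + N) then 1 else 0 :: nat)"
  have m: "even (Suc (N + m) + c)" by (auto simp: m_def)
  have c: "cls N c = cls N (N + Suc m)" "cls N (Suc c) = cls N (N + m)" "alt c = alt (Suc (N + m))"
    using m by (intro cls_parity alt_parity; simp)+
  have "kap m (Suc (Suc m)) = KK 0 * KK 1"
    using KK_parity[of 2 0] by (simp add: kap_def m_def mult.commute numeral_2_eq_2)
  moreover have "foldr sop (cls N (N + Suc m)) (foldr sop (cls N (N + m)) (Phi m (zz N m))) = Phi m (zz N (Suc (Suc m)))"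
    using foldr_sop_zz[of m m] foldr_sop_zz[of m "Suc m"] by simp
  moreover have "alt (Suc (N + Suc (Suc m))) = alt (Suc (N + m))" by (rule alt_parity) simp
  ultimately have A: "foldr sop (cls N c) (foldr sop (cls N (Suc c)) (Psi (alt c))) = fsc (KK 0 * KK 1) (Psi (alt c))"
    unfolding c Phi_zz by (simp add: kap_def)
  have sub: "set (cls N c') \<subseteq> {..N}" for c' by (auto simp: set_cls)
  define g where "g = foldr ctr (cls N c) f"
  have g: "indep {..<N} g" unfolding g_def by (rule ctr_cls_indep)
  have f: "foldr sop (cls N c) f = (\<lambda>x. g x * Psi (alt c) x)"
    unfolding g_def by (rule foldr_sop_cls)
  have "foldr sop (cls N c @ cls N (Suc c) @ cls N c) f
      = foldr sop (cls N c) (foldr sop (cls N (Suc c)) (\<lambda>x. g x * Psi (alt c) x))"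
    by (simp add: f)
  also have "\<dots> = (\<lambda>x. g x * foldr sop (cls N c) (foldr sop (cls N (Suc c)) (Psi (alt c))) x)"
    by (simp only: foldr_sop_mult[OF g sub])
  finally show ?thesis by (simp add: A f mult.left_commute)
qed

sublocale btl_dq N sop fsc "q + 1 / q" "a1 + d1" "a2 + d2" "KK 0 * KK 1"
proof
  fix u k w v assume "(u, k, w) \<in> dq_rel N (KK 0 * KK 1)"
  moreover have "I1_word N = cls N 1" "I2_word N = cls N 0" "cls N (Suc 1) = cls N 0"
    unfolding I1_word_def I2_word_def cls_def by (intro filter_cong refl; simp)+
  ultimately show "foldr sop u v = fsc k (foldr sop w v)"
    using three_cls[of 0 v] three_cls[of 1 v] by (auto simp: dq_rel_def)
qed

text \<open>A vector that \<open>Jw N\<close> does not kill. For odd \<open>N\<close> this word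
  contains \<open>e_0\<close>, whose covector may vanish on the constant function; fixing the first
  spin leaves its coefficient \<open>a1\<close>, which is nonzero.\<close>

definition chi :: "(nat \<Rightarrow> bool) \<Rightarrow> complex" where
  "chi x = (if odd N \<and> x 0 then 0 else 1)"

lemma foldr_ctr_chi:
  assumes "\<And>i. i \<in> set js \<Longrightarrow> 1 \<le> i \<and> i < N \<and> (odd N \<longrightarrow> i \<noteq> 1)"
  shows "foldr ctr js chi = fsc ((1 / q + 1) ^ length js) chi"
  using assms
proof (induction js)
  case (Cons i js)
  have "chi (x(i - 1 := a, i := b)) = chi x" for x a b
    using Cons.prems[of i] by (auto simp: chi_def)
  with Cons show ?case
    by (auto simp: fun_eq_iff ctr_def algebra_simps add_divide_distrib)
qed simp

lemma J_chi: "\<exists>k. k \<noteq> 0 \<and> foldr sop (Jw N) chi = fsc k (Psi (alt (Suc N)))"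
proof -
  have "q \<noteq> -1" using nz(2) by auto
  \<comment> \<open>Each bulk cap contributes this number on the constant function.\<close>
  then have q1: "1 / q + 1 \<noteq> 0" using nz(1) by (simp add: field_simps) (metis add.commute add_eq_0_iff)
  have "\<exists>k. k \<noteq> 0 \<and> foldr ctr (cls N (Suc N)) chi = (\<lambda>x. k)"
  proof (cases "even N")
    case True
    have "foldr ctr (cls N (Suc N)) chi = fsc ((1 / q + 1) ^ length (cls N (Suc N))) chi"
      using True by (intro foldr_ctr_chi) (auto simp: set_cls le_less elim: oddE)
    moreover have "chi = (\<lambda>x. 1)" using True by (auto simp: chi_def)
    ultimately show ?thesis using q1
      by (intro exI[of _ "(1 / q + 1) ^ length (cls N (Suc N))"]) simp
  next
    case False
    obtain js where js: "cls N (Suc N) = 0 # js" "\<And>i. i \<in> set js \<Longrightarrow> 1 \<le> i \<and> i \<le> N \<and> odd (i + N)"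
    proof -
      have "[0..<Suc N] = 0 # [Suc 0..<Suc N]" by (simp add: upt_conv_Cons del: upt_Suc)
      then show thesis
        using that[of "filter (\<lambda>i. even (i + Suc N)) [Suc 0..<Suc N]"] False
        by (auto simp: cls_def simp del: upt_Suc)
    qed
    have "foldr ctr js chi = fsc ((1 / q + 1) ^ length js) chi"
      using js(2) False by (intro foldr_ctr_chi) (metis One_nat_def even_add even_plus_one_iff le_neq_implies_less odd_one)
    then have "foldr ctr (cls N (Suc N)) chi = (\<lambda>x. a1 * (1 / q + 1) ^ length js)"
      using False by (simp add: js(1) fun_eq_iff ctr_def[of 0] chi_def)
    then show ?thesis using q1 nz
      by (intro exI[of _ "a1 * (1 / q + 1) ^ length js"]) simp
  qed
  then show ?thesis
    unfolding Jw_cls foldr_sop_cls by auto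
qed

text \<open>The word grows from \<open>Jw N\<close>, which sends \<open>chi\<close> to a multiple of
  the lowest zigzag, by letters at valleys, and these raise the path in \<open>Phi 0\<close> without
  any factor. Hence one constant serves all paths.\<close>

lemma Y_chi:
  "\<exists>k. k \<noteq> 0 \<and> (\<forall>h. valid N h \<longrightarrow> foldr sop (Yw N h) chi = fsc k (Phi 0 h))"
proof -
  obtain k where k: "k \<noteq> 0" "foldr sop (Jw N) chi = fsc k (Psi (alt (Suc N)))"
    using J_chi by blast
  have "foldr sop (Yw N h) chi = fsc k (Phi 0 h)" if "valid N h" for h
    using that
  proof (induction "hsz N h" arbitrary: h rule: less_induct)
    case less
    obtain j where j: "j \<le> N" "peak N h j" "\<And>k. k \<le> N \<Longrightarrow> h k \<le> h j"
      using exists_top_peak[OF less.prems] by blast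
    show ?case
    proof (cases "2 \<le> h j")
      case True
      let ?h = "h(j := h j - 2)"
      have v: "valid N ?h" using less.prems j True by (intro valid_lower)
      have sz: "hsz N ?h < hsz N h" using hsz_upd[OF j(1), of h "h j - 2"] True by simp
      have val: "valley N ?h j"
        unfolding valley_def
      proof (intro allI impI)
        fix i assume i: "nbr N j i"
        then have "i \<noteq> j" by (auto simp: nbr_def)
        moreover have "h j = Suc (h i)" using j(2) i by (simp add: peak_def)
        ultimately show "?h i = Suc (?h j)" using True by simp
      qed
      have "?h(j := ?h j + 2) = h" using True by (auto simp: fun_eq_iff)
      then have "sop j (Phi 0 ?h) = Phi 0 h"
        using sop_Phi[OF v j(1) val, of 0] by simp
      moreover have "foldr sop (Yw N h) chi = sop j (fsc k (Phi 0 ?h))"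
        using Y_lower[OF less.prems j(1,2) True, of chi] less.hyps[OF sz v] by simp
      ultimately show ?thesis by (simp add: sop_sc)
    next
      case False
      then have low: "h k \<le> 1" if "k \<le> N" for k using j(3)[OF that] by linarith
      have "h k = zz N 0 k" if "k \<le> N" for k
        using low[OF that] valid_parity[OF less.prems that] unfolding zz_def by (cases "h k") auto
      then have "Phi 0 h = Phi 0 (zz N 0)" by (rule Phi_cong)
      moreover have "Yw N h = Jw N"
        using Yu_low[where H = "hsz N h", OF low] Yu_stable[of N h "Suc (hsz N h)"] lev_one[OF less.prems] by simp
      ultimately show ?thesis
        using k by (simp add: Phi_zz kap_def)
    qed
  qed
  with k(1) show ?thesis by blast
qed

end

section \<open>Linear independence of half diagrams\<close>

definition words :: "nat \<Rightarrow> bool list set" where "words n = {w. length w = n}"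

lemma words_0: "words 0 = {[]}"
  by (auto simp: words_def)

lemma words_Suc: "words (Suc n) = (\<lambda>w. w @ [True]) ` words n \<union> (\<lambda>w. w @ [False]) ` words n"
proof
  show "words (Suc n) \<subseteq> (\<lambda>w. w @ [True]) ` words n \<union> (\<lambda>w. w @ [False]) ` words n"
  proof
    fix w assume "w \<in> words (Suc n)"
    then obtain w' c where "w = w' @ [c]" "length w' = n"
      by (auto simp: words_def length_Suc_conv_rev)
    then show "w \<in> (\<lambda>w. w @ [True]) ` words n \<union> (\<lambda>w. w @ [False]) ` words n"
      by (cases c) (auto simp: words_def)
  qed
qed (auto simp: words_def)

lemma finite_words [simp]: "finite (words n)"
  by (induction n) (simp_all add: words_0 words_Suc)

lemma sum_words_Suc: "(\<Sum>w\<in>words (Suc n). f w) = (\<Sum>w\<in>words n. f (w @ [True])) + (\<Sum>w\<in>words n. f (w @ [False]))"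
  for f :: "bool list \<Rightarrow> complex"
  unfolding words_Suc
  by (subst sum.union_disjoint) (auto simp: sum.reindex inj_on_def)

lemma card_words: "card (words n) = 2 ^ n"
  unfolding words_Suc using card_lists_length_eq[of "UNIV :: bool set" n]
  by (simp add: words_def)

text \<open>What the functional annihilating \<open>v\<close> leaves on the other leg of a cup;
  \<open>dt v l\<close> is the value of the same functional at \<open>l\<close>.\<close>

definition Kv :: "complex \<Rightarrow> (bool \<Rightarrow> complex) \<Rightarrow> bool \<Rightarrow> complex" where
  "Kv q v s = (if s then q * v True else - v False)"

definition dt :: "(bool \<Rightarrow> complex) \<Rightarrow> (bool \<Rightarrow> complex) \<Rightarrow> complex" where
  "dt v l = v True * l False - v False * l True"

definition lin_ind where
  "lin_ind q l r n \<longleftrightarrow> (\<forall>c. (\<forall>xs. length xs = n \<longrightarrow> (\<Sum>w\<in>words n. c w * ev q l r 0 [] w xs) = 0)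
     \<longrightarrow> (\<forall>w\<in>words n. c w = 0))"

definition spans where
  "spans q l r n \<longleftrightarrow> (\<forall>f. \<exists>c. \<forall>xs. length xs = n \<longrightarrow> f xs = (\<Sum>w\<in>words n. c w * ev q l r 0 [] w xs))"

text \<open>Splitting words by their last letter makes the system block triangular. The two smaller
  systems have the shifted right vectors and the right vectors preceded by
  \<open>Kv q (r 0)\<close>; some vectors of the second one are scaled by the determinant
  \<open>dt (r 0) (l n)\<close>, namely those whose final closing is tied to the left
  boundary.\<close>

primrec good :: "complex \<Rightarrow> (nat \<Rightarrow> bool \<Rightarrow> complex) \<Rightarrow> nat \<Rightarrow> (nat \<Rightarrow> bool \<Rightarrow> complex) \<Rightarrow> bool" where
  "good q l 0 r = True"
| "good q l (Suc n) r = (good q l n (\<lambda>k. r (Suc k)) \<and> good q l n (case_nat (Kv q (r 0)) r) \<and> dt (r 0) (l n) \<noteq> 0)"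

text \<open>Contracting the last site with the functional that kills \<open>r\<^sub>0\<close> removes the final closing and
  turns its partner into a right boundary strand with vector \<open>K r\<^sub>0\<close>.\<close>

lemma ev_last_False:
  assumes "periodic l" "length w = length xs"
  shows "r 0 True * ev q l r 0 [] (w @ [False]) (xs @ [False]) - r 0 False * ev q l r 0 [] (w @ [False]) (xs @ [True])
    = (if fin 0 w = 0 then dt (r 0) (l (length w)) else 1) * ev q l (case_nat (Kv q (r 0)) r) 0 [] w xs"
proof -
  obtain c n' st' where c: "length st' = fin 0 w" "even (n' + length st' + length w)"
    "\<And>r v ys. ev q l r 0 [] (w @ v) (xs @ ys) = c * ev q l r n' st' v ys"
    using ev_prefix[OF assms(2), of "[]" 0 q l, unfolded list.size add_0_right] by blast
  have p: "ev q l (case_nat (Kv q (r 0)) r) 0 [] w xs = c * rprod (case_nat (Kv q (r 0)) r) st'"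
    using c(3)[of _ "[]" "[]"] by simp
  show ?thesis
  proof (cases st')
    case Nil
    then have "l n' = l (length w)" using c(1,2) by (intro periodic_parity[OF assms(1)]) simp
    then show ?thesis
      using Nil c p by (simp add: dt_def algebra_simps)
  next
    case (Cons a st0)
    then have "fin 0 w \<noteq> 0" using c(1) by simp
    then show ?thesis
      using Cons c(3) p by (cases a) (simp_all add: Kv_def uu_def algebra_simps)
  qed
qed

lemma proportional:
  fixes a0 a1 f0 f1 :: complex
  assumes "a0 \<noteq> 0 \<or> a1 \<noteq> 0" "a1 * f0 = a0 * f1"
  shows "\<exists>g. f0 = a0 * g \<and> f1 = a1 * g"
proof (cases "a0 = 0")
  case True
  with assms show ?thesis by (intro exI[of _ "f1 / a1"]) auto
next
  case False
  with assms(2) show ?thesis by (intro exI[of _ "f0 / a0"]) (auto simp: field_simps)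
qed

context
  fixes q :: complex and l :: "nat \<Rightarrow> bool \<Rightarrow> complex"
  assumes per: "periodic l" and q0: "q \<noteq> 0"
begin

definition wt where "wt r n w = (if fin 0 w = 0 then dt (r 0) (l n) else 1)"

lemma split_last: "length xs = Suc n \<longleftrightarrow> (\<exists>ys y. length ys = n \<and> xs = ys @ [y])"
  by (auto simp: length_Suc_conv_rev)

lemma sum_last:
  assumes "length ys = n"
  shows "(\<Sum>w\<in>words (Suc n). c w * ev q l r 0 [] w (ys @ [y]))
    = r 0 y * (\<Sum>w\<in>words n. c (w @ [True]) * ev q l (\<lambda>k. r (Suc k)) 0 [] w ys)
      + (\<Sum>w\<in>words n. c (w @ [False]) * ev q l r 0 [] (w @ [False]) (ys @ [y]))"
  unfolding sum_words_Suc sum_distrib_left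
  using assms by (intro arg_cong2[of _ _ _ _ "(+)"] sum.cong) (auto simp: words_def ev_last_True algebra_simps)

lemma sum_False:
  assumes "length ys = n"
  shows "r 0 True * (\<Sum>w\<in>words n. d w * ev q l r 0 [] (w @ [False]) (ys @ [False]))
      - r 0 False * (\<Sum>w\<in>words n. d w * ev q l r 0 [] (w @ [False]) (ys @ [True]))
    = (\<Sum>w\<in>words n. d w * wt r n w * ev q l (case_nat (Kv q (r 0)) r) 0 [] w ys)"
  unfolding sum_distrib_left sum_subtractf[symmetric]
proof (rule sum.cong[OF refl])
  fix w assume "w \<in> words n"
  then have w: "length w = length ys" "length w = n" using assms by (auto simp: words_def)
  have "r 0 True * (d w * ev q l r 0 [] (w @ [False]) (ys @ [False])) - r 0 False * (d w * ev q l r 0 [] (w @ [False]) (ys @ [True]))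
    = d w * (r 0 True * ev q l r 0 [] (w @ [False]) (ys @ [False]) - r 0 False * ev q l r 0 [] (w @ [False]) (ys @ [True]))"
    by (simp add: algebra_simps)
  then show "r 0 True * (d w * ev q l r 0 [] (w @ [False]) (ys @ [False])) - r 0 False * (d w * ev q l r 0 [] (w @ [False]) (ys @ [True]))
    = d w * wt r n w * ev q l (case_nat (Kv q (r 0)) r) 0 [] w ys"
    unfolding ev_last_False[OF per w(1)] wt_def w(2) by simp
qed

text \<open>The contracted equation gives the coefficients of the words ending in a closing. The
  remainder is annihilated by the functional, so at the last site it is a multiple of
  \<open>r 0\<close>, and words ending in an opening expand it.\<close>

lemma good_spans: "good q l n r \<Longrightarrow> spans q l r n"
proof (induction n arbitrary: r)
  case 0
  show ?case
    unfolding spans_def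
  proof
    fix f :: "bool list \<Rightarrow> complex"
    show "\<exists>c. \<forall>xs. length xs = 0 \<longrightarrow> f xs = (\<Sum>w\<in>words 0. c w * ev q l r 0 [] w xs)"
      by (rule exI[of _ "\<lambda>_. f []"]) (simp add: words_0)
  qed
next
  case (Suc n)
  have sp: "spans q l (\<lambda>k. r (Suc k)) n" "spans q l (case_nat (Kv q (r 0)) r) n" and D: "dt (r 0) (l n) \<noteq> 0"
    using Suc by auto
  show ?case
    unfolding spans_def
  proof
    fix f :: "bool list \<Rightarrow> complex"
    obtain d where d: "\<And>ys. length ys = n \<Longrightarrow> r 0 True * f (ys @ [False]) - r 0 False * f (ys @ [True])
        = (\<Sum>w\<in>words n. d w * ev q l (case_nat (Kv q (r 0)) r) 0 [] w ys)"
      using sp(2)[unfolded spans_def, rule_format, of "\<lambda>ys. r 0 True * f (ys @ [False]) - r 0 False * f (ys @ [True])"] by blast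
    define e where "e w = d w / wt r n w" for w
    have ew: "e w * wt r n w = d w" for w using D by (simp add: e_def wt_def)
    define V where "V ys y = (\<Sum>w\<in>words n. e w * ev q l r 0 [] (w @ [False]) (ys @ [y]))" for ys y
    have "\<exists>g. f (ys @ [False]) - V ys False = r 0 False * g \<and> f (ys @ [True]) - V ys True = r 0 True * g"
      if "length ys = n" for ys
    proof (rule proportional)
      show "r 0 False \<noteq> 0 \<or> r 0 True \<noteq> 0" using D by (auto simp: dt_def)
      have "r 0 True * V ys False - r 0 False * V ys True = r 0 True * f (ys @ [False]) - r 0 False * f (ys @ [True])"
        unfolding V_def sum_False[OF that] ew d[OF that] ..
      then show "r 0 True * (f (ys @ [False]) - V ys False) = r 0 False * (f (ys @ [True]) - V ys True)"
        by (simp add: algebra_simps)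
    qed
    then obtain g where g: "\<And>ys y. length ys = n \<Longrightarrow> f (ys @ [y]) - V ys y = r 0 y * g ys"
      by (metis (full_types))
    obtain c where c: "\<And>ys. length ys = n \<Longrightarrow> g ys = (\<Sum>w\<in>words n. c w * ev q l (\<lambda>k. r (Suc k)) 0 [] w ys)"
      using sp(1)[unfolded spans_def, rule_format, of g] by blast
    show "\<exists>c. \<forall>xs. length xs = Suc n \<longrightarrow> f xs = (\<Sum>w\<in>words (Suc n). c w * ev q l r 0 [] w xs)"
    proof (intro exI allI impI)
      fix xs :: "bool list" assume "length xs = Suc n"
      then obtain ys y where xs: "length ys = n" "xs = ys @ [y]" unfolding split_last by blast
      show "f xs = (\<Sum>w\<in>words (Suc n). (if last w then c (butlast w) else e (butlast w)) * ev q l r 0 [] w xs)"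
        unfolding xs(2) sum_last[OF xs(1)] using g[OF xs(1), of y] c[OF xs(1)] by (simp add: V_def algebra_simps)
    qed
  qed
qed

lemma good_lin_ind: "good q l n r \<Longrightarrow> lin_ind q l r n"
proof (induction n arbitrary: r)
  case 0
  show ?case by (simp add: lin_ind_def words_0)
next
  case (Suc n)
  have li: "lin_ind q l (\<lambda>k. r (Suc k)) n" "lin_ind q l (case_nat (Kv q (r 0)) r) n" and D: "dt (r 0) (l n) \<noteq> 0"
    using Suc by auto
  show ?case
    unfolding lin_ind_def
  proof (intro allI impI)
    fix c assume z: "\<forall>xs. length xs = Suc n \<longrightarrow> (\<Sum>w\<in>words (Suc n). c w * ev q l r 0 [] w xs) = 0"
    define A where "A ys = (\<Sum>w\<in>words n. c (w @ [True]) * ev q l (\<lambda>k. r (Suc k)) 0 [] w ys)" for ys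
    define V where "V ys y = (\<Sum>w\<in>words n. c (w @ [False]) * ev q l r 0 [] (w @ [False]) (ys @ [y]))" for ys y
    have AV: "r 0 y * A ys + V ys y = 0" if "length ys = n" for ys y
      using z[rule_format, of "ys @ [y]"] that unfolding sum_last[OF that] by (simp add: A_def V_def)
    have "(\<Sum>w\<in>words n. c (w @ [False]) * wt r n w * ev q l (case_nat (Kv q (r 0)) r) 0 [] w ys) = 0"
      if "length ys = n" for ys
    proof -
      have "V ys y = - (r 0 y * A ys)" for y using AV[OF that, of y] by (simp add: eq_neg_iff_add_eq_0 add.commute)
      then have "r 0 True * V ys False - r 0 False * V ys True = 0" by simp
      then show ?thesis using sum_False[OF that, of r "\<lambda>w. c (w @ [False])"] by (simp only: V_def)
    qed
    then have "\<forall>w\<in>words n. c (w @ [False]) * wt r n w = 0"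
      using li(2)[unfolded lin_ind_def, rule_format, of "\<lambda>w. c (w @ [False]) * wt r n w"] by blast
    then have F: "\<And>w. w \<in> words n \<Longrightarrow> c (w @ [False]) = 0" using D by (auto simp: wt_def split: if_splits)
    then have "V ys y = 0" for ys y by (simp add: V_def)
    then have "r 0 y * A ys = 0" if "length ys = n" for ys y using AV[OF that, of y] by simp
    moreover have "r 0 False \<noteq> 0 \<or> r 0 True \<noteq> 0" using D by (auto simp: dt_def)
    ultimately have "A ys = 0" if "length ys = n" for ys using that by (metis mult_eq_0_iff)
    then have "\<forall>w\<in>words n. c (w @ [True]) = 0"
      unfolding A_def using li(1)[unfolded lin_ind_def, rule_format, of "\<lambda>w. c (w @ [True])"] by blast
    with F show "\<forall>w\<in>words (Suc n). c w = 0" by (auto simp: words_Suc)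
  qed
qed

lemma fin_replicate: "fin 0 (replicate n False) = 0"
  by (induction n) auto

text \<open>Words ending in an opening carry \<open>r 0\<close> at the last site, so independence
  passes to their prefixes, which then also span. Therefore a combination of words ending in a
  closing is trivial as soon as its contraction vanishes, and this gives the other two
  conditions.\<close>

lemma lin_ind_good:
  "lin_ind q l r n \<Longrightarrow> (\<And>k. r k False \<noteq> 0 \<or> r k True \<noteq> 0) \<Longrightarrow> good q l n r"
proof (induction n arbitrary: r)
  case (Suc n)
  note li = Suc.prems(1)[unfolded lin_ind_def, rule_format]
  have "lin_ind q l (\<lambda>k. r (Suc k)) n"
    unfolding lin_ind_def
  proof (intro allI impI)
    fix c assume z: "\<forall>xs. length xs = n \<longrightarrow> (\<Sum>w\<in>words n. c w * ev q l (\<lambda>k. r (Suc k)) 0 [] w xs) = 0"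
    define c' where "c' w = (if last w then c (butlast w) else 0)" for w
    have "c' w = 0" if "w \<in> words (Suc n)" for w
    proof (rule li[OF _ that])
      fix xs :: "bool list" assume "length xs = Suc n"
      then obtain ys y where xs: "length ys = n" "xs = ys @ [y]" unfolding split_last by blast
      show "(\<Sum>w\<in>words (Suc n). c' w * ev q l r 0 [] w xs) = 0"
        unfolding xs(2) sum_last[OF xs(1)] using z xs(1) by (simp add: c'_def)
    qed
    then have "c' (w @ [True]) = 0" if "w \<in> words n" for w using that by (simp add: words_Suc)
    then show "\<forall>w\<in>words n. c w = 0" by (simp add: c'_def)
  qed
  then have g1: "good q l n (\<lambda>k. r (Suc k))" using Suc.IH Suc.prems(2) by blast
  then have sp: "spans q l (\<lambda>k. r (Suc k)) n" by (rule good_spans)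
  have key: "d w = 0" if z: "\<And>ys. length ys = n \<Longrightarrow> (\<Sum>w\<in>words n. d w * wt r n w * ev q l (case_nat (Kv q (r 0)) r) 0 [] w ys) = 0"
    and w: "w \<in> words n" for d w
  proof -
    define V where "V ys y = (\<Sum>w\<in>words n. d w * ev q l r 0 [] (w @ [False]) (ys @ [y]))" for ys y
    have "\<exists>g. V ys False = r 0 False * g \<and> V ys True = r 0 True * g" if "length ys = n" for ys
      using Suc.prems(2)[of 0] sum_False[OF that, of r d] z[OF that]
      by (intro proportional) (auto simp: V_def)
    then obtain g where g: "\<And>ys y. length ys = n \<Longrightarrow> V ys y = r 0 y * g ys"
      by (metis (full_types))
    obtain c where c: "\<And>ys. length ys = n \<Longrightarrow> g ys = (\<Sum>w\<in>words n. c w * ev q l (\<lambda>k. r (Suc k)) 0 [] w ys)"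
      using sp[unfolded spans_def, rule_format, of g] by blast
    define c' where "c' w = (if last w then - c (butlast w) else d (butlast w))" for w
    have "c' (w @ [False]) = 0"
    proof (rule li)
      fix xs :: "bool list" assume "length xs = Suc n"
      then obtain ys y where xs: "length ys = n" "xs = ys @ [y]" unfolding split_last by blast
      show "(\<Sum>w\<in>words (Suc n). c' w * ev q l r 0 [] w xs) = 0"
        unfolding xs(2) sum_last[OF xs(1)] using g[OF xs(1), of y] c[OF xs(1)]
        by (simp add: c'_def V_def sum_negf)
    next
      show "w @ [False] \<in> words (Suc n)" using w by (simp add: words_Suc)
    qed
    then show ?thesis by (simp add: c'_def)
  qed
  have D: "dt (r 0) (l n) \<noteq> 0"
  proof
    assume D: "dt (r 0) (l n) = 0"
    \<comment> \<open>With closings only the stack stays empty, so the contraction of this word has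
      the determinant as a factor.\<close>
    let ?w = "replicate n False"
    have "(\<lambda>w. if w = ?w then 1 else 0 :: complex) ?w = 0"
    proof (rule key[of "\<lambda>w. if w = ?w then 1 else 0" ?w])
      fix ys :: "bool list"
      show "(\<Sum>w\<in>words n. (if w = ?w then 1 else 0) * wt r n w * ev q l (case_nat (Kv q (r 0)) r) 0 [] w ys) = 0"
        using D by (intro sum.neutral) (auto simp: wt_def fin_replicate)
    qed (simp add: words_def)
    then show False by simp
  qed
  have "lin_ind q l (case_nat (Kv q (r 0)) r) n"
    unfolding lin_ind_def
  proof (intro allI impI ballI)
    fix c w assume z: "\<forall>xs. length xs = n \<longrightarrow> (\<Sum>w\<in>words n. c w * ev q l (case_nat (Kv q (r 0)) r) 0 [] w xs) = 0"
      and w: "w \<in> words n"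
    have ne: "wt r n w \<noteq> 0" for w using D by (simp add: wt_def)
    have "c w / wt r n w = 0"
      using z ne by (intro key[of "\<lambda>w. c w / wt r n w" w, OF _ w]) simp
    then show "c w = 0" using ne by simp
  qed
  moreover have "case_nat (Kv q (r 0)) r k False \<noteq> 0 \<or> case_nat (Kv q (r 0)) r k True \<noteq> 0" for k
    using Suc.prems(2)[of 0] Suc.prems(2)[of "k - 1"] q0 by (cases k) (auto simp: Kv_def)
  ultimately have "good q l n (case_nat (Kv q (r 0)) r)" using Suc.IH by blast
  with g1 D show ?case by simp
qed simp

text \<open>The right sequences met in the recursion of \<open>good\<close>: decreasing powers of
  \<open>Kv q\<close> applied to \<open>r j\<close>, followed by \<open>r j\<close>,
  \<open>r (Suc j)\<close> and so on. Two numbers thus describe a node of a binary recursion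
  tree.\<close>

definition sq :: "(nat \<Rightarrow> bool \<Rightarrow> complex) \<Rightarrow> nat \<Rightarrow> nat \<Rightarrow> nat \<Rightarrow> bool \<Rightarrow> complex" where
  "sq r m j k = (if k < m then (Kv q ^^ (m - k)) (r j) else r (j + k - m))"

lemma sq_Suc: "(\<lambda>k. sq r m j (Suc k)) = (if m = 0 then sq r 0 (Suc j) else sq r (m - 1) j)"
  by (cases m) (auto simp: sq_def fun_eq_iff)

lemma sq_K: "case_nat (Kv q (sq r m j 0)) (sq r m j) = sq r (Suc m) j"
proof
  fix k
  show "case_nat (Kv q (sq r m j 0)) (sq r m j) k = sq r (Suc m) j k"
    by (cases k) (auto simp: sq_def)
qed

lemma sq_0: "sq r m j 0 = (Kv q ^^ m) (r j)"
  by (simp add: sq_def)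

text \<open>Along the recursion \<open>m + j + n\<close> keeps its parity and never grows. A node of
  size \<open>Suc n\<close> contributes the determinant with \<open>l n\<close>, hence the strict
  bound and the odd difference.\<close>

lemma goodI:
  assumes "\<And>m' j' n'. m' + j' + n' < m + j + n \<Longrightarrow> odd (m' + j' + n' + m + j + n) \<Longrightarrow>
    dt ((Kv q ^^ m') (r j')) (l n') \<noteq> 0"
  shows "good q l n (sq r m j)"
  using assms
proof (induction n arbitrary: m j)
  case (Suc n)
  have "good q l n (sq r (Suc m) j)"
    using Suc.prems by (intro Suc.IH) auto
  moreover have "good q l n (sq r 0 (Suc j))" if "m = 0"
    using Suc.prems that by (intro Suc.IH) auto
  moreover have "good q l n (sq r (m - 1) j)" if "m \<noteq> 0"
  proof (rule Suc.IH)
    fix m' j' n' assume "m' + j' + n' < m - 1 + j + n" "odd (m' + j' + n' + (m - 1) + j + n)"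
    then show "dt ((Kv q ^^ m') (r j')) (l n') \<noteq> 0"
      using that by (intro Suc.prems) (cases m; auto)+
  qed
  moreover have "dt ((Kv q ^^ m) (r j)) (l n) \<noteq> 0"
    by (rule Suc.prems) (simp, presburger)
  ultimately show ?case
    by (simp only: good.simps sq_Suc sq_K) (simp add: sq_0)
qed simp

lemma goodD: "good q l (Suc n + k) (sq r m j) \<Longrightarrow> dt ((Kv q ^^ (m + k)) (r j)) (l n) \<noteq> 0"
proof (induction k arbitrary: m)
  case 0
  then show ?case by (simp add: sq_0)
next
  case (Suc k)
  then have "good q l (Suc n + k) (sq r (Suc m) j)" by (simp add: sq_K)
  from Suc.IH[OF this] show ?case by simp
qed

lemma Kv_pow: "(Kv q ^^ m) v s = (if s then q ^ m * v True else (- 1) ^ m * v False)"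
  by (induction m) (auto simp: Kv_def)

end

section \<open>Critical values of the boundary parameter\<close>

context spin
begin

text \<open>The value of \<open>lt * rt\<close> at which the determinant for \<open>m\<close>,
  \<open>j\<close>, \<open>n\<close> vanishes.\<close>

definition tau :: "nat \<Rightarrow> nat \<Rightarrow> nat \<Rightarrow> complex" where
  "tau m j n = (- q) ^ m * (if odd j then q * d2 / a2 else 1) * (if odd n then q * d1 / a1 else 1)"

lemma dt_tau: "dt ((Kv q ^^ m) (rv j)) (lv n) \<noteq> 0 \<longleftrightarrow> lt * rt \<noteq> tau m j n"
proof -
  define Z where "Z = (if odd j then q * d2 / a2 else 1) * (if odd n then q * d1 / a1 else 1)"
  define u where "u = (if odd n then a1 / lt else 1) * (if odd j then a2 / rt else 1)"
  have u: "u \<noteq> 0" using nz by (simp add: u_def)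
  have T: "rv j True * lv n False = Z * u" "rv j False * lv n True = lt * rt * u"
    using nz by (simp_all add: rv_def lv_def Z_def u_def)
  define \<epsilon> :: complex where "\<epsilon> = (- 1) ^ m"
  have \<epsilon>: "\<epsilon> * \<epsilon> = 1" by (simp add: \<epsilon>_def flip: power_add)
  have "dt ((Kv q ^^ m) (rv j)) (lv n) = u * (q ^ m * Z - \<epsilon> * (lt * rt))"
    unfolding dt_def Kv_pow[OF periodic_lv nz(1)] using T by (simp add: \<epsilon>_def algebra_simps)
  moreover have "q ^ m * Z = \<epsilon> * (lt * rt) \<longleftrightarrow> lt * rt = \<epsilon> * (q ^ m * Z)"
    using \<epsilon> by (metis mult.assoc mult.left_neutral)
  moreover have "tau m j n = \<epsilon> * (q ^ m * Z)"
    unfolding tau_def Z_def \<epsilon>_def power_minus[of q m] by (simp add: mult.assoc)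
  ultimately show ?thesis using u by auto
qed

lemma KK0_iff: "KK 0 \<noteq> 0 \<longleftrightarrow> lt * rt \<noteq> - (d2 / a2) * (if even N then q * d1 / a1 else 1)"
proof -
  have "KK 0 = d2 / rt * lv (N + 1) False + a2 * lv (N + 1) True"
    unfolding pr_right by (simp add: KK_def)
  define Z where "Z = d2 / a2 * (if even N then q * d1 / a1 else 1)"
  define u where "u = a2 / rt * (if even N then a1 / lt else 1)"
  have "u \<noteq> 0" using nz by (simp add: u_def)
  moreover have "d2 / rt * lv (N + 1) False = u * Z" "a2 * lv (N + 1) True = u * (lt * rt)"
    using nz by (simp_all add: lv_def u_def Z_def)
  ultimately have "KK 0 \<noteq> 0 \<longleftrightarrow> Z + lt * rt \<noteq> 0"
    using \<open>KK 0 = _\<close> by (metis distrib_left mult_eq_0_iff)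
  then show ?thesis
    unfolding Z_def by (metis add.commute eq_neg_iff_add_eq_0 minus_mult_left)
qed

text \<open>The first condition is the nonvanishing of \<open>KK 0\<close>. In the others
  \<open>j\<close> and \<open>n\<close> matter modulo 2 only and \<open>m + j + n\<close> has the
  parity of \<open>N - 1\<close>, so \<open>j\<close> can be taken as 0 or 1 and \<open>n\<close> as
  large as possible.\<close>

definition regular :: bool where
  "regular \<longleftrightarrow> lt * rt \<noteq> - (d2 / a2) * (if even N then q * d1 / a1 else 1) \<and>
    (\<forall>m<N. lt * rt \<noteq> tau m 0 (N - 1 - m)) \<and> (\<forall>m. Suc m < N \<longrightarrow> lt * rt \<noteq> tau m 1 (N - 2 - m))"

lemma tau_parity: "even (j + j') \<Longrightarrow> even (n + n') \<Longrightarrow> tau m j n = tau m j' n'"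
  by (auto simp: tau_def)

lemma good_iff: "good q lv N rv \<longleftrightarrow> (\<forall>m<N. lt * rt \<noteq> tau m 0 (N - 1 - m)) \<and> (\<forall>m. Suc m < N \<longrightarrow> lt * rt \<noteq> tau m 1 (N - 2 - m))"
proof -
  have s: "sq q rv 0 0 = rv" by (auto simp: sq_def[OF periodic_lv nz(1)] fun_eq_iff)
  show ?thesis
  proof (intro iffI conjI allI impI)
    assume g: "good q lv N rv"
    fix m assume m: "m < N"
    have "good q lv (Suc (N - 1 - m) + m) (sq q rv 0 0)" using m g by (simp add: s)
    from goodD[OF periodic_lv nz(1) this] show "lt * rt \<noteq> tau m 0 (N - 1 - m)" by (simp add: dt_tau)
  next
    assume g: "good q lv N rv"
    fix m assume m: "Suc m < N"
    then obtain n where n: "N = Suc n" by (cases N) auto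
    have "good q lv n (sq q rv 0 1)"
      using g sq_Suc[OF periodic_lv nz(1), of rv 0 0] unfolding n by (simp add: s)
    then have "good q lv (Suc (N - 2 - m) + m) (sq q rv 0 1)" using m n by simp
    from goodD[OF periodic_lv nz(1) this] show "lt * rt \<noteq> tau m 1 (N - 2 - m)" by (simp add: dt_tau)
  next
    assume a: "(\<forall>m<N. lt * rt \<noteq> tau m 0 (N - 1 - m)) \<and> (\<forall>m. Suc m < N \<longrightarrow> lt * rt \<noteq> tau m 1 (N - 2 - m))"
    have "good q lv N (sq q rv 0 0)"
    proof (rule goodI[OF periodic_lv nz(1)])
      fix m j n assume mjn: "m + j + n < 0 + 0 + N" "odd (m + j + n + 0 + 0 + N)"
      have "lt * rt \<noteq> tau m j n"
      proof (cases "even j")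
        case True
        have "tau m j n = tau m 0 (N - 1 - m)"
          using True mjn by (intro tau_parity) auto
        then show ?thesis using a mjn by auto
      next
        case False
        then have "Suc m < N" using mjn by (cases j) auto
        moreover have "tau m j n = tau m 1 (N - 2 - m)"
          using False mjn \<open>Suc m < N\<close> by (intro tau_parity) auto
        ultimately show ?thesis using a by auto
      qed
      then show "dt ((Kv q ^^ m) (rv j)) (lv n) \<noteq> 0" by (simp add: dt_tau)
    qed
    then show "good q lv N rv" by (simp add: s)
  qed
qed

lemma Y_can_chi:
  "\<exists>k. k \<noteq> 0 \<and> (\<forall>w\<in>words N. foldr sop (Yw N (can w)) chi = fsc (k * kap 0 (mu N (can w))) (Psi w))"
proof -
  obtain k where k: "k \<noteq> 0" "\<And>h. valid N h \<Longrightarrow> foldr sop (Yw N h) chi = fsc k (Phi 0 h)"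
    using Y_chi by blast
  have "foldr sop (Yw N (can w)) chi = fsc (k * kap 0 (mu N (can w))) (Psi w)" if "w \<in> words N" for w
  proof -
    have w: "length w = N" using that by (simp add: words_def)
    then have "valid N (can w)" "wd N (can w) = w" using valid_can[of w] wd_can[of w] by auto
    then show ?thesis by (simp only: k(2) Phi_def mult.assoc)
  qed
  with k(1) show ?thesis by blast
qed

lemma mu_can: "w \<in> words N \<Longrightarrow> mu N (can w) = 0 \<or> mu N (can w) = 1"
proof -
  assume "w \<in> words N"
  then obtain j where "j \<le> N" "can w j = nat ((ups w N - minup w) mod 2)"
    using can_min[of w] by (auto simp: words_def)
  then have "mu N (can w) \<le> nat ((ups w N - minup w) mod 2)" using mu_le[of j N "can w"] by simp
  then show ?thesis by linarith
qed

definition Y_indep :: bool where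
  "Y_indep \<longleftrightarrow> (\<forall>c. (\<forall>x. (\<Sum>w\<in>words N. c w * foldr sop (Yw N (can w)) chi x) = 0) \<longrightarrow> (\<forall>w\<in>words N. c w = 0))"

lemma regular_iff: "regular \<longleftrightarrow> KK 0 \<noteq> 0 \<and> good q lv N rv"
  unfolding regular_def good_iff KK0_iff by blast

text \<open>Canonical paths have minimum 0 or 1, so \<open>kap\<close> is 1 or \<open>KK 0\<close>,
  and \<open>Y_w chi\<close> is a nonzero multiple of \<open>Psi w\<close>, which reads only the
  first \<open>N\<close> spins.\<close>

lemma regular_Y_indep:
  assumes regular
    and z: "\<And>x. (\<And>j. N \<le> j \<Longrightarrow> \<not> x j) \<Longrightarrow> (\<Sum>w\<in>words N. c w * foldr sop (Yw N (can w)) chi x) = 0"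
    and w: "w \<in> words N"
  shows "c w = 0"
proof -
  obtain k where k: "k \<noteq> 0" "\<forall>w\<in>words N. foldr sop (Yw N (can w)) chi = fsc (k * kap 0 (mu N (can w))) (Psi w)"
    using Y_can_chi by blast
  have kn: "k * kap 0 (mu N (can w)) \<noteq> 0" if "w \<in> words N" for w
    using mu_can[OF that] assms(1) k(1) by (auto simp: kap_def regular_iff)
  have li: "lin_ind q lv rv N"
    using assms(1) good_lin_ind[OF periodic_lv nz(1)] by (simp add: regular_iff)
  have "c w * (k * kap 0 (mu N (can w))) = 0"
  proof (rule li[unfolded lin_ind_def, rule_format, OF _ w, where c = "\<lambda>w. c w * (k * kap 0 (mu N (can w)))"])
    fix xs :: "bool list" assume xs: "length xs = N"
    define x where "x j = (j < N \<and> xs ! j)" for j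
    have m: "map x [0..<N] = xs" using xs by (intro nth_equalityI) (auto simp: x_def)
    have "(\<Sum>w\<in>words N. c w * (k * kap 0 (mu N (can w))) * ev q lv rv 0 [] w xs)
        = (\<Sum>w\<in>words N. c w * foldr sop (Yw N (can w)) chi x)"
      using k(2) by (intro sum.cong) (auto simp: Psi_def m)
    also have "\<dots> = 0" by (rule z) (simp add: x_def)
    finally show "(\<Sum>w\<in>words N. c w * (k * kap 0 (mu N (can w))) * ev q lv rv 0 [] w xs) = 0" .
  qed
  then show ?thesis using kn[OF w] by simp
qed

lemma Y_indep_regular:
  assumes Y_indep
  shows regular
proof -
  obtain k where k: "k \<noteq> 0" "\<forall>w\<in>words N. foldr sop (Yw N (can w)) chi = fsc (k * kap 0 (mu N (can w))) (Psi w)"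
    using Y_can_chi by blast
  note ind = assms[unfolded Y_indep_def, rule_format]
  have K0: "KK 0 \<noteq> 0"
  proof
    assume K: "KK 0 = 0"
    \<comment> \<open>The canonical path of \<open>w\<close> has minimum 1, so its vector carries
      the factor \<open>KK 0\<close> and would be zero.\<close>
    define w where "w = wd N (zz N 1)"
    have w: "w \<in> words N" by (simp add: words_def w_def)
    obtain k' where k': "\<forall>j\<le>N. zz N 1 j = can w j + 2 * k'"
      using valid_eq_can_shift[OF valid_zz, of N 1] by (auto simp: w_def)
    obtain j where j: "j \<le> N" "zz N 1 j = 1" using mu_attained[of N "zz N 1"] mu_zz[OF N_pos, of 1] by auto
    then have "1 = can w j + 2 * k'" using k' by metis
    then have "k' = 0" by presburger
    then have "mu N (can w) = mu N (zz N 1)"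
      unfolding mu_def using k' by (intro arg_cong[where f = Min] image_cong) auto
    then have mu1: "mu N (can w) = 1" by (simp add: mu_zz[OF N_pos])
    have "(\<lambda>v. if v = w then 1 else 0 :: complex) w = 0"
    proof (rule ind[OF _ w, where c = "\<lambda>v. if v = w then 1 else 0"])
      fix x
      show "(\<Sum>v\<in>words N. (if v = w then 1 else 0) * foldr sop (Yw N (can v)) chi x) = 0"
        using k(2) K mu1 by (intro sum.neutral) (auto simp: kap_def)
    qed
    then show False by simp
  qed
  have kn: "k * kap 0 (mu N (can w)) \<noteq> 0" if "w \<in> words N" for w
    using mu_can[OF that] K0 k(1) by (auto simp: kap_def)
  have "lin_ind q lv rv N"
    unfolding lin_ind_def
  proof (intro allI impI ballI)
    fix c w assume z: "\<forall>xs. length xs = N \<longrightarrow> (\<Sum>w\<in>words N. c w * ev q lv rv 0 [] w xs) = 0" and w: "w \<in> words N"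
    have "c w / (k * kap 0 (mu N (can w))) = 0"
    proof (rule ind[OF _ w, where c = "\<lambda>w. c w / (k * kap 0 (mu N (can w)))"])
      fix x :: "nat \<Rightarrow> bool"
      have "(\<Sum>w\<in>words N. c w / (k * kap 0 (mu N (can w))) * foldr sop (Yw N (can w)) chi x)
          = (\<Sum>w\<in>words N. c w * ev q lv rv 0 [] w (map x [0..<N]))"
        using k(2) kn by (intro sum.cong) (auto simp: Psi_def)
      also have "\<dots> = 0" using z by simp
      finally show "(\<Sum>w\<in>words N. c w / (k * kap 0 (mu N (can w))) * foldr sop (Yw N (can w)) chi x) = 0" .
    qed
    then show "c w = 0" using kn[OF w] by simp
  qed
  moreover have "rv k False \<noteq> 0 \<or> rv k True \<noteq> 0" for k using nz by (simp add: rv_def)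
  ultimately have "good q lv N rv" by (rule lin_ind_good[OF periodic_lv nz(1)])
  with K0 show ?thesis by (simp add: regular_iff)
qed

lemma regular_spans:
  assumes regular
  shows "\<exists>c. \<forall>x. f (map x [0..<N]) = (\<Sum>w\<in>words N. c w * foldr sop (Yw N (can w)) chi x)"
proof -
  obtain k where k: "k \<noteq> 0" "\<forall>w\<in>words N. foldr sop (Yw N (can w)) chi = fsc (k * kap 0 (mu N (can w))) (Psi w)"
    using Y_can_chi by blast
  have kn: "k * kap 0 (mu N (can w)) \<noteq> 0" if "w \<in> words N" for w
    using mu_can[OF that] assms(1) k(1) by (auto simp: kap_def regular_iff)
  have "spans q lv rv N"
    using assms(1) good_spans[OF periodic_lv nz(1)] by (simp add: regular_iff)
  then obtain c where c: "\<And>xs. length xs = N \<Longrightarrow> f xs = (\<Sum>w\<in>words N. c w * ev q lv rv 0 [] w xs)"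
    unfolding spans_def by blast
  have "f (map x [0..<N]) = (\<Sum>w\<in>words N. c w / (k * kap 0 (mu N (can w))) * foldr sop (Yw N (can w)) chi x)" for x
    using k(2) kn by (subst c) (auto intro!: sum.cong simp: Psi_def)
  then show ?thesis
    by (intro exI[of _ "\<lambda>w. c w / (k * kap 0 (mu N (can w)))"]) blast
qed

end

section \<open>The double quotient\<close>

definition mon :: "nat list \<Rightarrow> ncpoly" where "mon u = Poly_Mapping.single (FWord u) 1"

lemma mon_Nil: "mon [] = 1"
  by (simp add: mon_def zero_fword_def[symmetric])

lemma mon_append: "mon (u @ v) = mon u * mon v"
  by (simp add: mon_def mult_single plus_fword_def)

lemma gen_mon: "gen i = mon [i]"
  by (simp add: gen_def mon_def)

lemma mon_Cons: "mon (i # u) = gen i * mon u"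
  using mon_append[of "[i]" u] by (simp add: gen_mon)

lemma const_mon: "const c * mon u = Poly_Mapping.single (FWord u) c"
  by (simp add: const_def mon_def mult_single)

lemma const_1: "const 1 = 1"
  by (simp add: const_def)

lemma const_0: "const 0 = 0"
  by (simp add: const_def)

lemma const_mult: "const c * const d = const (c * d)"
  by (simp add: const_def mult_single)

lemma const_add: "const c + const d = const (c + d)"
  by (simp add: const_def single_add)

lemma const_mon_comm: "mon u * const c = const c * mon u"
  by (simp add: const_def mon_def mult_single)

lemma poly_eq_sum: "p = (\<Sum>w\<in>Poly_Mapping.keys p. const (Poly_Mapping.lookup p w) * mon (letters w))" for p :: ncpoly
  by (rule poly_mapping_eqI)
    (auto simp: const_mon lookup_sum lookup_single when_def in_keys_iff)

lemma mon_carrier: "set u \<subseteq> {..N} \<Longrightarrow> mon u \<in> carrier (free_algebra N)"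
  by (auto simp: free_algebra_def mon_def)

lemma free_algebra_sum: "(\<And>i. i \<in> S \<Longrightarrow> f i \<in> carrier (free_algebra N)) \<Longrightarrow> sum f S \<in> carrier (free_algebra N)"
proof (induction S rule: infinite_finite_induct)
  case (insert x S)
  then show ?case by (simp add: free_algebra_add)
qed (simp_all add: free_algebra_def)

lemma free_algebra_induct [consumes 1, case_names zero add]:
  assumes "p \<in> carrier (free_algebra N)" and "P 0"
    and "\<And>c u p. set u \<subseteq> {..N} \<Longrightarrow> p \<in> carrier (free_algebra N) \<Longrightarrow> P p \<Longrightarrow> P (const c * mon u + p)"
  shows "P p"
proof -
  have "P (\<Sum>w\<in>S. const (Poly_Mapping.lookup p w) * mon (letters w))" if "finite S" "S \<subseteq> Poly_Mapping.keys p" for S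
    using that
  proof (induction S rule: finite_induct)
    case (insert w S)
    have sub: "set (letters w') \<subseteq> {..N}" if "w' \<in> Poly_Mapping.keys p" for w'
      using assms(1) that by (fastforce simp: free_algebra_def)
    then have "(\<Sum>w\<in>S. const (Poly_Mapping.lookup p w) * mon (letters w)) \<in> carrier (free_algebra N)"
      using insert.prems by (intro free_algebra_sum free_algebra_mult const_carrier mon_carrier) auto
    with insert sub show ?case by (auto intro: assms(3))
  qed (simp add: assms(2))
  then show ?thesis using poly_eq_sum[of p] by (metis finite_keys order_refl)
qed

section \<open>Evaluating noncommutative polynomials at operators\<close>

definition pact :: "(nat \<Rightarrow> ('x \<Rightarrow> complex) \<Rightarrow> 'x \<Rightarrow> complex) \<Rightarrow> ncpoly \<Rightarrow> ('x \<Rightarrow> complex) \<Rightarrow> 'x \<Rightarrow> complex" where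
  "pact e p f = (\<lambda>x. \<Sum>w\<in>Poly_Mapping.keys p. Poly_Mapping.lookup p w * foldr e (letters w) f x)"

locale lin_ops =
  fixes e :: "nat \<Rightarrow> ('x \<Rightarrow> complex) \<Rightarrow> 'x \<Rightarrow> complex"
  assumes op_add: "e i (\<lambda>x. f x + g x) = (\<lambda>x. e i f x + e i g x)"
    and op_sc: "e i (\<lambda>x. c * f x) = (\<lambda>x. c * e i f x)"
begin

lemma word_add: "foldr e u (\<lambda>x. f x + g x) = (\<lambda>x. foldr e u f x + foldr e u g x)"
  by (induction u) (simp_all add: op_add)

lemma word_scale: "foldr e u (\<lambda>x. c * f x) = (\<lambda>x. c * foldr e u f x)"
  by (induction u) (simp_all add: op_sc)

lemma word_zero: "foldr e u (\<lambda>x. 0) = (\<lambda>x. 0)"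
  using word_scale[of u 0 "\<lambda>x. 0"] by simp

lemma word_sum: "foldr e u (\<lambda>x. \<Sum>w\<in>S. f w x) = (\<lambda>x. \<Sum>w\<in>S. foldr e u (f w) x)"
  by (induction S rule: infinite_finite_induct) (simp_all add: word_zero word_add)

lemma pact_superset:
  assumes "finite S" "Poly_Mapping.keys p \<subseteq> S"
  shows "pact e p f x = (\<Sum>w\<in>S. Poly_Mapping.lookup p w * foldr e (letters w) f x)"
  unfolding pact_def using assms
  by (intro sum.mono_neutral_left) (auto simp: in_keys_iff)

lemma pact_add: "pact e (p + r) f = (\<lambda>x. pact e p f x + pact e r f x)"
proof
  fix x
  let ?S = "Poly_Mapping.keys p \<union> Poly_Mapping.keys r"
  have "pact e (p + r) f x = (\<Sum>w\<in>?S. Poly_Mapping.lookup (p + r) w * foldr e (letters w) f x)"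
    using Poly_Mapping.keys_add[of p r] by (intro pact_superset) auto
  also have "\<dots> = pact e p f x + pact e r f x"
    by (simp add: pact_superset[of ?S p] pact_superset[of ?S r] lookup_add distrib_right sum.distrib)
  finally show "pact e (p + r) f x = pact e p f x + pact e r f x" .
qed

lemma pact_zero: "pact e 0 f = (\<lambda>x. 0)"
  by (simp add: pact_def)

lemma pact_sum: "pact e (sum p S) f = (\<lambda>x. \<Sum>i\<in>S. pact e (p i) f x)"
  by (induction S rule: infinite_finite_induct) (simp_all add: pact_zero pact_add)

lemma pact_diff: "pact e (p - r) f = (\<lambda>x. pact e p f x - pact e r f x)"
  using pact_add[of "p - r" r f] by (auto simp: fun_eq_iff)

lemma pact_mon: "pact e (const c * mon u) f = (\<lambda>x. c * foldr e u f x)"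
  by (auto simp: const_mon pact_def)

lemma pact_mon1: "pact e (mon u) f = foldr e u f"
  using pact_mon[of 1 u f] by (simp add: const_1)

lemma pact_const: "pact e (const c) f = (\<lambda>x. c * f x)"
  using pact_mon[of c "[]" f] by (simp add: mon_Nil)

lemma pact_gen: "pact e (gen i) f = e i f"
  using pact_mon1[of "[i]" f] by (simp add: gen_mon)

lemma pact_arg_zero: "pact e p (\<lambda>x. 0) = (\<lambda>x. 0)"
  by (simp add: pact_def word_zero)

lemma pact_mult: "pact e (p * r) f = pact e p (pact e r f)"
proof -
  have mono: "pact e ((const a * mon u) * (const b * mon v)) f = pact e (const a * mon u) (pact e (const b * mon v) f)"
    for a b u v
  proof -
    have "(const a * mon u) * (const b * mon v) = const (a * b) * mon (u @ v)"
      by (metis (no_types, lifting) const_mon_comm const_mult mon_append mult.assoc)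
    then show ?thesis by (simp add: pact_mon word_scale mult.assoc)
  qed
  define P where "P w = const (Poly_Mapping.lookup p w) * mon (letters w)" for w
  define Q where "Q w = const (Poly_Mapping.lookup r w) * mon (letters w)" for w
  have p: "p = (\<Sum>w\<in>Poly_Mapping.keys p. P w)" and r: "r = (\<Sum>w\<in>Poly_Mapping.keys r. Q w)"
    unfolding P_def Q_def by (rule poly_eq_sum)+
  have 1: "pact e (P w * r) f = pact e (P w) (pact e r f)" for w
  proof -
    have "pact e (P w) (pact e r f) = pact e (P w) (\<lambda>x. \<Sum>w'\<in>Poly_Mapping.keys r. pact e (Q w') f x)"
      by (subst r) (simp add: pact_sum)
    also have "\<dots> = (\<lambda>x. \<Sum>w'\<in>Poly_Mapping.keys r. pact e (P w) (pact e (Q w') f) x)"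
      by (simp add: P_def pact_mon word_sum sum_distrib_left)
    also have "\<dots> = (\<lambda>x. \<Sum>w'\<in>Poly_Mapping.keys r. pact e (P w * Q w') f x)"
      unfolding P_def Q_def mono ..
    also have "\<dots> = pact e (P w * r) f"
      by (subst (2) r) (simp add: sum_distrib_left pact_sum)
    finally show ?thesis by simp
  qed
  have "pact e (p * r) f = pact e (\<Sum>w\<in>Poly_Mapping.keys p. P w * r) f"
    by (subst p) (simp add: sum_distrib_right)
  also have "\<dots> = (\<lambda>x. \<Sum>w\<in>Poly_Mapping.keys p. pact e (P w) (pact e r f) x)"
    by (simp add: pact_sum 1)
  also have "\<dots> = pact e p (pact e r f)"
    by (subst (2) p) (simp add: pact_sum)
  finally show ?thesis .
qed

text \<open>Being an ideal, the annihilator contains everything generated by relations that the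
  operators satisfy.\<close>

lemma ideal_annihilator:
  "ideal {p \<in> carrier (free_algebra N). \<forall>f. pact e p f = (\<lambda>x. 0)} (free_algebra N)" (is "ideal ?I _")
proof (rule idealI[OF ring_free_algebra])
  interpret R: ring "free_algebra N" by (rule ring_free_algebra)
  show "subgroup ?I (add_monoid (free_algebra N))"
  proof (rule R.add.subgroupI)
    show "?I \<noteq> {}" using R.zero_closed by (auto simp: free_algebra_sel pact_zero)
  next
    fix p assume p: "p \<in> ?I"
    have m: "\<ominus>\<^bsub>free_algebra N\<^esub> p = - p"
      using p R.minus_equality[of "- p" p] free_algebra_minus[OF R.zero_closed, of p] by (auto simp: free_algebra_sel)
    have "pact e (- p) f = (\<lambda>x. 0)" for f
      using p pact_diff[of 0 p f] by (simp add: pact_zero)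
    then show "\<ominus>\<^bsub>free_algebra N\<^esub> p \<in> ?I"
      using p R.a_inv_closed[of p] m by auto
  next
    fix p r assume "p \<in> ?I" "r \<in> ?I"
    then show "p \<oplus>\<^bsub>free_algebra N\<^esub> r \<in> ?I"
      by (auto simp: free_algebra_sel pact_add intro: free_algebra_add)
  qed auto
next
  fix a x assume "a \<in> ?I" "x \<in> carrier (free_algebra N)"
  then show "x \<otimes>\<^bsub>free_algebra N\<^esub> a \<in> ?I" "a \<otimes>\<^bsub>free_algebra N\<^esub> x \<in> ?I"
    by (auto simp: free_algebra_sel pact_mult pact_arg_zero intro: free_algebra_mult)
qed

end

definition rel_poly :: "nat list \<times> complex \<times> nat list \<Rightarrow> ncpoly" where
  "rel_poly = (\<lambda>(u, k, w). mon u - const k * mon w)"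

lemma btl_relations_eq: "btl_relations N \<delta> s1 s2 = rel_poly ` btl_rel N \<delta> s1 s2"
proof -
  have m2: "mon [i] * mon [j] = mon [i, j]" and m3: "mon [i, j] * mon [k] = mon [i, j, k]" for i j k
    using mon_append[of "[i]" "[j]"] mon_append[of "[i, j]" "[k]"] by simp_all
  have "btl_relations N \<delta> s1 s2 =
     {rel_poly ([i, i], \<delta>, [i]) | i. 1 \<le> i \<and> i \<le> N - 1}
   \<union> {rel_poly ([i, j, i], 1, [i]) | i j. 1 \<le> i \<and> i \<le> N - 1 \<and> (j = i + 1 \<or> j = i - 1)}
   \<union> {rel_poly ([0, 0], s1, [0]), rel_poly ([N, N], s2, [N])}
   \<union> {rel_poly ([i, j], 1, [j, i]) | i j. i \<le> N \<and> j \<le> N \<and> \<bar>int i - int j\<bar> > 1}"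
    unfolding btl_relations_def rel_poly_def m2 m3 gen_mon prod.case const_1 mult_1 ..
  also have "\<dots> = rel_poly ` btl_rel N \<delta> s1 s2"
    unfolding btl_rel_def image_Un by (intro arg_cong2[of _ _ _ _ "(\<union>)"]) blast+
  finally show ?thesis .
qed

lemma prod_list_gen: "prod_list (map gen is) = mon is"
  by (induction "is") (simp_all add: mon_Nil mon_Cons)

lemma dq_relations_eq: "dq_relations N \<delta> s1 s2 b = (\<lambda>r. btl_class N \<delta> s1 s2 (rel_poly r)) ` dq_rel N b"
  by (simp add: dq_relations_def dq_rel_def rel_poly_def I1_elem_def I2_elem_def prod_list_gen
      I1_word_def I2_word_def mon_append mult.assoc del: upt_Suc)

lemma coset_eq_iff:
  assumes "ideal I R" "x \<in> carrier R"
  shows "I +>\<^bsub>R\<^esub> x = I \<longleftrightarrow> x \<in> I"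
proof -
  interpret ideal I R by fact
  show ?thesis
    using a_rcos_self[OF assms(2)] a_rcos_const[of x] by auto
qed

section \<open>The two quotients as one quotient of the free algebra\<close>

locale dqr =
  fixes N :: nat and \<delta> s1 s2 b :: complex
  assumes N_pos: "1 \<le> N" and s1_nz: "s1 \<noteq> 0"
begin

abbreviation "FA \<equiv> free_algebra N"
abbreviation "BT \<equiv> two_BTL N \<delta> s1 s2"
abbreviation "DQ \<equiv> double_quotient N \<delta> s1 s2 b"

definition pj :: "ncpoly \<Rightarrow> ncpoly set set" where
  "pj p = dq_proj N \<delta> s1 s2 b (btl_class N \<delta> s1 s2 p)"

sublocale FA: ring FA by (rule ring_free_algebra)
sublocale BT: ring BT by (rule ring_two_BTL[OF N_pos])
sublocale DQ: ring DQ by (rule ring_double_quotient[OF N_pos])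

lemma btl_class_hom: "btl_class N \<delta> s1 s2 \<in> ring_hom FA BT"
  using ideal.rcos_ring_hom[OF ideal_btl_ideal[OF N_pos]] unfolding btl_class_def[abs_def] two_BTL_def .

lemma dq_proj_hom: "dq_proj N \<delta> s1 s2 b \<in> ring_hom BT DQ"
  using ideal.rcos_ring_hom[OF ideal_dq_ideal[OF N_pos]] unfolding dq_proj_def[abs_def] double_quotient_def .

lemma pj_hom: "pj \<in> ring_hom FA DQ"
proof -
  have "pj = dq_proj N \<delta> s1 s2 b \<circ> btl_class N \<delta> s1 s2" by (auto simp: pj_def)
  then show ?thesis using ring_hom_trans[OF btl_class_hom dq_proj_hom] by simp
qed

sublocale pj: ring_hom_ring FA DQ pj
  by (rule ring_hom_ringI2[OF FA.ring_axioms DQ.ring_axioms pj_hom])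

lemma btl_class_surj: "x \<in> carrier BT \<Longrightarrow> \<exists>p\<in>carrier FA. x = btl_class N \<delta> s1 s2 p"
  unfolding two_BTL_def FactRing_def A_RCOSETS_def' btl_class_def by auto

lemma dq_proj_surj: "x \<in> carrier DQ \<Longrightarrow> \<exists>y\<in>carrier BT. x = dq_proj N \<delta> s1 s2 b y"
  unfolding double_quotient_def FactRing_def A_RCOSETS_def' dq_proj_def by auto

lemma pj_surj: "x \<in> carrier DQ \<Longrightarrow> \<exists>p\<in>carrier FA. x = pj p"
  using dq_proj_surj btl_class_surj unfolding pj_def by metis

lemma pj_mult: "p \<in> carrier FA \<Longrightarrow> r \<in> carrier FA \<Longrightarrow> pj (p * r) = pj p \<otimes>\<^bsub>DQ\<^esub> pj r"
  using pj.hom_mult[of p r] by (simp add: free_algebra_sel)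

lemma pj_add: "p \<in> carrier FA \<Longrightarrow> r \<in> carrier FA \<Longrightarrow> pj (p + r) = pj p \<oplus>\<^bsub>DQ\<^esub> pj r"
  using pj.hom_add[of p r] by (simp add: free_algebra_sel)

lemma pj_one: "pj 1 = \<one>\<^bsub>DQ\<^esub>"
  using pj.hom_one by (simp add: free_algebra_sel)

lemma pj_zero: "pj 0 = \<zero>\<^bsub>DQ\<^esub>"
  using pj.hom_zero by (simp add: free_algebra_sel)

lemma pj_eq_iff:
  assumes "p \<in> carrier FA" "r \<in> carrier FA"
  shows "pj p = pj r \<longleftrightarrow> pj (p - r) = \<zero>\<^bsub>DQ\<^esub>"
proof -
  have "pj p = pj (p - r) \<oplus>\<^bsub>DQ\<^esub> pj r"
    using pj_add[OF free_algebra_minus[OF assms] assms(2)] by simp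
  then show ?thesis
    using pj.hom_closed[OF assms(2)] pj.hom_closed[OF free_algebra_minus[OF assms]]
      DQ.add.right_cancel[of "pj r" "pj (p - r)" "\<zero>\<^bsub>DQ\<^esub>"] by auto
qed

text \<open>The universal property of the two-step quotient, in the form in which a representation
  of the free algebra descends: \<open>J\<close> will be its annihilator.\<close>

lemma pj_ker_subset:
  assumes J: "ideal J FA" and rel: "rel_poly ` btl_rel N \<delta> s1 s2 \<subseteq> J" "rel_poly ` dq_rel N b \<subseteq> J"
    and p: "p \<in> carrier FA" "pj p = \<zero>\<^bsub>DQ\<^esub>"
  shows "p \<in> J"
proof -
  have I: "btl_ideal N \<delta> s1 s2 \<subseteq> J"
    unfolding btl_ideal_def btl_relations_eq using FA.genideal_minimal[OF J rel(1)] .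
  have "ideal (btl_class N \<delta> s1 s2 ` J) BT"
    using FA.ring_ideal_imp_quot_ideal[OF ideal_btl_ideal[OF N_pos] J]
    unfolding btl_class_def[abs_def] two_BTL_def .
  moreover have "dq_relations N \<delta> s1 s2 b \<subseteq> btl_class N \<delta> s1 s2 ` J"
    unfolding dq_relations_eq using rel(2) by auto
  ultimately have D: "dq_ideal N \<delta> s1 s2 b \<subseteq> btl_class N \<delta> s1 s2 ` J"
    unfolding dq_ideal_def by (rule BT.genideal_minimal)
  have "dq_ideal N \<delta> s1 s2 b +>\<^bsub>BT\<^esub> btl_class N \<delta> s1 s2 p = dq_ideal N \<delta> s1 s2 b"
    using p(2) unfolding pj_def dq_proj_def double_quotient_def by (simp add: FactRing_def)
  then have "btl_class N \<delta> s1 s2 p \<in> dq_ideal N \<delta> s1 s2 b"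
    using coset_eq_iff[OF ideal_dq_ideal[OF N_pos] btl_class_carrier[OF p(1)]] by blast
  with D obtain x where x: "x \<in> J" "btl_class N \<delta> s1 s2 p = btl_class N \<delta> s1 s2 x" by auto
  have xc: "x \<in> carrier FA" using x(1) ideal.Icarr[OF J] by blast
  have "p \<in> btl_ideal N \<delta> s1 s2 +>\<^bsub>FA\<^esub> p"
    using abelian_subgroup.a_rcos_self[OF ideal.axioms(1)[THEN abelian_subgroupI3, OF ideal_btl_ideal[OF N_pos] FA.abelian_group_axioms]] p(1) by blast
  then have "p \<in> btl_ideal N \<delta> s1 s2 +>\<^bsub>FA\<^esub> x"
    using x(2) by (simp add: btl_class_def)
  then obtain y where "y \<in> btl_ideal N \<delta> s1 s2" "p = y + x"
    unfolding a_r_coset_def' by (auto simp: free_algebra_sel)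
  then show ?thesis
    using I x(1) additive_subgroup.a_closed[OF ideal.axioms(1)[OF J], of y x] by (auto simp: free_algebra_sel)
qed

lemma rel_poly_carrier:
  "rel_poly ` btl_rel N \<delta> s1 s2 \<subseteq> carrier FA" "rel_poly ` dq_rel N b \<subseteq> carrier FA"
proof -
  show "rel_poly ` btl_rel N \<delta> s1 s2 \<subseteq> carrier FA"
    using btl_relations_carrier[OF N_pos] by (simp add: btl_relations_eq)
  show "rel_poly ` dq_rel N b \<subseteq> carrier FA"
    unfolding dq_rel_def rel_poly_def I1_word_def I2_word_def
    by (auto intro!: free_algebra_minus free_algebra_mult const_carrier mon_carrier simp del: upt_Suc)
qed

lemma pj_btl_rel: "r \<in> btl_rel N \<delta> s1 s2 \<Longrightarrow> pj (rel_poly r) = \<zero>\<^bsub>DQ\<^esub>"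
proof -
  assume r: "r \<in> btl_rel N \<delta> s1 s2"
  then have "rel_poly r \<in> btl_ideal N \<delta> s1 s2"
    unfolding btl_ideal_def btl_relations_eq using FA.genideal_self[OF rel_poly_carrier(1)] by blast
  then have "btl_class N \<delta> s1 s2 (rel_poly r) = \<zero>\<^bsub>BT\<^esub>"
    using r rel_poly_carrier(1) coset_eq_iff[OF ideal_btl_ideal[OF N_pos, of \<delta> s1 s2], of "rel_poly r"]
    by (auto simp: btl_class_def two_BTL_def FactRing_def)
  then show ?thesis
    using ring_hom_zero[OF dq_proj_hom BT.ring_axioms DQ.ring_axioms] by (simp add: pj_def)
qed

lemma pj_dq_rel: "r \<in> dq_rel N b \<Longrightarrow> pj (rel_poly r) = \<zero>\<^bsub>DQ\<^esub>"
proof -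
  assume r: "r \<in> dq_rel N b"
  have c: "dq_relations N \<delta> s1 s2 b \<subseteq> carrier BT"
    unfolding dq_relations_eq using rel_poly_carrier(2) btl_class_carrier by auto
  have "btl_class N \<delta> s1 s2 (rel_poly r) \<in> dq_relations N \<delta> s1 s2 b"
    unfolding dq_relations_eq using r by blast
  then have "btl_class N \<delta> s1 s2 (rel_poly r) \<in> dq_ideal N \<delta> s1 s2 b" "btl_class N \<delta> s1 s2 (rel_poly r) \<in> carrier BT"
    unfolding dq_ideal_def using BT.genideal_self[OF c] c by blast+
  then show ?thesis
    using coset_eq_iff[OF ideal_dq_ideal[OF N_pos]]
    by (simp add: pj_def dq_proj_def double_quotient_def FactRing_def)
qed

lemma pj_rel: "(u, k, w) \<in> btl_rel N \<delta> s1 s2 \<union> dq_rel N b \<Longrightarrow> set u \<subseteq> {..N} \<and> set w \<subseteq> {..N} \<and> pj (mon u) = pj (const k * mon w)"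
proof -
  assume r: "(u, k, w) \<in> btl_rel N \<delta> s1 s2 \<union> dq_rel N b"
  then have sub: "set u \<subseteq> {..N}" "set w \<subseteq> {..N}"
    using N_pos by (auto simp: btl_rel_def dq_rel_def I1_word_def I2_word_def simp del: upt_Suc)
  moreover have "pj (mon u - const k * mon w) = \<zero>\<^bsub>DQ\<^esub>"
    using r pj_btl_rel[of "(u, k, w)"] pj_dq_rel[of "(u, k, w)"] by (auto simp: rel_poly_def)
  ultimately show ?thesis
    by (subst pj_eq_iff) (auto intro: mon_carrier free_algebra_mult const_carrier)
qed

text \<open>Left multiplication, extended by the identity outside the carrier, so that the operator
  identities hold on the whole type.\<close>

definition ge :: "nat \<Rightarrow> ncpoly set set \<Rightarrow> ncpoly set set" where
  "ge i v = (if v \<in> carrier DQ \<and> i \<le> N then pj (gen i) \<otimes>\<^bsub>DQ\<^esub> v else v)"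

definition gs :: "complex \<Rightarrow> ncpoly set set \<Rightarrow> ncpoly set set" where
  "gs c v = (if v \<in> carrier DQ then pj (const c) \<otimes>\<^bsub>DQ\<^esub> v else v)"

lemma pj_closed: "p \<in> carrier FA \<Longrightarrow> pj p \<in> carrier DQ"
  by (rule pj.hom_closed)

lemma pj_mult_act: "p \<in> carrier FA \<Longrightarrow> r \<in> carrier FA \<Longrightarrow> v \<in> carrier DQ \<Longrightarrow>
    pj p \<otimes>\<^bsub>DQ\<^esub> (pj r \<otimes>\<^bsub>DQ\<^esub> v) = pj (p * r) \<otimes>\<^bsub>DQ\<^esub> v"
  by (simp add: pj_mult DQ.m_assoc pj_closed)

lemma ge_word: "set u \<subseteq> {..N} \<Longrightarrow> v \<in> carrier DQ \<Longrightarrow> foldr ge u v = pj (mon u) \<otimes>\<^bsub>DQ\<^esub> v"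
proof (induction u)
  case Nil
  then show ?case by (simp add: mon_Nil pj_one)
next
  case (Cons i u)
  then show ?case
    by (simp add: ge_def mon_Cons pj_mult_act pj_closed mon_carrier gen_carrier)
qed

lemma ge_word_off: "v \<notin> carrier DQ \<Longrightarrow> foldr ge u v = v"
  by (induction u) (simp_all add: ge_def)

sublocale act: btl_dq N ge gs \<delta> s1 s2 b
proof -
  have rel: "foldr ge u v = gs k (foldr ge w v)" if "(u, k, w) \<in> btl_rel N \<delta> s1 s2 \<union> dq_rel N b" for u k w v
  proof (cases "v \<in> carrier DQ")
    case True
    have r: "set u \<subseteq> {..N}" "set w \<subseteq> {..N}" "pj (mon u) = pj (const k * mon w)" using pj_rel[OF that] by auto
    then show ?thesis
      using True by (simp add: ge_word gs_def pj_mult_act const_carrier mon_carrier pj_closed)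
  next
    case False
    then show ?thesis by (simp add: ge_word_off gs_def)
  qed
  show "btl_dq N ge gs \<delta> s1 s2 b"
  proof
    show "gs c (gs d v) = gs (c * d) v" for c d v
      by (simp add: gs_def pj_mult_act const_carrier pj_closed const_mult)
    show "gs 1 v = v" for v by (simp add: gs_def const_1 pj_one)
    show "ge i (gs c v) = gs c (ge i v)" if "i \<le> N" for i c v
      using that const_mon_comm[of "[i]" c]
      by (simp add: gs_def ge_def pj_mult_act const_carrier mon_carrier pj_closed gen_mon)
  qed (use N_pos s1_nz rel in auto)
qed

end

primrec Epoly :: "complex \<Rightarrow> nat \<Rightarrow> ncpoly" where
  "Epoly s 0 = 1"
| "Epoly s (Suc k) = const (s powi ((-1) ^ Suc k)) * Epoly s k * gen k * Epoly s k"

lemma Epoly_carrier: "k \<le> Suc N \<Longrightarrow> Epoly s k \<in> carrier (free_algebra N)"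
  by (induction k) (auto intro!: free_algebra_mult const_carrier gen_carrier one_carrier)

lemma Yw_zz: "Yw N (zz N 0) = Jw N"
proof -
  have "Yw N (zz N 0) = Yu N (zz N 0) (Suc (hsz N (zz N 0)))"
    by (rule Yu_stable[symmetric]) simp
  also have "\<dots> = lev N (zz N 0) 1"
    by (rule Yu_low) (simp add: zz_def)
  finally show ?thesis using lev_one[OF valid_zz] by simp
qed

section \<open>The left ideal and its spanning family\<close>

context dqr
begin

definition EE :: "ncpoly set set" where "EE = E_idem N \<delta> s1 s2 b N"

lemma dq_const_pj: "dq_const N \<delta> s1 s2 b c = pj (const c)"
  by (simp add: dq_const_def pj_def)

lemma dq_gen_pj: "dq_gen N \<delta> s1 s2 b i = pj (gen i)"
  by (simp add: dq_gen_def pj_def)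

lemma pj_Epoly: "k \<le> Suc N \<Longrightarrow> pj (Epoly s1 k) = E_idem N \<delta> s1 s2 b k"
proof (induction k)
  case (Suc k)
  then have c: "Epoly s1 k \<in> carrier FA" by (intro Epoly_carrier) simp
  show ?case
    using Suc c by (simp add: pj_mult free_algebra_mult const_carrier gen_carrier dq_const_pj dq_gen_pj)
qed (simp add: pj_one)

lemma EE_pj: "EE = pj (Epoly s1 N)"
  by (simp add: EE_def pj_Epoly)

lemma EE_closed: "EE \<in> carrier DQ"
  unfolding EE_pj by (intro pj_closed Epoly_carrier) simp

lemma ge_apply: "i \<le> N \<Longrightarrow> v \<in> carrier DQ \<Longrightarrow> ge i v = pj (gen i) \<otimes>\<^bsub>DQ\<^esub> v"
  and gs_apply: "v \<in> carrier DQ \<Longrightarrow> gs c v = pj (const c) \<otimes>\<^bsub>DQ\<^esub> v"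
  by (simp_all add: ge_def gs_def)

lemma act_Eop: "k \<le> Suc N \<Longrightarrow> v \<in> carrier DQ \<Longrightarrow> act.Eop k v = pj (Epoly s1 k) \<otimes>\<^bsub>DQ\<^esub> v"
proof (induction k arbitrary: v)
  case (Suc k)
  then have c: "Epoly s1 k \<in> carrier FA" by (intro Epoly_carrier) simp
  have "act.Eop (Suc k) v = gs (s1 powi ((-1) ^ Suc k)) (pj (Epoly s1 k) \<otimes>\<^bsub>DQ\<^esub> (pj (gen k) \<otimes>\<^bsub>DQ\<^esub> (pj (Epoly s1 k) \<otimes>\<^bsub>DQ\<^esub> v)))"
    using Suc c by (simp add: ge_apply act.cf_def pj_closed gen_carrier)
  then show ?case
    using Suc.prems c by (simp add: gs_apply pj_closed gen_carrier pj_mult_act free_algebra_mult const_carrier mult.assoc)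
qed (simp add: pj_one)

lemma EE_eq: "act.Eop N \<one>\<^bsub>DQ\<^esub> = EE"
  using act_Eop[of N "\<one>\<^bsub>DQ\<^esub>"] EE_closed by (simp add: EE_pj)

definition comb :: "(bool list \<Rightarrow> complex) \<Rightarrow> ncpoly" where
  "comb c = (\<Sum>w\<in>words N. const (c w) * mon (Yw N (can w)))"

text \<open>The coordinate map of the spanning family \<open>Y_w E_N\<close>; it sees a coefficient
  function only through its values on \<open>words N\<close>.\<close>

definition UU :: "(bool list \<Rightarrow> complex) \<Rightarrow> ncpoly set set" where
  "UU c = pj (comb c) \<otimes>\<^bsub>DQ\<^esub> EE"

lemma Y_carrier: "mon (Yw N h) \<in> carrier FA"
  by (rule mon_carrier) (rule Yw_subset)

lemma comb_carrier: "comb c \<in> carrier FA"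
  unfolding comb_def by (intro free_algebra_sum free_algebra_mult const_carrier Y_carrier)

lemma UU_closed: "UU c \<in> carrier DQ"
  by (simp add: UU_def pj_closed comb_carrier EE_closed)

lemma UU_add: "UU (\<lambda>w. c w + d w) = UU c \<oplus>\<^bsub>DQ\<^esub> UU d"
proof -
  have "comb (\<lambda>w. c w + d w) = comb c + comb d"
    by (simp add: comb_def const_add[symmetric] distrib_right sum.distrib)
  then show ?thesis
    by (simp add: UU_def pj_add comb_carrier DQ.l_distr pj_closed EE_closed)
qed

lemma UU_sc: "gs k (UU c) = UU (\<lambda>w. k * c w)"
proof -
  have "comb (\<lambda>w. k * c w) = const k * comb c"
    by (simp add: comb_def const_mult[symmetric] sum_distrib_left mult.assoc)
  then show ?thesis
    using UU_closed[of c] by (simp add: gs_apply UU_def pj_mult_act const_carrier comb_carrier EE_closed)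
qed

lemma UU_cong: "(\<And>w. w \<in> words N \<Longrightarrow> c w = d w) \<Longrightarrow> UU c = UU d"
  unfolding UU_def comb_def by (simp cong: sum.cong)

lemma UU_zero: "UU (\<lambda>w. 0) = \<zero>\<^bsub>DQ\<^esub>"
  by (simp add: UU_def comb_def const_0 pj_zero EE_closed)

lemma UU_single:
  assumes "w \<in> words N"
  shows "UU (\<lambda>v. if v = w then k else 0) = gs k (foldr ge (Yw N (can w)) EE)"
proof -
  have "comb (\<lambda>v. if v = w then k else 0) = (\<Sum>v\<in>words N. if v = w then const k * mon (Yw N (can v)) else 0)"
    unfolding comb_def by (intro sum.cong) (auto simp: const_0)
  also have "\<dots> = const k * mon (Yw N (can w))" using assms by simp
  finally show ?thesis
    using EE_closed by (simp add: UU_def ge_word Yw_subset gs_apply pj_mult_act const_carrier Y_carrier pj_closed)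
qed

lemma Y_EE_UU: "valid N h \<Longrightarrow> foldr ge (Yw N h) EE \<in> range UU"
proof -
  assume h: "valid N h"
  obtain k where "\<forall>j\<le>N. h j = can (wd N h) j + 2 * k"
    using valid_eq_can_shift[OF h] by auto
  then have "foldr ge (Yw N h) EE = gs (b ^ k) (foldr ge (Yw N (can (wd N h))) EE)"
    using act.Y_shifts[OF h] by auto
  also have "\<dots> \<in> range UU"
    using UU_single[of "wd N h" "b ^ k"] by (simp add: words_def) (metis rangeI)
  finally show ?thesis .
qed

lemma range_UU_zero: "\<zero>\<^bsub>DQ\<^esub> \<in> range UU"
  unfolding UU_zero[symmetric] by (rule rangeI)

lemma range_UU_add: "x \<in> range UU \<Longrightarrow> y \<in> range UU \<Longrightarrow> x \<oplus>\<^bsub>DQ\<^esub> y \<in> range UU"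
  by (auto simp flip: UU_add)

lemma range_UU_sc: "x \<in> range UU \<Longrightarrow> gs k x \<in> range UU"
  by (auto simp: UU_sc)

lemma ge_UU: "i \<le> N \<Longrightarrow> ge i (UU c) \<in> range UU"
proof -
  assume i: "i \<le> N"
  define f where "f w = const (c w) * (gen i * mon (Yw N (can w)))" for w
  have fc: "f w \<in> carrier FA" for w
    unfolding f_def using i by (intro free_algebra_mult const_carrier gen_carrier Y_carrier)
  have one: "pj (f w) \<otimes>\<^bsub>DQ\<^esub> EE \<in> range UU" if w: "w \<in> words N" for w
  proof -
    have lw: "length w = N" using w by (simp add: words_def)
    obtain k h' where h': "valid N h'" "ge i (foldr ge (Yw N (can w)) EE) = gs k (foldr ge (Yw N h') EE)"
      using act.Y_closed[OF _ i, of "can w"] valid_can[of w] lw by auto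
    have "pj (f w) \<otimes>\<^bsub>DQ\<^esub> EE = gs (c w) (ge i (foldr ge (Yw N (can w)) EE))"
      using i EE_closed by (simp add: f_def ge_word Yw_subset gs_apply ge_apply pj_mult_act const_carrier gen_carrier
          Y_carrier free_algebra_mult pj_closed)
    then show ?thesis unfolding h'(2) by (simp add: range_UU_sc Y_EE_UU h'(1))
  qed
  have "pj (sum f S) \<otimes>\<^bsub>DQ\<^esub> EE \<in> range UU" if "finite S" "S \<subseteq> words N" for S
    using that
  proof (induction S rule: finite_induct)
    case empty
    show ?case using range_UU_zero by (simp add: pj_zero EE_closed)
  next
    case (insert w S)
    then have "pj (sum f (insert w S)) \<otimes>\<^bsub>DQ\<^esub> EE = (pj (f w) \<otimes>\<^bsub>DQ\<^esub> EE) \<oplus>\<^bsub>DQ\<^esub> (pj (sum f S) \<otimes>\<^bsub>DQ\<^esub> EE)"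
      using fc by (simp add: pj_add free_algebra_sum DQ.l_distr pj_closed EE_closed)
    with insert one show ?case by (simp add: range_UU_add)
  qed
  moreover have "gen i * comb c = sum f (words N)"
    unfolding comb_def f_def sum_distrib_left
    using const_mon_comm[of "[i]"] by (intro sum.cong) (auto simp: gen_mon simp flip: mult.assoc)
  ultimately show ?thesis
    using i UU_closed[of c] by (simp add: ge_apply UU_def pj_mult_act gen_carrier comb_carrier EE_closed)
qed

lemma range_UU_word: "x \<in> range UU \<Longrightarrow> set u \<subseteq> {..N} \<Longrightarrow> foldr ge u x \<in> range UU"
  by (induction u) (auto intro: ge_UU)

text \<open>\<open>F E_N\<close> is a nonzero multiple of \<open>E_N\<close>. Moreover
  \<open>F = M J\<close>, where \<open>J E_N\<close> is the vector of the lowest zigzag, and the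
  span is closed under the letters of \<open>M\<close>.\<close>

lemma EE_UU: "EE \<in> range UU"
proof -
  obtain f where f: "f \<noteq> 0" "foldr ge (Fw N) EE = gs f EE"
    using act.Fw_Eop[of N] unfolding EE_eq[symmetric] by auto
  have "foldr ge (Jw N) EE \<in> range UU"
    using Y_EE_UU[OF valid_zz, of 0] by (simp add: Yw_zz)
  moreover have "set (Mw N) \<subseteq> {..N}" by (auto dest!: Mw_less)
  ultimately have "gs f EE \<in> range UU"
    unfolding f(2)[symmetric] act.Fw_eq[OF order_refl] by (rule range_UU_word)
  then have "gs (1 / f) (gs f EE) \<in> range UU" by (rule range_UU_sc)
  then show ?thesis using f(1) by simp
qed

lemma pj_UU: "p \<in> carrier FA \<Longrightarrow> x \<in> range UU \<Longrightarrow> pj p \<otimes>\<^bsub>DQ\<^esub> x \<in> range UU"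
proof (induction p rule: free_algebra_induct)
  case zero
  then have "x \<in> carrier DQ" using UU_closed by auto
  then show ?case using range_UU_zero by (simp add: pj_zero)
next
  case (add c u p)
  have x: "x \<in> carrier DQ" using add.prems UU_closed by auto
  have "pj (const c * mon u + p) \<otimes>\<^bsub>DQ\<^esub> x = gs c (foldr ge u x) \<oplus>\<^bsub>DQ\<^esub> (pj p \<otimes>\<^bsub>DQ\<^esub> x)"
    using add x by (simp add: pj_add free_algebra_mult const_carrier mon_carrier DQ.l_distr pj_closed ge_word gs_apply pj_mult_act)
  then show ?case using add by (simp add: range_UU_add range_UU_sc range_UU_word)
qed

lemma W_mod_eq: "W_mod N \<delta> s1 s2 b = range UU"
proof
  show "W_mod N \<delta> s1 s2 b \<subseteq> range UU"
    unfolding W_mod_def EE_def[symmetric] using pj_surj pj_UU[OF _ EE_UU] by blast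
  show "range UU \<subseteq> W_mod N \<delta> s1 s2 b"
    unfolding W_mod_def EE_def[symmetric] UU_def using pj_closed[OF comb_carrier] by blast
qed

lemma btl_submodule_iff: "btl_submodule N \<delta> s1 s2 b U \<longleftrightarrow>
    additive_subgroup U DQ \<and> (\<forall>p\<in>carrier FA. \<forall>u\<in>U. pj p \<otimes>\<^bsub>DQ\<^esub> u \<in> U)"
  unfolding btl_submodule_def pj_def using btl_class_surj btl_class_carrier by metis

lemma additive_subgroupI_act:
  assumes "U \<subseteq> carrier DQ" "\<zero>\<^bsub>DQ\<^esub> \<in> U" "\<And>x y. x \<in> U \<Longrightarrow> y \<in> U \<Longrightarrow> x \<oplus>\<^bsub>DQ\<^esub> y \<in> U"
    and "\<And>p u. p \<in> carrier FA \<Longrightarrow> u \<in> U \<Longrightarrow> pj p \<otimes>\<^bsub>DQ\<^esub> u \<in> U"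
  shows "btl_submodule N \<delta> s1 s2 b U"
proof -
  have "\<ominus>\<^bsub>DQ\<^esub> u \<in> U" if u: "u \<in> U" for u
  proof -
    have c: "u \<in> carrier DQ" "pj (const (- 1)) \<in> carrier DQ" using u assms(1) by (auto intro: pj_closed const_carrier)
    have "(pj (const (- 1)) \<otimes>\<^bsub>DQ\<^esub> u) \<oplus>\<^bsub>DQ\<^esub> u = (pj (const (- 1)) \<oplus>\<^bsub>DQ\<^esub> pj (const 1)) \<otimes>\<^bsub>DQ\<^esub> u"
      using c by (simp add: DQ.l_distr const_1 pj_one)
    also have "pj (const (- 1)) \<oplus>\<^bsub>DQ\<^esub> pj (const 1) = \<zero>\<^bsub>DQ\<^esub>"
      using pj_add[OF const_carrier const_carrier, of "- 1" 1] by (simp add: const_add const_0 pj_zero)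
    finally have "\<ominus>\<^bsub>DQ\<^esub> u = pj (const (- 1)) \<otimes>\<^bsub>DQ\<^esub> u"
      using c by (simp add: DQ.minus_equality)
    then show ?thesis using assms(4)[OF const_carrier u] by simp
  qed
  then have "additive_subgroup U DQ"
    using assms(1-3) by (intro additive_subgroupI DQ.add.subgroupI) auto
  with assms(4) show ?thesis by (simp add: btl_submodule_iff)
qed

lemma W_submodule: "btl_submodule N \<delta> s1 s2 b (range UU)"
  using UU_closed by (intro additive_subgroupI_act range_UU_add range_UU_zero pj_UU) auto

end

section \<open>The dimension, given independence of the family\<close>

locale dqr_inj = dqr +
  assumes UU_inj: "UU c = \<zero>\<^bsub>double_quotient N \<delta> s1 s2 b\<^esub> \<Longrightarrow> w \<in> words N \<Longrightarrow> c w = 0"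
begin

lemma UU_inj_eq:
  assumes "UU c = UU d" "w \<in> words N"
  shows "c w = d w"
proof -
  have "UU (\<lambda>w. c w + (- 1) * d w) = UU c \<oplus>\<^bsub>DQ\<^esub> UU (\<lambda>w. (- 1) * d w)"
    by (rule UU_add)
  also have "\<dots> = UU (\<lambda>w. d w + (- 1) * d w)" unfolding UU_add assms(1) ..
  also have "\<dots> = \<zero>\<^bsub>DQ\<^esub>" by (simp add: UU_zero)
  finally show ?thesis using UU_inj[OF _ assms(2)] by fastforce
qed

text \<open>The words are added one at a time: each new vector lies outside the previous span by
  independence and extends it by a line.\<close>

lemma W_dim: "has_complex_dim N \<delta> s1 s2 b (2 ^ N) (W_mod N \<delta> s1 s2 b)"
proof -
  define sub where "sub S = UU ` {c. \<forall>w. w \<notin> S \<longrightarrow> c w = 0}" for S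
  have "DQ.dimension (card S) (range (dq_const N \<delta> s1 s2 b)) (sub S)" if "finite S" "S \<subseteq> words N" for S
    using that
  proof (induction S rule: finite_induct)
    case empty
    have "{c :: bool list \<Rightarrow> complex. \<forall>w. w \<notin> {} \<longrightarrow> c w = 0} = {\<lambda>w. 0}" by auto
    then have "sub {} = {\<zero>\<^bsub>DQ\<^esub>}" by (simp add: sub_def UU_zero)
    then show ?case by simp
  next
    case (insert w S)
    define v where "v = UU (\<lambda>u. if u = w then 1 else 0)"
    have w: "w \<in> words N" using insert.prems by simp
    have vc: "v \<in> carrier DQ" by (simp add: v_def UU_closed)
    have "v \<notin> sub S"
    proof
      assume "v \<in> sub S"
      then obtain c where c: "v = UU c" "\<And>u. u \<notin> S \<Longrightarrow> c u = 0" by (auto simp: sub_def)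
      have "(if w = w then 1 else 0) = c w"
        using UU_inj_eq[of "\<lambda>u. if u = w then 1 else 0" c w] c(1) w unfolding v_def by blast
      with c(2) insert.hyps(2) show False by simp
    qed
    moreover have "DQ.line_extension (range (dq_const N \<delta> s1 s2 b)) v (sub S) = sub (insert w S)"
    proof (rule Set.set_eqI)
      fix x
      have kv: "dq_const N \<delta> s1 s2 b k \<otimes>\<^bsub>DQ\<^esub> v = UU (\<lambda>u. if u = w then k else 0)" for k
      proof -
        have "dq_const N \<delta> s1 s2 b k \<otimes>\<^bsub>DQ\<^esub> v = gs k v" using vc by (simp add: gs_apply dq_const_pj)
        also have "\<dots> = UU (\<lambda>u. k * (if u = w then 1 else 0))" unfolding v_def by (rule UU_sc)
        also have "(\<lambda>u. k * (if u = w then 1 else 0)) = (\<lambda>u. if u = w then k else 0)" by auto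
        finally show ?thesis .
      qed
      have "x \<in> DQ.line_extension (range (dq_const N \<delta> s1 s2 b)) v (sub S)
          \<longleftrightarrow> (\<exists>k. \<exists>y\<in>sub S. x = UU (\<lambda>u. if u = w then k else 0) \<oplus>\<^bsub>DQ\<^esub> y)"
        unfolding DQ.line_extension_mem_iff using kv by auto
      also have "\<dots> \<longleftrightarrow> x \<in> sub (insert w S)"
      proof
        assume "\<exists>k. \<exists>y\<in>sub S. x = UU (\<lambda>u. if u = w then k else 0) \<oplus>\<^bsub>DQ\<^esub> y"
        then obtain k c where c: "\<And>u. u \<notin> S \<Longrightarrow> c u = 0" "x = UU (\<lambda>u. if u = w then k else 0) \<oplus>\<^bsub>DQ\<^esub> UU c"
          by (auto simp: sub_def)
        then have "x = UU (\<lambda>u. (if u = w then k else 0) + c u)" by (simp add: UU_add)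
        then show "x \<in> sub (insert w S)" unfolding sub_def using c(1) by (intro image_eqI) auto
      next
        assume "x \<in> sub (insert w S)"
        then obtain c where c: "\<And>u. u \<notin> insert w S \<Longrightarrow> c u = 0" "x = UU c" by (auto simp: sub_def)
        have "UU c = UU (\<lambda>u. (if u = w then c w else 0) + (if u = w then 0 else c u))"
          by (rule UU_cong) auto
        then have "x = UU (\<lambda>u. if u = w then c w else 0) \<oplus>\<^bsub>DQ\<^esub> UU (\<lambda>u. if u = w then 0 else c u)"
          by (simp only: c(2) UU_add)
        moreover have "UU (\<lambda>u. if u = w then 0 else c u) \<in> sub S"
          unfolding sub_def using c(1) by (intro imageI) auto
        ultimately show "\<exists>k. \<exists>y\<in>sub S. x = UU (\<lambda>u. if u = w then k else 0) \<oplus>\<^bsub>DQ\<^esub> y" by blast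
      qed
      finally show "x \<in> DQ.line_extension (range (dq_const N \<delta> s1 s2 b)) v (sub S) \<longleftrightarrow> x \<in> sub (insert w S)" .
    qed
    ultimately show ?case
      using insert DQ.Suc_dim[OF vc, of "sub S" "card S" "range (dq_const N \<delta> s1 s2 b)"] by simp
  qed
  from this[OF finite_words order_refl] have "DQ.dimension (2 ^ N) (range (dq_const N \<delta> s1 s2 b)) (sub (words N))"
    by (simp add: card_words)
  moreover have "sub (words N) = range UU"
  proof
    show "range UU \<subseteq> sub (words N)"
    proof
      fix x assume "x \<in> range UU"
      then obtain c where "x = UU c" by blast
      also have "UU c = UU (\<lambda>w. if w \<in> words N then c w else 0)" by (rule UU_cong) simp
      finally have "x = UU (\<lambda>w. if w \<in> words N then c w else 0)" .
      then show "x \<in> sub (words N)" unfolding sub_def by (intro image_eqI) auto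
    qed
  qed (auto simp: sub_def)
  ultimately show ?thesis unfolding has_complex_dim_def W_mod_eq by simp
qed

end

section \<open>Maps from the left ideal to a representation\<close>

locale repn = dqr N \<delta> s1 s2 b + lin_ops e + rp: btl_dq N e "\<lambda>c f x. c * f x" \<delta> s1 s2 b
  for N :: nat and \<delta> s1 s2 b :: complex and e :: "nat \<Rightarrow> ('x \<Rightarrow> complex) \<Rightarrow> 'x \<Rightarrow> complex"
begin

lemma ker_acts:
  assumes "p \<in> carrier FA" "pj p = \<zero>\<^bsub>DQ\<^esub>"
  shows "pact e p f = (\<lambda>x. 0)"
proof -
  have r: "pact e (rel_poly r) f = (\<lambda>x. 0)" if "r \<in> btl_rel N \<delta> s1 s2 \<union> dq_rel N b" for r f
  proof -
    obtain u k w where ukw: "r = (u, k, w)" by (cases r)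
    have "foldr e u f = (\<lambda>x. k * foldr e w f x)" using that ukw rp.rel rp.dq by auto
    then show ?thesis by (simp add: ukw rel_poly_def pact_diff pact_mon pact_mon1)
  qed
  have "p \<in> {p \<in> carrier FA. \<forall>f. pact e p f = (\<lambda>x. 0)}"
    using rel_poly_carrier r by (intro pj_ker_subset[OF ideal_annihilator] assms) auto
  then show ?thesis by simp
qed

lemma pact_Epoly: "pact e (Epoly s1 k) f = rp.Eop k f"
proof (induction k arbitrary: f)
  case (Suc k)
  then show ?case by (simp add: pact_mult pact_const pact_gen rp.cf_def)
next
  case 0
  then show ?case using pact_mon1[of "[]" f] by (simp add: mon_Nil)
qed

text \<open>This makes \<open>p E_N\<close> act on a vector fixed by the idempotent: equality of
  \<open>p E_N\<close> and \<open>r E_N\<close> puts the difference of the corresponding polynomials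
  into the kernel of the projection, which acts as zero.\<close>

lemma act_welldef:
  assumes "p \<in> carrier FA" "r \<in> carrier FA" "pj p \<otimes>\<^bsub>DQ\<^esub> EE = pj r \<otimes>\<^bsub>DQ\<^esub> EE"
  shows "pact e p (rp.Eop N f) = pact e r (rp.Eop N f)"
proof -
  have E: "Epoly s1 N \<in> carrier FA" by (rule Epoly_carrier) simp
  have "pj (p * Epoly s1 N) = pj (r * Epoly s1 N)"
    using assms E by (simp add: pj_mult EE_pj)
  then have "pj (p * Epoly s1 N - r * Epoly s1 N) = \<zero>\<^bsub>DQ\<^esub>"
    using assms E by (simp add: pj_eq_iff free_algebra_mult)
  then have "pact e (p * Epoly s1 N - r * Epoly s1 N) f = (\<lambda>x. 0)"
    using assms E by (intro ker_acts free_algebra_minus free_algebra_mult)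
  then show ?thesis
    by (simp add: pact_diff pact_mult pact_Epoly fun_eq_iff)
qed

lemma pact_comb: "pact e (comb c) f = (\<lambda>x. \<Sum>w\<in>words N. c w * foldr e (Yw N (can w)) f x)"
  by (simp add: comb_def pact_sum pact_mon)

end

lemma (in btl_act_nz) Y_Fw:
  "\<exists>c. c \<noteq> 0 \<and> (\<forall>h v. valid N h \<longrightarrow> foldr e (Yw N h) (foldr e (Fw N) v) = sc c (foldr e (Yw N h) v))"
proof -
  obtain c where c: "c \<noteq> 0" "\<And>v. foldr e (Jw N) (foldr e (Fw N) v) = sc c (foldr e (Jw N) v)"
    using Jw_Fw[of N] by auto
  have "foldr e (Yw N h) (foldr e (Fw N) v) = sc c (foldr e (Yw N h) v)" if h: "valid N h" for h v
  proof -
    have "foldr e (Yu N h (Suc H)) (foldr e (Fw N) v) = sc c (foldr e (Yu N h (Suc H)) v)" for H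
    proof (induction H)
      case 0
      have "Yu N h (Suc 0) = Jw N" using lev_one[OF h] by simp
      then show ?case by (simp only: c(2))
    next
      case (Suc H)
      have "set (lev N h (Suc (Suc H))) \<subseteq> {..N}" by (auto simp: set_lev)
      with Suc show ?case
        by (simp only: Yu.simps(2)[of N h "Suc H"] foldr_append comp_def word_sc)
    qed
    from this[of "hsz N h"] show ?thesis by (simp only: Yu_stable le_SucI order_refl)
  qed
  with c(1) show ?thesis by blast
qed

section \<open>The module for arbitrary parameters\<close>

text \<open>The product of the two strand weights as a function of \<open>t = lt * rt\<close>. It is
  invariant under replacing \<open>t\<close> by \<open>d1 * d2 / (a1 * a2 * t)\<close>.\<close>

definition bfun :: "nat \<Rightarrow> complex \<Rightarrow> complex \<Rightarrow> complex \<Rightarrow> complex \<Rightarrow> complex \<Rightarrow> complex \<Rightarrow> complex" where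
  "bfun N q a1 d1 a2 d2 t = d1 * d2 / t + a1 * a2 * t +
     (if even N then q * d1 * d2 + a1 * a2 / q else a1 * d2 + a2 * d1)"

lemma (in spin) KK_prod: "KK 0 * KK 1 = bfun N q a1 d1 a2 d2 (lt * rt)"
proof (cases "even N")
  case True
  then have "KK 0 = pr 1 1" "KK 1 = pr 0 0" unfolding KK_def by (auto intro: pr_parity)
  then have "KK 0 * KK 1 = pr 1 1 * pr 0 0" by simp
  also have "\<dots> = bfun N q a1 d1 a2 d2 (lt * rt)"
    using True nz by (simp add: pr_def lv_def rv_def bfun_def field_simps)
  finally show ?thesis .
next
  case False
  then have "KK 0 = pr 0 1" "KK 1 = pr 1 0" unfolding KK_def by (auto intro: pr_parity)
  then have "KK 0 * KK 1 = pr 0 1 * pr 1 0" by simp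
  also have "\<dots> = bfun N q a1 d1 a2 d2 (lt * rt)"
    using False nz by (simp add: pr_def lv_def rv_def bfun_def field_simps)
  finally show ?thesis .
qed

lemma (in spin) lin_ops_sop: "lin_ops sop"
  by standard (simp_all add: sop_add sop_sc)

section \<open>All chains at once, and the module in coordinates\<close>

locale spin_family =
  fixes N :: nat and q a1 d1 a2 d2 :: complex
  assumes N_pos: "1 \<le> N"
    and nz: "q \<noteq> 0" "q\<^sup>2 \<noteq> 1" "a1 \<noteq> 0" "d1 \<noteq> 0" "a2 \<noteq> 0" "d2 \<noteq> 0"
    and s1_nz: "a1 + d1 \<noteq> 0"
    and bl: "a1 / q + q * d1 = 1" and br: "a2 / q + q * d2 = 1"
begin

lemma spin: "lt \<noteq> 0 \<Longrightarrow> rt \<noteq> 0 \<Longrightarrow> spin N q a1 d1 a2 d2 lt rt"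
  by (intro spin.intro) (simp_all add: N_pos[simplified] nz s1_nz bl br)

text \<open>A default at \<open>t = 0\<close>, where there is no chain, so that the family is
  defined for all \<open>t\<close>.\<close>

definition tz :: "complex \<Rightarrow> complex" where "tz t = (if t = 0 then 1 else t)"

lemma tz_nz [simp]: "tz t \<noteq> 0" by (simp add: tz_def)

definition so :: "complex \<Rightarrow> nat \<Rightarrow> ((nat \<Rightarrow> bool) \<Rightarrow> complex) \<Rightarrow> (nat \<Rightarrow> bool) \<Rightarrow> complex" where
  "so t = spin.sop N q a1 d1 a2 d2 1 (tz t)"

abbreviation ch :: "(nat \<Rightarrow> bool) \<Rightarrow> complex" where "ch \<equiv> spin.chi N"

abbreviation bt :: "complex \<Rightarrow> complex" where "bt \<equiv> bfun N q a1 d1 a2 d2"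

lemma spin_t: "spin N q a1 d1 a2 d2 1 (tz t)"
  by (rule spin) simp_all

lemma so_dq: "btl_dq N (so t) (\<lambda>c f x. c * f x) (q + 1 / q) (a1 + d1) (a2 + d2) (bt (tz t))"
proof -
  interpret spin N q a1 d1 a2 d2 1 "tz t" by (rule spin_t)
  show ?thesis
    unfolding so_def using btl_dq_axioms KK_prod by simp
qed

lemma so_lin: "lin_ops (so t)"
  unfolding so_def by (rule spin.lin_ops_sop[OF spin_t])

text \<open>The product of all chains; the path calculus on it yields structure constants common to
  all \<open>t\<close>. As \<open>b\<close> varies with \<open>t\<close>, the lowering of paths by
  powers of \<open>b\<close> is done at each \<open>t\<close> separately.\<close>

definition po :: "nat \<Rightarrow> (complex \<Rightarrow> (nat \<Rightarrow> bool) \<Rightarrow> complex) \<Rightarrow> complex \<Rightarrow> (nat \<Rightarrow> bool) \<Rightarrow> complex" where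
  "po i F = (\<lambda>t. so t i (F t))"

lemma po_word: "foldr po u F t = foldr (so t) u (F t)"
  by (induction u) (simp_all add: po_def)

lemma po_act: "btl_act_nz N po (\<lambda>c F t x. c * F t x) (q + 1 / q) (a1 + d1) (a2 + d2)"
proof
  show "foldr po u F = (\<lambda>t x. k * foldr po w F t x)"
    if "(u, k, w) \<in> btl_rel N (q + 1 / q) (a1 + d1) (a2 + d2)" for u k w F
  proof
    fix t
    interpret S: btl_dq N "so t" "\<lambda>c f x. c * f x" "q + 1 / q" "a1 + d1" "a2 + d2" "bt (tz t)" by (rule so_dq)
    show "foldr po u F t = (\<lambda>x. k * foldr po w F t x)" unfolding po_word by (rule S.rel[OF that])
  qed
  show "po i (\<lambda>t x. c * v t x) = (\<lambda>t x. c * po i v t x)" for i c v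
    using lin_ops.op_sc[OF so_lin] by (simp add: po_def)
qed (use N_pos s1_nz in \<open>simp_all add: mult.assoc\<close>)

lemma structure_constants:
  assumes "i \<le> N" "w \<in> words N"
  shows "\<exists>c k w'. w' \<in> words N \<and> (\<forall>t v. so t i (foldr (so t) (Yw N (can w)) v)
    = (\<lambda>x. c * bt (tz t) ^ k * foldr (so t) (Yw N (can w')) v x))"
proof -
  interpret P: btl_act_nz N po "\<lambda>c F t x. c * F t x" "q + 1 / q" "a1 + d1" "a2 + d2" by (rule po_act)
  have v: "valid N (can w)" using valid_can[of w] assms(2) by (simp add: words_def)
  obtain c h' where h': "valid N h'" "\<And>F. po i (foldr po (Yw N (can w)) F) = (\<lambda>t x. c * foldr po (Yw N h') F t x)"
    using P.Y_closed[OF v assms(1)] by auto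
  obtain k where k: "\<forall>j\<le>N. h' j = can (wd N h') j + 2 * k"
    using valid_eq_can_shift[OF h'(1)] by auto
  have "so t i (foldr (so t) (Yw N (can w)) v) = (\<lambda>x. c * bt (tz t) ^ k * foldr (so t) (Yw N (can (wd N h'))) v x)" for t v
  proof -
    interpret S: btl_dq N "so t" "\<lambda>c f x. c * f x" "q + 1 / q" "a1 + d1" "a2 + d2" "bt (tz t)" by (rule so_dq)
    have "so t i (foldr (so t) (Yw N (can w)) v) = (\<lambda>x. c * foldr (so t) (Yw N h') v x)"
      using fun_cong[OF h'(2)[of "\<lambda>t. v"], of t] by (simp add: po_word po_def)
    also have "foldr (so t) (Yw N h') v = (\<lambda>x. bt (tz t) ^ k * foldr (so t) (Yw N (can (wd N h'))) v x)"
      using S.Y_shifts[OF h'(1)] k by blast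
    finally show ?thesis by (simp only: mult.assoc)
  qed
  then show ?thesis by (intro exI[of _ c] exI[of _ k] exI[of _ "wd N h'"]) (simp add: words_def)
qed

definition sca :: "nat \<Rightarrow> bool list \<Rightarrow> complex \<times> nat \<times> bool list" where
  "sca i w = (SOME (c, k, w'). w' \<in> words N \<and> (\<forall>t v. so t i (foldr (so t) (Yw N (can w)) v)
    = (\<lambda>x. c * bt (tz t) ^ k * foldr (so t) (Yw N (can w')) v x)))"

abbreviation cc where "cc i w \<equiv> fst (sca i w)"
abbreviation kk where "kk i w \<equiv> fst (snd (sca i w))"
abbreviation ww where "ww i w \<equiv> snd (snd (sca i w))"

lemma sca:
  assumes "i \<le> N" "w \<in> words N"
  shows "ww i w \<in> words N" "so t i (foldr (so t) (Yw N (can w)) v)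
    = (\<lambda>x. cc i w * bt (tz t) ^ kk i w * foldr (so t) (Yw N (can (ww i w))) v x)"
proof -
  have "\<exists>r. case r of (c, k, w') \<Rightarrow> w' \<in> words N \<and> (\<forall>t v. so t i (foldr (so t) (Yw N (can w)) v)
    = (\<lambda>x. c * bt (tz t) ^ k * foldr (so t) (Yw N (can w')) v x))"
    using structure_constants[OF assms] by (simp add: split_paired_Ex)
  from someI_ex[OF this] show "ww i w \<in> words N" "so t i (foldr (so t) (Yw N (can w)) v)
    = (\<lambda>x. cc i w * bt (tz t) ^ kk i w * foldr (so t) (Yw N (can (ww i w))) v x)"
    unfolding sca_def[symmetric] by (auto simp: case_prod_beta)
qed

text \<open>The module in coordinates. Its structure constants are polynomials in \<open>b\<close>, so relations that
  hold for generic \<open>b\<close>, where the coordinate vectors embed into the spin chain, hold for all \<open>b\<close>.\<close>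

definition TT :: "complex \<Rightarrow> nat \<Rightarrow> (bool list \<Rightarrow> complex) \<Rightarrow> bool list \<Rightarrow> complex" where
  "TT b i c = (\<lambda>w'. \<Sum>w\<in>words N. if ww i w = w' then c w * cc i w * b ^ kk i w else 0)"

lemma TT_lin: "lin_ops (TT b)"
  by standard (auto simp: TT_def fun_eq_iff sum.distrib[symmetric] sum_distrib_left algebra_simps intro!: sum.cong)

definition BB :: "complex \<Rightarrow> (bool list \<Rightarrow> complex) \<Rightarrow> (nat \<Rightarrow> bool) \<Rightarrow> complex" where
  "BB t c = (\<lambda>x. \<Sum>w\<in>words N. c w * foldr (so t) (Yw N (can w)) ch x)"

text \<open>The coordinate map to the chain is an intertwiner for every \<open>t\<close>, including
  those where it is not injective.\<close>

lemma BB_TT: "i \<le> N \<Longrightarrow> BB t (TT (bt (tz t)) i c) = so t i (BB t c)"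
proof
  fix x assume i: "i \<le> N"
  interpret lin_ops "so t" by (rule so_lin)
  let ?Y = "\<lambda>w. foldr (so t) (Yw N (can w)) ch"
  have "BB t (TT (bt (tz t)) i c) x = (\<Sum>w'\<in>words N. \<Sum>w\<in>words N.
      if ww i w = w' then c w * cc i w * bt (tz t) ^ kk i w * ?Y w' x else 0)"
    unfolding BB_def TT_def sum_distrib_right by (intro sum.cong refl) simp
  also have "\<dots> = (\<Sum>w\<in>words N. \<Sum>w'\<in>words N.
      if ww i w = w' then c w * cc i w * bt (tz t) ^ kk i w * ?Y w' x else 0)"
    by (rule sum.swap)
  also have "\<dots> = (\<Sum>w\<in>words N. c w * so t i (?Y w) x)"
    using sca[OF i] by (intro sum.cong refl) (simp add: mult.assoc)
  also have "\<dots> = so t i (BB t c) x"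
    using fun_cong[OF word_sum[of "[i]" "\<lambda>w x. c w * ?Y w x" "words N"], of x]
    by (simp add: BB_def op_sc)
  finally show "BB t (TT (bt (tz t)) i c) x = so t i (BB t c) x" .
qed

lemma BB_word: "set u \<subseteq> {..N} \<Longrightarrow> BB t (foldr (TT (bt (tz t))) u c) = foldr (so t) u (BB t c)"
  by (induction u) (simp_all add: BB_TT)

lemma TT_off: "w \<notin> words N \<Longrightarrow> i \<le> N \<Longrightarrow> TT b i c w = 0"
  unfolding TT_def using sca(1) by (intro sum.neutral) auto

definition reg :: "complex \<Rightarrow> bool" where "reg t \<longleftrightarrow> t \<noteq> 0 \<and> spin.regular N q a1 d1 a2 d2 1 t"

lemma eventually_reg: "eventually reg (at t0)"
proof -
  have "eventually (\<lambda>t. t \<noteq> 0 \<and> t \<noteq> - (d2 / a2) * (if even N then q * d1 / a1 else 1) \<and>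
      (\<forall>m\<in>{..<N}. t \<noteq> spin.tau q a1 d1 a2 d2 m 0 (N - 1 - m)) \<and>
      (\<forall>m\<in>{..<N}. t \<noteq> spin.tau q a1 d1 a2 d2 m 1 (N - 2 - m))) (at t0)"
    by (intro eventually_conj eventually_ball_finite ballI eventually_neq_at_within) auto
  then show ?thesis
  proof (rule eventually_mono)
    fix t assume t: "t \<noteq> 0 \<and> t \<noteq> - (d2 / a2) * (if even N then q * d1 / a1 else 1) \<and>
      (\<forall>m\<in>{..<N}. t \<noteq> spin.tau q a1 d1 a2 d2 m 0 (N - 1 - m)) \<and>
      (\<forall>m\<in>{..<N}. t \<noteq> spin.tau q a1 d1 a2 d2 m 1 (N - 2 - m))"
    then interpret spin N q a1 d1 a2 d2 1 t by (intro spin) auto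
    show "reg t" unfolding reg_def regular_def using t by auto
  qed
qed

lemma BB_inj:
  assumes "reg t" "\<And>x. BB t c x = k * BB t d x" "w \<in> words N"
  shows "c w = k * d w"
proof -
  have t: "tz t = t" using assms(1) by (simp add: reg_def tz_def)
  interpret spin N q a1 d1 a2 d2 1 t using spin_t[of t] t by simp
  have "c w - k * d w = 0"
  proof (rule regular_Y_indep[OF _ _ assms(3), of "\<lambda>w. c w - k * d w"])
    show regular using assms(1) by (simp add: reg_def)
    fix x
    show "(\<Sum>w\<in>words N. (c w - k * d w) * foldr sop (Yw N (can w)) chi x) = 0"
      using assms(2)[of x] by (simp add: BB_def so_def t left_diff_distrib sum_subtractf sum_distrib_left mult.assoc)
  qed
  then show ?thesis by simp
qed

lemma bt_cont: "t0 \<noteq> 0 \<Longrightarrow> isCont bt t0"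
  unfolding bfun_def by (intro continuous_intros) auto

lemma TT_cont: "t0 \<noteq> 0 \<Longrightarrow> isCont (\<lambda>t. foldr (TT (bt t)) u c w) t0"
proof (induction u arbitrary: w)
  case (Cons i u)
  have "isCont (\<lambda>t. \<Sum>v\<in>words N. if ww i v = w then foldr (TT (bt t)) u c v * cc i v * bt t ^ kk i v else 0) t0"
  proof (intro continuous_sum)
    fix v
    show "isCont (\<lambda>t. if ww i v = w then foldr (TT (bt t)) u c v * cc i v * bt t ^ kk i v else 0) t0"
      using Cons bt_cont by (cases "ww i v = w") (auto intro!: continuous_intros)
  qed
  then show ?case by (simp add: TT_def[of _ i])
qed simp

text \<open>At regular \<open>t\<close> the map to the chain is injective, so an identity in the
  chains becomes one in coordinates. Both sides are continuous at \<open>t0\<close>, and all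
  \<open>t\<close> near \<open>t0\<close>, except possibly \<open>t0\<close> itself, are
  regular.\<close>

lemma TT_limit:
  assumes t0: "t0 \<noteq> 0" and sub: "set u \<subseteq> {..N}" "set v \<subseteq> {..N}" and \<kappa>: "isCont \<kappa> t0"
    and eq: "\<And>t x. reg t \<Longrightarrow> foldr (so t) u (BB t c) x = \<kappa> t * foldr (so t) v (BB t d) x"
    and w: "w \<in> words N"
  shows "foldr (TT (bt t0)) u c w = \<kappa> t0 * foldr (TT (bt t0)) v d w"
proof -
  define f where "f t = foldr (TT (bt t)) u c w - \<kappa> t * foldr (TT (bt t)) v d w" for t
  have "isCont f t0"
    unfolding f_def using \<kappa> TT_cont[OF t0] by (intro continuous_intros) auto
  then have A: "(f \<longlongrightarrow> f t0) (at t0)" by (simp only: isCont_def)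
  have "f t = 0" if r: "reg t" for t
  proof -
    have t: "tz t = t" using r by (simp add: reg_def tz_def)
    have "BB t (foldr (TT (bt t)) u c) x = \<kappa> t * BB t (foldr (TT (bt t)) v d) x" for x
      using eq[OF r, of x] BB_word[OF sub(1), of t c] BB_word[OF sub(2), of t d] by (simp only: t)
    from BB_inj[OF r this w] show ?thesis by (simp add: f_def)
  qed
  then have "eventually (\<lambda>t. f t = 0) (at t0)"
    using eventually_reg by (rule eventually_mono[rotated])
  then have B: "(f \<longlongrightarrow> 0) (at t0)" by (rule tendsto_eventually)
  show ?thesis using LIM_unique[OF A B] by (simp add: f_def)
qed

text \<open>Nonemptiness matters for coordinates outside \<open>words N\<close>: \<open>TT\<close>
  kills them, the empty word keeps them.\<close>

lemma btl_rel_words: "(u, k, w) \<in> btl_rel N \<delta> s1 s2 \<union> dq_rel N b \<Longrightarrow> set u \<subseteq> {..N} \<and> set w \<subseteq> {..N} \<and> u \<noteq> [] \<and> w \<noteq> []"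
proof -
  assume r: "(u, k, w) \<in> btl_rel N \<delta> s1 s2 \<union> dq_rel N b"
  have "1 \<in> set (I1_word N)" "0 \<in> set (I2_word N)" using N_pos by (auto simp: I1_word_def I2_word_def)
  then have "I1_word N \<noteq> []" "I2_word N \<noteq> []" by auto
  then show ?thesis
    using r N_pos by (auto simp: btl_rel_def dq_rel_def) (auto simp: I1_word_def I2_word_def simp del: upt_Suc)
qed

lemma TT_dq: "t0 \<noteq> 0 \<Longrightarrow> btl_dq N (TT (bt t0)) (\<lambda>c f x. c * f x) (q + 1 / q) (a1 + d1) (a2 + d2) (bt t0)"
proof
  assume t0: "t0 \<noteq> 0"
  have rel: "foldr (TT (bt t0)) u c = (\<lambda>x. k t0 * foldr (TT (bt t0)) w c x)"
    if sub: "set u \<subseteq> {..N} \<and> set w \<subseteq> {..N} \<and> u \<noteq> [] \<and> w \<noteq> []" and k: "isCont k t0"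
      and eq: "\<And>t f x. t \<noteq> 0 \<Longrightarrow> foldr (so t) u f x = k t * foldr (so t) w f x" for u k w c
  proof
    fix x
    show "foldr (TT (bt t0)) u c x = k t0 * foldr (TT (bt t0)) w c x"
    proof (cases "x \<in> words N")
      case True
      then show ?thesis using sub k eq by (intro TT_limit[OF t0]) (auto simp: reg_def)
    next
      case False
      have "foldr (TT (bt t0)) u c x = 0" if "set u \<subseteq> {..N}" "u \<noteq> []" for u
        using that False by (cases u) (auto simp: TT_off)
      then show ?thesis using sub by simp
    qed
  qed
  show "foldr (TT (bt t0)) u c = (\<lambda>x. k * foldr (TT (bt t0)) w c x)"
    if r: "(u, k, w) \<in> btl_rel N (q + 1 / q) (a1 + d1) (a2 + d2)" for u k w c
  proof (rule rel[where k = "\<lambda>_. k"])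
    show "set u \<subseteq> {..N} \<and> set w \<subseteq> {..N} \<and> u \<noteq> [] \<and> w \<noteq> []" using r btl_rel_words[of u k w] by blast
    fix t f x
    interpret S: btl_dq N "so t" "\<lambda>c f x. c * f x" "q + 1 / q" "a1 + d1" "a2 + d2" "bt (tz t)" by (rule so_dq)
    show "foldr (so t) u f x = k * foldr (so t) w f x" using S.rel[OF r] by simp
  qed simp
  show "foldr (TT (bt t0)) u c = (\<lambda>x. k * foldr (TT (bt t0)) w c x)"
    if r: "(u, k, w) \<in> dq_rel N (bt t0)" for u k w c
  proof -
    have k: "k = bt t0" using r by (auto simp: dq_rel_def)
    show ?thesis
      unfolding k
    proof (rule rel[OF _ bt_cont[OF t0]])
      show "set u \<subseteq> {..N} \<and> set w \<subseteq> {..N} \<and> u \<noteq> [] \<and> w \<noteq> []" using r btl_rel_words[of u k w] by blast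
      fix t :: complex and f x assume t: "t \<noteq> 0"
      interpret S: btl_dq N "so t" "\<lambda>c f x. c * f x" "q + 1 / q" "a1 + d1" "a2 + d2" "bt (tz t)" by (rule so_dq)
      have "(u, bt t, w) \<in> dq_rel N (bt t)" using r by (auto simp: dq_rel_def)
      then show "foldr (so t) u f x = bt t * foldr (so t) w f x" using S.dq[of u "bt t" w f] t by (simp add: tz_def)
    qed
  qed
  show "TT (bt t0) i (\<lambda>x. c * v x) = (\<lambda>x. c * TT (bt t0) i v x)" for i c v
    using lin_ops.op_sc[OF TT_lin] by simp
qed (use N_pos s1_nz in \<open>simp_all add: mult.assoc\<close>)

lemma dqr: "dqr N (a1 + d1)"
  by unfold_locales (fact N_pos s1_nz)+

lemma dqr_inj:
  assumes t0: "t0 \<noteq> 0"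
  shows "dqr_inj N (q + 1 / q) (a1 + d1) (a2 + d2) (bt t0)"
proof -
  interpret V: btl_dq N "TT (bt t0)" "\<lambda>c f x. c * f x" "q + 1 / q" "a1 + d1" "a2 + d2" "bt t0" by (rule TT_dq[OF t0])
  interpret R: repn N "q + 1 / q" "a1 + d1" "a2 + d2" "bt t0" "TT (bt t0)"
    by (intro repn.intro dqr TT_lin V.btl_dq_axioms)
  interpret P: btl_act_nz N po "\<lambda>c F t x. c * F t x" "q + 1 / q" "a1 + d1" "a2 + d2" by (rule po_act)
  define wz where "wz = wd N (zz N 0)"
  define eZ :: "bool list \<Rightarrow> complex" where "eZ w = (if w = wz then 1 else 0)" for w
  \<comment> \<open>The coordinate counterpart of \<open>F chi\<close>. The vector
    \<open>chi\<close> need not come from coordinates, but \<open>J chi\<close> is the image of the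
    basis vector \<open>eZ\<close>, and \<open>F = M J\<close>.\<close>
  define z where "z = foldr (TT (bt t0)) (Mw N) eZ"
  have wz: "wz \<in> words N" by (simp add: wz_def words_def)
  have Msub: "set (Mw N) \<subseteq> {..N}" by (auto dest!: Mw_less)
  have Ywz: "Yw N (can wz) = Jw N"
  proof -
    obtain k where k: "\<forall>j\<le>N. zz N 0 j = can wz j + 2 * k"
      using valid_eq_can_shift[OF valid_zz, of N 0] by (auto simp: wz_def)
    obtain j where "j \<le> N" "zz N 0 j = 0" using mu_attained[of N "zz N 0"] mu_zz[OF N_pos, of 0] by auto
    with k have "k = 0" by fastforce
    with k have "Yw N (can wz) = Yw N (zz N 0)" by (intro Yw_cong) simp
    then show ?thesis by (simp add: Yw_zz)
  qed
  \<comment> \<open>Taken from the product of all chains, so that the factor is independent of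
    \<open>t\<close> and survives the limit.\<close>
  obtain k where k: "k \<noteq> 0" "\<And>h F. valid N h \<Longrightarrow> foldr po (Yw N h) (foldr po (Fw N) F) = (\<lambda>t x. k * foldr po (Yw N h) F t x)"
    using P.Y_Fw by auto
  obtain k2 where k2: "k2 \<noteq> 0" "\<And>h v. valid N h \<Longrightarrow> foldr (TT (bt t0)) (Yw N h) (foldr (TT (bt t0)) (Fw N) v)
      = (\<lambda>x. k2 * foldr (TT (bt t0)) (Yw N h) v x)"
    using V.Y_Fw by auto
  have Yz: "foldr (TT (bt t0)) (Yw N (can w)) z v = k * (if v = w then 1 else 0)"
    if w: "w \<in> words N" and v: "v \<in> words N" for w v
  proof -
    have valid: "valid N (can w)" using valid_can[of w] w by (simp add: words_def)
    have "foldr (TT (bt t0)) (Yw N (can w) @ Mw N) eZ v = k * foldr (TT (bt t0)) [] (\<lambda>v. if v = w then 1 else 0) v"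
    proof (rule TT_limit[OF t0 _ _ _ _ v])
      fix t x assume "reg t"
      interpret S: btl_dq N "so t" "\<lambda>c f x. c * f x" "q + 1 / q" "a1 + d1" "a2 + d2" "bt (tz t)" by (rule so_dq)
      have B: "BB t eZ = foldr (so t) (Jw N) ch"
        using wz by (simp add: BB_def eZ_def Ywz[symmetric] if_distrib[of "\<lambda>c. c * _"] cong: if_cong)
      have "foldr (so t) (Yw N (can w) @ Mw N) (BB t eZ) = foldr (so t) (Yw N (can w)) (foldr (so t) (Fw N) ch)"
        by (simp add: B S.Fw_eq)
      also have "\<dots> = (\<lambda>x. k * foldr (so t) (Yw N (can w)) ch x)"
        using fun_cong[OF k(2)[OF valid, of "\<lambda>_. ch"], of t] by (simp add: po_word)
      also have "foldr (so t) (Yw N (can w)) ch = BB t (\<lambda>v. if v = w then 1 else 0)"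
        using w by (simp add: BB_def if_distrib[of "\<lambda>c. c * _"] cong: if_cong)
      finally show "foldr (so t) (Yw N (can w) @ Mw N) (BB t eZ) x = k * foldr (so t) [] (BB t (\<lambda>v. if v = w then 1 else 0)) x"
        by simp
    qed (use Msub Yw_subset in auto)
    then show ?thesis by (simp add: z_def)
  qed
  show ?thesis
  proof
    fix c w assume U: "R.UU c = \<zero>\<^bsub>R.DQ\<^esub>" and w: "w \<in> words N"
    \<comment> \<open>The idempotent fixes this vector, and \<open>comb c\<close> sends it to a
      nonzero multiple of \<open>c\<close> on \<open>words N\<close>.\<close>
    let ?f = "foldr (TT (bt t0)) (Fw N) z"
    have "pact (TT (bt t0)) (R.comb c) (V.Eop N ?f) = pact (TT (bt t0)) 0 (V.Eop N ?f)"
      using U R.UU_zero R.comb_carrier R.pj_zero R.EE_closed R.FA.zero_closed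
      by (intro R.act_welldef) (auto simp: R.UU_def free_algebra_sel)
    then have "(\<Sum>v\<in>words N. c v * foldr (TT (bt t0)) (Yw N (can v)) ?f w) = 0"
      by (simp add: V.Eop_Fw R.pact_comb R.pact_zero fun_eq_iff)
    also have "(\<Sum>v\<in>words N. c v * foldr (TT (bt t0)) (Yw N (can v)) ?f w)
        = (\<Sum>v\<in>words N. if v = w then c v * (k2 * k) else 0)"
    proof (intro sum.cong refl)
      fix v assume v: "v \<in> words N"
      then have "valid N (can v)" using valid_can[of v] by (simp add: words_def)
      then show "c v * foldr (TT (bt t0)) (Yw N (can v)) ?f w = (if v = w then c v * (k2 * k) else 0)"
        using k2(2) Yz[OF v w] by auto
    qed
    finally show "c w = 0" using w k(1) k2(1) by simp
  qed
qed

end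

section \<open>Irreducibility\<close>

text \<open>The configuration \<open>even\<close> alternates, so each cup meets opposite spins and
  no local factor vanishes.\<close>

lemma (in spin) Psi_alt_nz: "Psi (alt c) even \<noteq> 0"
proof -
  have "loc i even \<noteq> 0" if "i \<le> N" for i
    using that nz N_pos by (auto simp: loc_def lv_def rv_def uu_def)
  then show ?thesis by (auto simp: Psi_alt prod_list_zero_iff set_cls)
qed

section \<open>Transposition of spin chains\<close>

definition conf :: "nat \<Rightarrow> (nat \<Rightarrow> bool) set" where "conf n = {x. \<forall>j. n \<le> j \<longrightarrow> \<not> x j}"

lemma finite_conf [simp]: "finite (conf n)"
proof (rule finite_subset)
  show "conf n \<subseteq> (\<lambda>S j. j \<in> S) ` Pow {..<n}"
  proof
    fix x assume "x \<in> conf n"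
    then have "{j. x j} \<subseteq> {..<n}" by (auto simp: conf_def not_le[symmetric])
    then show "x \<in> (\<lambda>S j. j \<in> S) ` Pow {..<n}" by (intro image_eqI[of _ _ "{j. x j}"]) auto
  qed
qed simp

lemma sum_conf_site:
  fixes h :: "(nat \<Rightarrow> bool) \<Rightarrow> complex"
  assumes "k < n"
  shows "2 * (\<Sum>x\<in>conf n. h x) = (\<Sum>x\<in>conf n. h (x(k := False)) + h (x(k := True)))"
proof -
  have "(\<Sum>x\<in>conf n. h x) = (\<Sum>x\<in>conf n. h (x(k := \<not> x k)))"
    using assms by (intro sum.reindex_bij_witness[of _ "\<lambda>x. x(k := \<not> x k)" "\<lambda>x. x(k := \<not> x k)"]) (auto simp: conf_def)
  then have "2 * (\<Sum>x\<in>conf n. h x) = (\<Sum>x\<in>conf n. h x + h (x(k := \<not> x k)))"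
    by (simp add: sum.distrib)
  also have "\<dots> = (\<Sum>x\<in>conf n. h (x(k := False)) + h (x(k := True)))"
  proof (intro sum.cong refl)
    fix x
    show "h x + h (x(k := \<not> x k)) = h (x(k := False)) + h (x(k := True))"
      using fun_upd_triv[of x k] by (cases "x k") (auto simp: add.commute)
  qed
  finally show ?thesis .
qed

lemma conf_cong_site:
  fixes f g :: "(nat \<Rightarrow> bool) \<Rightarrow> complex"
  assumes "k < n" "\<And>x. f (x(k := False)) + f (x(k := True)) = g (x(k := False)) + g (x(k := True))"
  shows "(\<Sum>x\<in>conf n. f x) = (\<Sum>x\<in>conf n. g x)"
proof -
  have "2 * (\<Sum>x\<in>conf n. f x) = 2 * (\<Sum>x\<in>conf n. g x)"
    unfolding sum_conf_site[OF assms(1)] by (intro sum.cong refl assms(2))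
  then show ?thesis by simp
qed

lemma indep_conf:
  assumes "indep {..<n} g" "x \<in> conf n"
  shows "g x = g (\<lambda>_. False)"
proof -
  have "m \<le> n \<Longrightarrow> g x = g (\<lambda>j. m \<le> j \<and> x j)" for m
  proof (induction m)
    case (Suc m)
    have "(\<lambda>j. Suc m \<le> j \<and> x j) = (\<lambda>j. m \<le> j \<and> x j)(m := False)" by (auto simp: fun_eq_iff)
    then show ?case using Suc assms(1) by (simp add: indep_def)
  qed simp
  from this[of n] show ?thesis using assms(2) by (simp add: conf_def cong: conj_cong)
qed

text \<open>Transposing swaps vector and covector of a boundary operator: on the left the covector
  is \<open>a1\<close> times the vector with parameter \<open>d1 / (a1 * lt)\<close>, and similarly
  on the right. The product of the new parameters is the second solution of the equation for
  \<open>b\<close>.\<close>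

lemma (in spin) dual: "spin N q a1 d1 a2 d2 (d1 / (a1 * lt)) (d2 / (a2 * rt))"
  by (intro spin.intro) (use N_pos nz s1_nz bl br in auto)

text \<open>In the bulk the cap is the cup divided by \<open>q\<close>, so these operators are
  symmetric; at the ends the dual parameters account for the transpose.\<close>

lemma (in spin) sop_transpose:
  assumes "i \<le> N"
  shows "(\<Sum>x\<in>conf N. spin.sop N q a1 d1 a2 d2 (d1 / (a1 * lt)) (d2 / (a2 * rt)) i f x * g x)
    = (\<Sum>x\<in>conf N. f x * sop i g x)"
proof -
  interpret T: spin N q a1 d1 a2 d2 "d1 / (a1 * lt)" "d2 / (a2 * rt)" by (rule dual)
  consider "i = 0" | "i = N" "i \<noteq> 0" | "0 < i" "i < N" using assms by linarith
  then show ?thesis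
  proof cases
    case 1
    then show ?thesis
      using N_pos nz by (intro conf_cong_site[of 0])
        (simp_all add: T.sop_def T.loc_def T.ctr_def T.lv_def sop_def loc_def ctr_def lv_def field_simps)
  next
    case 2
    then show ?thesis
      using N_pos nz by (intro conf_cong_site[of "N - 1"])
        (simp_all add: T.sop_def T.loc_def T.ctr_def T.rv_def sop_def loc_def ctr_def rv_def field_simps)
  next
    case 3
    define k where "k = i - 1"
    have k: "i = Suc k" using 3 by (simp add: k_def)
    let ?S = "\<lambda>h x. h (x(k := False, Suc k := False)) + h (x(k := False, Suc k := True))
      + h (x(k := True, Suc k := False)) + h (x(k := True, Suc k := True))"
    have 4: "4 * (\<Sum>x\<in>conf N. h x) = (\<Sum>x\<in>conf N. ?S h x)" for h :: "(nat \<Rightarrow> bool) \<Rightarrow> complex"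
    proof -
      have "4 * (\<Sum>x\<in>conf N. h x) = 2 * (\<Sum>x\<in>conf N. h (x(Suc k := False)) + h (x(Suc k := True)))"
        using sum_conf_site[of "Suc k" N h] 3 k by simp
      also have "\<dots> = (\<Sum>x\<in>conf N. ?S h x)"
        using sum_conf_site[of k N "\<lambda>x. h (x(Suc k := False)) + h (x(Suc k := True))"] 3 k by (simp add: add.assoc)
      finally show ?thesis .
    qed
    have u: "x(k := a, Suc k := b, k := c, Suc k := d) = x(k := c, Suc k := d)" for x :: "nat \<Rightarrow> bool" and a b c d
      by auto
    have e: "?S (\<lambda>x. T.sop i f x * g x) x = ?S (\<lambda>x. f x * sop i g x) x" for x
      using 3 k nz by (simp add: T.sop_bulk sop_bulk u uu_def del: fun_upd_upd) (simp add: field_simps)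
    have "4 * (\<Sum>x\<in>conf N. T.sop i f x * g x) = 4 * (\<Sum>x\<in>conf N. f x * sop i g x)"
      unfolding 4[of "\<lambda>x. T.sop i f x * g x"] 4[of "\<lambda>x. f x * sop i g x"] by (intro sum.cong refl e)
    then show ?thesis by simp
  qed
qed

lemma (in spin) word_transpose:
  "set u \<subseteq> {..N} \<Longrightarrow> (\<Sum>x\<in>conf N. foldr (spin.sop N q a1 d1 a2 d2 (d1 / (a1 * lt)) (d2 / (a2 * rt))) u f x * g x)
    = (\<Sum>x\<in>conf N. f x * foldr sop (rev u) g x)"
  by (induction u arbitrary: g) (simp_all add: sop_transpose)

text \<open>Transposition reverses words; a product of commuting letters such as \<open>Jw N\<close>
  is not affected.\<close>

lemma (in btl_act) word_rev:
  "sorted_wrt (\<lambda>i j. Suc i < j) u \<Longrightarrow> set u \<subseteq> {..N} \<Longrightarrow> foldr e (rev u) v = foldr e u v"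
proof (induction u arbitrary: v)
  case (Cons i u)
  then have "e i (foldr e u v) = foldr e u (e i v)" by (intro e_comm_word) auto
  with Cons show ?case by simp
qed simp

lemma Yw_J:
  assumes "valid N h"
  obtains u where "set u \<subseteq> {..N}" "Yw N h = u @ Jw N"
proof -
  have "\<exists>u. set u \<subseteq> {..N} \<and> Yu N h (Suc H) = u @ Jw N" for H
  proof (induction H)
    case 0
    then show ?case using lev_one[OF assms] by simp
  next
    case (Suc H)
    then obtain u where u: "set u \<subseteq> {..N}" "Yu N h (Suc H) = u @ Jw N" by blast
    have "set (lev N h (Suc (Suc H))) \<subseteq> {..N}" by (auto simp: set_lev)
    with u show ?case
      by (intro exI[of _ "lev N h (Suc (Suc H)) @ u"]) (simp add: Yu.simps(2)[of N h "Suc H"] del: Yu.simps)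
  qed
  from this[of "hsz N h"] show thesis using that by (auto simp: Yu_stable simp del: Yu.simps)
qed

lemma (in spin) J_rank_one: "\<exists>k. \<forall>x\<in>conf N. foldr sop (Jw N) f x = k * Psi (alt (Suc N)) x"
  using indep_conf[OF ctr_cls_indep] by (auto simp: Jw_cls foldr_sop_cls)

section \<open>Comparing the module with a chain\<close>

locale spin_repn = spin N q a1 d1 a2 d2 lt rt + dqr_inj N "q + 1 / q" "a1 + d1" "a2 + d2" b
  for N :: nat and q a1 d1 a2 d2 lt rt b :: complex +
  assumes b_eq: "b = KK 0 * KK 1"
begin

sublocale R: repn N "q + 1 / q" "a1 + d1" "a2 + d2" b sop
  unfolding b_eq by (intro repn.intro dqr_axioms[unfolded b_eq] lin_ops_sop btl_dq_axioms)

text \<open>The image of \<open>E_N\<close> under a module map to the chain; in the form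
  \<open>F chi\<close> it is fixed by the idempotent.\<close>

definition vac :: "(nat \<Rightarrow> bool) \<Rightarrow> complex" where "vac = foldr sop (Fw N) chi"

lemma act_vac:
  assumes "p \<in> carrier FA" "r \<in> carrier FA" "pj p \<otimes>\<^bsub>DQ\<^esub> EE = pj r \<otimes>\<^bsub>DQ\<^esub> EE"
  shows "pact sop p vac = pact sop r vac"
  using R.act_welldef[OF assms, of vac] Eop_Fw[of N chi] by (simp add: vac_def)

lemma comb_vac: "\<exists>k. k \<noteq> 0 \<and> (\<forall>c. pact sop (comb c) vac = fsc k (\<lambda>x. \<Sum>w\<in>words N. c w * foldr sop (Yw N (can w)) chi x))"
proof -
  obtain k where k: "k \<noteq> 0" "\<And>h v. valid N h \<Longrightarrow> foldr sop (Yw N h) (foldr sop (Fw N) v) = fsc k (foldr sop (Yw N h) v)"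
    using Y_Fw by auto
  have "pact sop (comb c) vac x = k * (\<Sum>w\<in>words N. c w * foldr sop (Yw N (can w)) chi x)" for c x
    unfolding R.pact_comb vac_def sum_distrib_left using k(2) valid_can
    by (intro sum.cong) (auto simp: words_def)
  with k(1) show ?thesis by blast
qed

lemma J_vac: "\<exists>k. k \<noteq> 0 \<and> foldr sop (Jw N) vac = fsc k (Psi (alt (Suc N)))"
proof -
  obtain c where c: "c \<noteq> 0" "foldr sop (Jw N) vac = fsc c (foldr sop (Jw N) chi)"
    using Jw_Fw[of N] unfolding vac_def by auto
  obtain k where k: "k \<noteq> 0" "foldr sop (Jw N) chi = fsc k (Psi (alt (Suc N)))"
    using J_chi by blast
  have "foldr sop (Jw N) vac = fsc (c * k) (Psi (alt (Suc N)))"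
    unfolding c(2) k(2) by (simp only: mult.assoc)
  then show ?thesis using c(1) k(1) by (metis mult_eq_0_iff)
qed

text \<open>The kernel of the module map to the chain is a submodule. It misses \<open>E_N\<close>
  because \<open>J\<close> does not kill \<open>vac\<close>, so irreducibility makes the map
  injective, and this is independence of the vectors \<open>Y_w chi\<close>.\<close>

lemma irreducible_regular:
  assumes irr: "btl_irreducible N (q + 1 / q) (a1 + d1) (a2 + d2) b (range UU)"
  shows regular
proof (rule Y_indep_regular, unfold Y_indep_def, intro allI impI ballI)
  fix c w assume z: "\<forall>x. (\<Sum>w\<in>words N. c w * foldr sop (Yw N (can w)) chi x) = 0" and w: "w \<in> words N"
  define Ker where "Ker = {u. \<exists>p\<in>carrier FA. u = pj p \<otimes>\<^bsub>DQ\<^esub> EE \<and> pact sop p vac = (\<lambda>x. 0)}"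
  have "btl_submodule N (q + 1 / q) (a1 + d1) (a2 + d2) b Ker"
  proof (rule additive_subgroupI_act)
    show "Ker \<subseteq> carrier DQ" by (auto simp: Ker_def pj_closed EE_closed)
    show "\<zero>\<^bsub>DQ\<^esub> \<in> Ker" unfolding Ker_def
      using FA.zero_closed by (intro CollectI bexI[of _ 0]) (auto simp: pj_zero EE_closed R.pact_zero free_algebra_sel)
  next
    fix x y assume "x \<in> Ker" "y \<in> Ker"
    then obtain p r where "p \<in> carrier FA" "x = pj p \<otimes>\<^bsub>DQ\<^esub> EE" "pact sop p vac = (\<lambda>x. 0)"
      "r \<in> carrier FA" "y = pj r \<otimes>\<^bsub>DQ\<^esub> EE" "pact sop r vac = (\<lambda>x. 0)" by (auto simp: Ker_def)
    then show "x \<oplus>\<^bsub>DQ\<^esub> y \<in> Ker" unfolding Ker_def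
      by (intro CollectI bexI[of _ "p + r"])
        (auto simp: pj_add DQ.l_distr pj_closed EE_closed R.pact_add free_algebra_add)
  next
    fix p u assume p: "p \<in> carrier FA" and "u \<in> Ker"
    then obtain r where "r \<in> carrier FA" "u = pj r \<otimes>\<^bsub>DQ\<^esub> EE" "pact sop r vac = (\<lambda>x. 0)" by (auto simp: Ker_def)
    with p show "pj p \<otimes>\<^bsub>DQ\<^esub> u \<in> Ker" unfolding Ker_def
      by (intro CollectI bexI[of _ "p * r"])
        (auto simp: pj_mult_act EE_closed R.pact_mult R.pact_arg_zero free_algebra_mult)
  qed
  moreover have "Ker \<subseteq> range UU"
    using pj_UU[OF _ EE_UU] by (auto simp: Ker_def)
  moreover have "EE \<notin> Ker"
  proof
    assume "EE \<in> Ker"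
    then obtain p where p: "p \<in> carrier FA" "EE = pj p \<otimes>\<^bsub>DQ\<^esub> EE" "pact sop p vac = (\<lambda>x. 0)" by (auto simp: Ker_def)
    have "pact sop 1 vac = pact sop p vac"
      using p(1,2) EE_closed by (intro act_vac one_carrier) (simp_all add: pj_one)
    then have "vac = (\<lambda>x. 0)" using p(3) R.pact_mon1[of "[]" vac] by (simp add: mon_Nil)
    then have z: "foldr sop (Jw N) vac = (\<lambda>x. 0)" by (simp add: R.word_zero)
    obtain k where k: "k \<noteq> 0" "foldr sop (Jw N) vac = fsc k (Psi (alt (Suc N)))" using J_vac by blast
    have "Psi (alt (Suc N)) x = 0" for x using z k by (metis mult_eq_0_iff)
    then show False using Psi_alt_nz by blast
  qed
  ultimately have K: "Ker = {\<zero>\<^bsub>DQ\<^esub>}"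
    using irr EE_UU unfolding btl_irreducible_def by blast
  obtain k where "k \<noteq> 0" "pact sop (comb c) vac = fsc k (\<lambda>x. \<Sum>w\<in>words N. c w * foldr sop (Yw N (can w)) chi x)"
    using comb_vac by blast
  then have "UU c \<in> Ker"
    unfolding Ker_def UU_def using z comb_carrier by (intro CollectI bexI[of _ "comb c"]) auto
  then show "c w = 0" using K UU_inj w by blast
qed

text \<open>Pairing with the transposed chain detects a nonzero vector of a submodule. As
  \<open>J\<close> has rank one, the detecting word produces a nonzero multiple of
  \<open>J E_N\<close>, from which \<open>M\<close> recovers \<open>E_N\<close>.\<close>

lemma regular_irreducible:
  assumes regular "spin.regular N q a1 d1 a2 d2 (d1 / (a1 * lt)) (d2 / (a2 * rt))"
  shows "btl_irreducible N (q + 1 / q) (a1 + d1) (a2 + d2) b (range UU)"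
  unfolding btl_irreducible_def
proof (intro conjI allI impI)
  show "btl_submodule N (q + 1 / q) (a1 + d1) (a2 + d2) b (range UU)" by (rule W_submodule)
  show "range UU \<noteq> {\<zero>\<^bsub>DQ\<^esub>}"
  proof
    assume "range UU = {\<zero>\<^bsub>DQ\<^esub>}"
    then have "UU (\<lambda>_. 1) = \<zero>\<^bsub>DQ\<^esub>" by blast
    from UU_inj[OF this, of "replicate N True"] show False by (simp add: words_def)
  qed
  fix U assume U: "btl_submodule N (q + 1 / q) (a1 + d1) (a2 + d2) b U \<and> U \<subseteq> range UU"
  then have act: "\<And>p u. p \<in> carrier FA \<Longrightarrow> u \<in> U \<Longrightarrow> pj p \<otimes>\<^bsub>DQ\<^esub> u \<in> U"
    and sub: "additive_subgroup U DQ" unfolding btl_submodule_iff by auto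
  have UC: "u \<in> carrier DQ" if "u \<in> U" for u using sub that by (rule additive_subgroup.a_Hcarr)
  have word: "foldr ge u v \<in> U" if "set u \<subseteq> {..N}" "v \<in> U" for u v
    using that act[OF mon_carrier] UC by (simp add: ge_word)
  have scal: "gs k v \<in> U" if "v \<in> U" for k v
    using that act[OF const_carrier] UC by (simp add: gs_apply)
  show "U = {\<zero>\<^bsub>DQ\<^esub>} \<or> U = range UU"
  proof (rule disjCI)
    assume "U \<noteq> range UU"
    have "EE \<notin> U"
    proof
      assume "EE \<in> U"
      have "x \<in> U" if "x \<in> range UU" for x
        using that act[OF comb_carrier \<open>EE \<in> U\<close>] by (auto simp: UU_def)
      with U \<open>U \<noteq> range UU\<close> show False by blast
    qed
    have "u = \<zero>\<^bsub>DQ\<^esub>" if u: "u \<in> U" for u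
    proof (rule ccontr)
      assume "u \<noteq> \<zero>\<^bsub>DQ\<^esub>"
      obtain c where c: "u = UU c" using U u by blast
      obtain k where k: "k \<noteq> 0"
        "\<And>c. pact sop (comb c) vac = fsc k (\<lambda>x. \<Sum>w\<in>words N. c w * foldr sop (Yw N (can w)) chi x)"
        using comb_vac by blast
      have inj: "\<forall>w\<in>words N. c w = 0" if "\<And>x. x \<in> conf N \<Longrightarrow> pact sop (comb c) vac x = 0" for c
      proof
        fix w assume "w \<in> words N"
        then show "c w = 0"
        proof (rule regular_Y_indep[OF assms(1), rotated])
          fix x :: "nat \<Rightarrow> bool" assume "\<And>j. N \<le> j \<Longrightarrow> \<not> x j"
          then have "pact sop (comb c) vac x = 0" using that by (simp add: conf_def)
          then show "(\<Sum>w\<in>words N. c w * foldr sop (Yw N (can w)) chi x) = 0" using k(1) unfolding k(2) by simp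
        qed
      qed
      define f where "f = pact sop (comb c) vac"
      obtain x where x: "x \<in> conf N" "f x \<noteq> 0"
      proof (rule ccontr)
        assume "\<not> thesis"
        then have "\<forall>w\<in>words N. c w = 0" using that by (intro inj) (auto simp: f_def)
        then have "UU c = UU (\<lambda>w. 0)" by (intro UU_cong) simp
        with c \<open>u \<noteq> _\<close> show False by (simp add: UU_zero)
      qed
      interpret T: spin N q a1 d1 a2 d2 "d1 / (a1 * lt)" "d2 / (a2 * rt)" by (rule dual)
      \<comment> \<open>The indicator of a configuration where \<open>f\<close> does not vanish,
        expanded in the transposed chain.\<close>
      define one where "one xs = (if xs = map x [0..<N] then 1 else 0 :: complex)" for xs
      obtain c' where c': "\<And>y. one (map y [0..<N]) = (\<Sum>w\<in>words N. c' w * foldr T.sop (Yw N (can w)) chi y)"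
        using T.regular_spans[OF assms(2), of one] by blast
      have "(\<Sum>w\<in>words N. c' w * (\<Sum>y\<in>conf N. foldr T.sop (Yw N (can w)) chi y * f y))
          = (\<Sum>y\<in>conf N. one (map y [0..<N]) * f y)"
        unfolding c' sum_distrib_left sum_distrib_right by (subst sum.swap) (simp add: mult.assoc)
      also have "\<dots> = (\<Sum>y\<in>conf N. if y = x then f y else 0)"
      proof (intro sum.cong refl)
        fix y assume y: "y \<in> conf N"
        have "y = x" if "map y [0..<N] = map x [0..<N]"
        proof
          fix j show "y j = x j" using that x(1) y by (cases "j < N") (auto simp: conf_def)
        qed
        then show "one (map y [0..<N]) * f y = (if y = x then f y else 0)" by (auto simp: one_def)
      qed
      also have "\<dots> = f x" using x(1) by simp
      finally have "(\<Sum>w\<in>words N. c' w * (\<Sum>y\<in>conf N. foldr T.sop (Yw N (can w)) chi y * f y)) \<noteq> 0"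
        using x(2) by simp
      then obtain w where w: "w \<in> words N" "(\<Sum>y\<in>conf N. foldr T.sop (Yw N (can w)) chi y * f y) \<noteq> 0"
        by (metis (no_types, lifting) mult_zero_right sum.neutral)
      have "valid N (can w)" using valid_can[of w] w(1) by (simp add: words_def)
      then obtain v where v: "set v \<subseteq> {..N}" "Yw N (can w) = v @ Jw N" by (rule Yw_J)
      have J: "set (Jw N) \<subseteq> {..N}" by (auto dest!: Jw_less)
      have Jrev: "foldr sop (rev (Jw N)) g = foldr sop (Jw N) g" for g
        using word_rev[OF gap_cls[unfolded gap_def]] J by (simp add: Jw_cls)
      \<comment> \<open>The word \<open>v @ Jw N\<close> passes to \<open>f\<close> in reverse
        order, so that \<open>Jw N\<close> acts last and the rank one factor is nonzero.\<close>
      have "(\<Sum>y\<in>conf N. chi y * foldr sop (Jw N) (foldr sop (rev v) f) y) \<noteq> 0"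
        using w(2) J v(1) unfolding v(2) by (simp add: word_transpose Jrev)
      moreover obtain k1 where k1: "\<And>y. y \<in> conf N \<Longrightarrow> foldr sop (Jw N) (foldr sop (rev v) f) y = k1 * Psi (alt (Suc N)) y"
        using J_rank_one by blast
      ultimately have "k1 \<noteq> 0" by (auto simp: sum.neutral)
      obtain k2 where k2: "k2 \<noteq> 0" "foldr sop (Jw N) vac = fsc k2 (Psi (alt (Suc N)))" using J_vac by blast
      define p where "p = mon (Jw N) * (mon (rev v) * comb c)"
      have p: "p \<in> carrier FA" unfolding p_def using J v(1)
        by (intro free_algebra_mult mon_carrier comb_carrier) auto
      have "pj p \<otimes>\<^bsub>DQ\<^esub> EE = pj (mon (Jw N)) \<otimes>\<^bsub>DQ\<^esub> (pj (mon (rev v)) \<otimes>\<^bsub>DQ\<^esub> u)"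
        unfolding p_def c UU_def using J v(1)
        by (simp add: pj_mult_act mon_carrier comb_carrier free_algebra_mult EE_closed pj_closed)
      also have "\<dots> \<in> U" using J v(1) u by (intro act mon_carrier) auto
      finally have pU: "pj p \<otimes>\<^bsub>DQ\<^esub> EE \<in> U" .
      obtain d where d: "pj p \<otimes>\<^bsub>DQ\<^esub> EE = UU d" using pU U by blast
      obtain d' where d': "pj (mon (Jw N)) \<otimes>\<^bsub>DQ\<^esub> EE = UU d'"
        using pj_UU[OF mon_carrier[OF J] EE_UU] by blast
      have D: "pact sop (comb d) vac y = k1 * Psi (alt (Suc N)) y" if "y \<in> conf N" for y
      proof -
        have "pact sop (comb d) vac = pact sop p vac"
          using d by (intro act_vac p comb_carrier) (simp add: UU_def)
        also have "\<dots> = foldr sop (Jw N) (foldr sop (rev v) f)"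
          by (simp add: p_def R.pact_mult R.pact_mon1 f_def)
        finally show ?thesis using k1[OF that] by simp
      qed
      have D': "pact sop (comb d') vac = fsc k2 (Psi (alt (Suc N)))"
      proof -
        have "pact sop (comb d') vac = pact sop (mon (Jw N)) vac"
          using d' J by (intro act_vac mon_carrier comb_carrier) (simp_all add: UU_def)
        then show ?thesis by (simp add: R.pact_mon1 k2(2))
      qed
      \<comment> \<open>The images in the chain are proportional, and regularity lifts the
        proportionality to the coordinates.\<close>
      have "\<forall>w\<in>words N. k2 * d w + - k1 * d' w = 0"
      proof (rule inj)
        fix y assume "y \<in> conf N"
        have "pact sop (comb (\<lambda>w. k2 * d w + - k1 * d' w)) vac y
            = k2 * pact sop (comb d) vac y - k1 * pact sop (comb d') vac y"
          unfolding k(2) by (simp add: algebra_simps sum.distrib sum_distrib_left sum_negf sum_subtractf)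
        also have "\<dots> = 0" using D[OF \<open>y \<in> conf N\<close>] by (simp add: D')
        finally show "pact sop (comb (\<lambda>w. k2 * d w + - k1 * d' w)) vac y = 0" .
      qed
      then have "UU d' = UU (\<lambda>w. k2 / k1 * d w)" using \<open>k1 \<noteq> 0\<close>
        by (intro UU_cong) (simp add: field_simps)
      also have "\<dots> = gs (k2 / k1) (UU d)" by (simp only: UU_sc)
      also have "\<dots> \<in> U" using scal pU d by simp
      finally have "foldr ge (Jw N) EE \<in> U" using d' J EE_closed by (simp add: ge_word)
      moreover have "set (Mw N) \<subseteq> {..N}" by (auto dest!: Mw_less)
      ultimately have "foldr ge (Fw N) EE \<in> U" using word by (simp add: act.Fw_eq)
      moreover obtain r where r: "r \<noteq> 0" "foldr ge (Fw N) EE = gs r EE"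
        using act.Fw_Eop[of N] unfolding EE_eq[symmetric] by auto
      ultimately have "gs (1 / r) (gs r EE) \<in> U" using scal by metis
      then show False using r(1) \<open>EE \<notin> U\<close> by simp
    qed
    then show "U = {\<zero>\<^bsub>DQ\<^esub>}" using additive_subgroup.zero_closed[OF sub] by blast
  qed
qed

end

section \<open>The exceptional points\<close>

lemma all_less_double: "(\<forall>m<2 * M. P m) \<longleftrightarrow> (\<forall>n<M. P (2 * n) \<and> P (2 * n + 1))" for M :: nat
proof (intro iffI allI impI)
  fix m assume a: "\<forall>n<M. P (2 * n) \<and> P (2 * n + 1)" and m: "m < 2 * M"
  then have "m div 2 < M" by linarith
  with a have "P (2 * (m div 2))" "P (2 * (m div 2) + 1)" by auto
  then show "P m" by (cases "even m") (auto elim: evenE oddE)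
qed auto

lemma all_less_double_Suc: "(\<forall>m<2 * M + 1. P m) \<longleftrightarrow> (\<forall>n\<le>M. P (2 * n)) \<and> (\<forall>n<M. P (2 * n + 1))" for M :: nat
proof (intro iffI allI impI)
  fix m assume a: "(\<forall>n\<le>M. P (2 * n)) \<and> (\<forall>n<M. P (2 * n + 1))" and m: "m < 2 * M + 1"
  show "P m"
  proof (cases "even m")
    case True then show ?thesis using a m by (auto elim!: evenE)
  next
    case False then show ?thesis using a m by (auto elim!: oddE)
  qed
qed auto

text \<open>Boundary parameters in terms of \<open>X = q\<^bsup>\<omega>\<^sub>1\<^esup>\<close>, \<open>Y = q\<^bsup>\<omega>\<^sub>2\<^esup>\<close>; for \<open>t = \<plusminus>X Y q\<^bsup>\<theta>\<^esup>\<close> the two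
  solutions of the quadratic equation for \<open>t\<close> are exchanged by \<open>\<theta> \<mapsto> - \<theta>\<close>.\<close>

locale spin_param = spin_family N q "- 1 / (X * D1)" "X / D1" "- 1 / (Y * D2)" "Y / D2"
  for N :: nat and q X D1 Y D2 :: complex +
  assumes X: "X \<noteq> 0" and Y: "Y \<noteq> 0" and D: "D1 \<noteq> 0" "D2 \<noteq> 0"
begin

abbreviation tX :: "complex \<Rightarrow> complex" where "tX T \<equiv> (- 1) ^ (N + 1) * X * Y * T"

lemma ratios: "X / D1 / (- 1 / (X * D1)) = - X\<^sup>2" "Y / D2 / (- 1 / (Y * D2)) = - Y\<^sup>2"
  using X Y D by (simp_all add: power2_eq_square)

lemma tau_param: "spin.tau q (- 1 / (X * D1)) (X / D1) (- 1 / (Y * D2)) (Y / D2) m j n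
    = (- q) ^ m * (if odd j then - q * Y\<^sup>2 else 1) * (if odd n then - q * X\<^sup>2 else 1)"
proof -
  interpret spin N q "- 1 / (X * D1)" "X / D1" "- 1 / (Y * D2)" "Y / D2" 1 1 by (rule spin) simp_all
  show ?thesis unfolding tau_def times_divide_eq_right[symmetric] ratios by simp
qed

lemma cancel: "X * Y * T = c * (X * Y) \<longleftrightarrow> T = c" "X * Y * T = c * X\<^sup>2 \<longleftrightarrow> T = c * (X / Y)"
    "X * Y * T = c * Y\<^sup>2 \<longleftrightarrow> T = c * (Y / X)" "X * Y * T = c \<longleftrightarrow> T = c * (1 / (X * Y))"
    "X * Y * T = c * X\<^sup>2 * Y\<^sup>2 \<longleftrightarrow> T = c * (X * Y)"
  using X Y by (auto simp: field_simps power2_eq_square)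

lemma reg_param: "T \<noteq> 0 \<Longrightarrow> reg (tX T) \<longleftrightarrow> tX T \<noteq> Y\<^sup>2 * (if even N then - q * X\<^sup>2 else 1) \<and>
    (\<forall>m<N. tX T \<noteq> (- q) ^ m * (if odd (N - 1 - m) then - q * X\<^sup>2 else 1)) \<and>
    (\<forall>m. Suc m < N \<longrightarrow> tX T \<noteq> (- q) ^ m * (- q * Y\<^sup>2) * (if odd (N - 2 - m) then - q * X\<^sup>2 else 1))"
proof -
  assume T: "T \<noteq> 0"
  interpret spin N q "- 1 / (X * D1)" "X / D1" "- 1 / (Y * D2)" "Y / D2" 1 "tX T" using X Y T by (intro spin) simp_all
  have nz: "tX T \<noteq> 0" using X Y T by simp
  have r: "reg (tX T) \<longleftrightarrow> regular" unfolding reg_def using nz by (simp only: simp_thms)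
  show ?thesis
    unfolding r regular_def tau_param times_divide_eq_right[symmetric] ratios by simp
qed

text \<open>Even and odd \<open>m\<close> in the two families give the four products
  \<open>Z\<close>. For \<open>X * Y\<close> the second family starts only at exponent 3; the
  missing exponent 1 is the condition on \<open>KK 0\<close>.\<close>

lemma reg_even:
  assumes T: "T \<noteq> 0" and N: "N = 2 * M"
  shows "reg (tX T) \<longleftrightarrow> (\<forall>n<M. \<forall>Z\<in>{1 / (X * Y), X / Y, Y / X, X * Y}. T \<noteq> q ^ (2 * n + 1) * Z)"
proof -
  have M: "0 < M" using N N_pos by simp
  have "reg (tX T) \<longleftrightarrow> T \<noteq> q * (X * Y) \<and> (\<forall>n<M. T \<noteq> q ^ (2 * n + 1) * (X / Y) \<and> T \<noteq> q ^ (2 * n + 1) * (1 / (X * Y))) \<and>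
      (\<forall>n<M. T \<noteq> q ^ (2 * n + 1) * (Y / X) \<and> (Suc n < M \<longrightarrow> T \<noteq> q ^ (2 * n + 3) * (X * Y)))"
  proof -
    have tx: "tX T = - (X * Y * T)" using N by simp
    have 1: "tX T \<noteq> Y\<^sup>2 * (if even N then - q * X\<^sup>2 else 1) \<longleftrightarrow> T \<noteq> q * (X * Y)"
      unfolding tx using N cancel(5)[of T q] by (simp add: algebra_simps)
    have 2: "tX T \<noteq> (- q) ^ (2 * n) * (if odd (N - 1 - 2 * n) then - q * X\<^sup>2 else 1) \<longleftrightarrow> T \<noteq> q ^ (2 * n + 1) * (X / Y)"
      "tX T \<noteq> (- q) ^ (2 * n + 1) * (if odd (N - 1 - (2 * n + 1)) then - q * X\<^sup>2 else 1) \<longleftrightarrow> T \<noteq> q ^ (2 * n + 1) * (1 / (X * Y))"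
      if "n < M" for n
      unfolding tx using N that cancel(2)[of T "q ^ (2 * n + 1)"] cancel(4)[of T "q ^ (2 * n + 1)"]
      by (simp_all add: algebra_simps)
    have 3: "(Suc (2 * n) < N \<longrightarrow> tX T \<noteq> (- q) ^ (2 * n) * (- q * Y\<^sup>2) * (if odd (N - 2 - 2 * n) then - q * X\<^sup>2 else 1)) \<longleftrightarrow> T \<noteq> q ^ (2 * n + 1) * (Y / X)" (is "?A n")
      "(Suc (2 * n + 1) < N \<longrightarrow> tX T \<noteq> (- q) ^ (2 * n + 1) * (- q * Y\<^sup>2) * (if odd (N - 2 - (2 * n + 1)) then - q * X\<^sup>2 else 1))
        \<longleftrightarrow> (Suc n < M \<longrightarrow> T \<noteq> q ^ (2 * n + 3) * (X * Y))" (is "?B n")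
      if "n < M" for n
    proof -
      have "Suc (2 * n) < N" "Suc (2 * n + 1) < N \<longleftrightarrow> Suc n < M" using N that by linarith+
      then show "?A n" "?B n" unfolding tx using N that cancel(3)[of T "q ^ (2 * n + 1)"] cancel(5)[of T "q ^ (2 * n + 3)"]
        by (simp_all add: algebra_simps power3_eq_cube power_add)
    qed
    have 4: "(\<forall>m. Suc m < N \<longrightarrow> Q m) \<longleftrightarrow> (\<forall>m<2 * M. Suc m < N \<longrightarrow> Q m)" for Q using N by auto
    have 5: "(\<forall>m<N. Q m) \<longleftrightarrow> (\<forall>m<2 * M. Q m)" for Q using N by simp
    show ?thesis
      by (simp only: reg_param[OF T] 1 4 5 all_less_double 2 3 cong: imp_cong)
  qed
  also have "\<dots> \<longleftrightarrow> (\<forall>n<M. \<forall>Z\<in>{1 / (X * Y), X / Y, Y / X, X * Y}. T \<noteq> q ^ (2 * n + 1) * Z)"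
  proof -
    have "T \<noteq> q * (X * Y) \<and> (\<forall>n<M. Suc n < M \<longrightarrow> T \<noteq> q ^ (2 * n + 3) * (X * Y)) \<longleftrightarrow> (\<forall>n<M. T \<noteq> q ^ (2 * n + 1) * (X * Y))"
      (is "?L \<longleftrightarrow> ?R")
    proof
      assume L: ?L
      show ?R
      proof (intro allI impI)
        fix n assume "n < M"
        then show "T \<noteq> q ^ (2 * n + 1) * (X * Y)"
        proof (cases n)
          case (Suc n')
          then have "T \<noteq> q ^ (2 * n' + 3) * (X * Y)" using L \<open>n < M\<close> by (metis Suc_lessD)
          moreover have "2 * n' + 3 = 2 * n + 1" using Suc by simp
          ultimately show ?thesis by metis
        qed (use L in simp)
      qed
    next
      assume R: ?R
      have "2 * n + 3 = 2 * Suc n + 1" for n by simp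
      then show ?L using R M by (metis mult_0_right add_0 power_one_right)
    qed
    then show ?thesis by auto
  qed
  finally show ?thesis .
qed

text \<open>Exponent zero occurs for \<open>1 / (X * Y)\<close>, as the start of the first family,
  and for \<open>Y / X\<close>, from \<open>KK 0\<close>. The values \<open>X * Y\<close> and
  \<open>X / Y\<close> join them when \<open>T\<close> is replaced by \<open>1 / T\<close>.\<close>

lemma reg_odd:
  assumes T: "T \<noteq> 0" and N: "N = 2 * M + 1"
  shows "reg (tX T) \<longleftrightarrow> T \<noteq> 1 / (X * Y) \<and> T \<noteq> Y / X \<and>
    (\<forall>n. 0 < n \<and> n \<le> M \<longrightarrow> (\<forall>Z\<in>{1 / (X * Y), X / Y, Y / X, X * Y}. T \<noteq> q ^ (2 * n) * Z))"
proof -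
  have "reg (tX T) \<longleftrightarrow> T \<noteq> Y / X \<and> ((\<forall>n\<le>M. T \<noteq> q ^ (2 * n) * (1 / (X * Y))) \<and> (\<forall>n<M. T \<noteq> q ^ (2 * Suc n) * (X / Y))) \<and>
      (\<forall>n<M. T \<noteq> q ^ (2 * Suc n) * (X * Y) \<and> T \<noteq> q ^ (2 * Suc n) * (Y / X))"
  proof -
    have tx: "tX T = X * Y * T" using N by simp
    have 1: "tX T \<noteq> Y\<^sup>2 * (if even N then - q * X\<^sup>2 else 1) \<longleftrightarrow> T \<noteq> Y / X"
      unfolding tx using N cancel(3)[of T 1] by simp
    have 2: "tX T \<noteq> (- q) ^ (2 * n) * (if odd (N - 1 - 2 * n) then - q * X\<^sup>2 else 1) \<longleftrightarrow> T \<noteq> q ^ (2 * n) * (1 / (X * Y))"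
      if "n \<le> M" for n
      unfolding tx using N that cancel(4)[of T "q ^ (2 * n)"] by simp
    have 3: "tX T \<noteq> (- q) ^ (2 * n + 1) * (if odd (N - 1 - (2 * n + 1)) then - q * X\<^sup>2 else 1) \<longleftrightarrow> T \<noteq> q ^ (2 * Suc n) * (X / Y)"
      "tX T \<noteq> (- q) ^ (2 * n) * (- q * Y\<^sup>2) * (if odd (N - 2 - 2 * n) then - q * X\<^sup>2 else 1) \<longleftrightarrow> T \<noteq> q ^ (2 * Suc n) * (X * Y)"
      "tX T \<noteq> (- q) ^ (2 * n + 1) * (- q * Y\<^sup>2) * (if odd (N - 2 - (2 * n + 1)) then - q * X\<^sup>2 else 1) \<longleftrightarrow> T \<noteq> q ^ (2 * Suc n) * (Y / X)"
      if "n < M" for n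
      unfolding tx using N that cancel(2)[of T "q ^ (2 * Suc n)"] cancel(3)[of T "q ^ (2 * Suc n)"] cancel(5)[of T "q ^ (2 * Suc n)"]
      by (simp_all add: algebra_simps)
    have 4: "(\<forall>m. Suc m < N \<longrightarrow> Q m) \<longleftrightarrow> (\<forall>m<2 * M. Q m)" for Q using N by auto
    have 5: "(\<forall>m<N. Q m) \<longleftrightarrow> (\<forall>m<2 * M + 1. Q m)" for Q using N by simp
    show ?thesis
      by (simp only: reg_param[OF T] 1 4 5 all_less_double all_less_double_Suc 2 3 cong: imp_cong)
  qed
  also have "\<dots> \<longleftrightarrow> T \<noteq> 1 / (X * Y) \<and> T \<noteq> Y / X \<and>
    (\<forall>n. 0 < n \<and> n \<le> M \<longrightarrow> (\<forall>Z\<in>{1 / (X * Y), X / Y, Y / X, X * Y}. T \<noteq> q ^ (2 * n) * Z))"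
  proof -
    have A: "(\<forall>n. 0 < n \<and> n \<le> M \<longrightarrow> Q n) \<longleftrightarrow> (\<forall>n<M. Q (Suc n))" for Q
      by (metis Suc_le_eq Suc_pred zero_less_Suc)
    have B: "(\<forall>n\<le>M. Q n) \<longleftrightarrow> Q 0 \<and> (\<forall>n<M. Q (Suc n))" for Q
      by (metis A le0 neq0_conv)
    show ?thesis unfolding A B by auto
  qed
  finally show ?thesis .
qed

end

lemma (in spin) regular_prod: "regular \<longleftrightarrow> spin.regular N q a1 d1 a2 d2 1 (lt * rt)"
proof -
  interpret S: spin N q a1 d1 a2 d2 1 "lt * rt"
    by (intro spin.intro) (use N_pos nz s1_nz bl br in auto)
  show ?thesis unfolding regular_def S.regular_def by simp
qed

context spin_family
begin

lemma spin_repn: "t \<noteq> 0 \<Longrightarrow> spin_repn N q a1 d1 a2 d2 1 t (bt t)"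
  using spin.KK_prod[OF spin[of 1 t]]
  by (intro spin_repn.intro spin dqr_inj spin_repn_axioms.intro) simp_all

text \<open>Both parameters give the same \<open>b\<close>, so both chains are compared with one
  module. The regularity of the transposed chain is that of the chain at \<open>t'\<close>, since
  only the product of its two boundary parameters matters.\<close>

lemma irreducible_iff:
  assumes t: "t \<noteq> 0"
  shows "btl_irreducible N (q + 1 / q) (a1 + d1) (a2 + d2) (bt t) (W_mod N (q + 1 / q) (a1 + d1) (a2 + d2) (bt t))
    \<longleftrightarrow> reg t \<and> reg (d1 * d2 / (a1 * a2 * t))"
proof -
  define t' where "t' = d1 * d2 / (a1 * a2 * t)"
  have t': "t' \<noteq> 0" using nz t by (simp add: t'_def)
  have b: "bt t' = bt t" using nz t by (simp add: bfun_def t'_def)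
  interpret I: spin_repn N q a1 d1 a2 d2 1 t "bt t" by (rule spin_repn[OF t])
  interpret I': spin_repn N q a1 d1 a2 d2 1 t' "bt t" using spin_repn[OF t'] by (simp only: b)
  have "spin.regular N q a1 d1 a2 d2 (d1 / (a1 * 1)) (d2 / (a2 * t)) \<longleftrightarrow> I'.regular"
    using spin.regular_prod[OF I.dual] by (simp add: t'_def mult.assoc)
  then show ?thesis
    unfolding I.W_mod_eq reg_def t'_def[symmetric]
    using t t' I.irreducible_regular I'.irreducible_regular I.regular_irreducible by blast
qed

end

section \<open>Translation to powers of q\<close>

lemma qpow_add: "qpow \<eta> (x + y) = qpow \<eta> x * qpow \<eta> y"
  by (simp add: qpow_def distrib_left exp_add)

lemma qpow_minus: "qpow \<eta> (- x) = 1 / qpow \<eta> x"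
  by (simp add: qpow_def exp_minus inverse_eq_divide)

lemma qpow_nz: "qpow \<eta> x \<noteq> 0"
  by (simp add: qpow_def)

lemma qpow_nat: "qpow \<eta> (of_nat n) = qpow \<eta> 1 ^ n"
  by (simp add: qpow_def exp_of_nat_mult[symmetric] mult.commute)

lemma qnum_halves: "qnum \<eta> ((A + B) / 2) * qnum \<eta> ((A - B) / 2)
    = (qpow \<eta> A + qpow \<eta> (- A) - qpow \<eta> B - qpow \<eta> (- B)) / (qpow \<eta> 1 - qpow \<eta> (- 1))\<^sup>2"
proof -
  define u v where "u = (A + B) / 2" and "v = (A - B) / 2"
  have AB: "A = u + v" "B = u + - v" "- A = - u + - v" "- B = - u + v" by (simp_all add: u_def v_def field_simps)
  show ?thesis
    unfolding u_def[symmetric] v_def[symmetric] unfolding AB(3,4) unfolding AB(1,2) qpow_add qnum_def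
    by (simp add: power2_eq_square algebra_simps)
qed

text \<open>The outer sign decides between \<open>T\<close> and \<open>1 / T\<close>; the inner
  signs give the four products \<open>Z\<close>.\<close>

lemma exceptional_exponents:
  fixes \<omega>1 \<omega>2 \<theta> \<eta> :: complex and m :: nat
  defines "q \<equiv> qpow \<eta> 1" and "X \<equiv> qpow \<eta> \<omega>1" and "Y \<equiv> qpow \<eta> \<omega>2" and "T \<equiv> qpow \<eta> \<theta>"
  shows "(\<exists>\<sigma>\<in>{1, -1}. \<exists>\<epsilon>1\<in>{1, -1}. \<exists>\<epsilon>2\<in>{1, -1}. T = qpow \<eta> (\<sigma> * (- of_nat m + \<epsilon>1 * \<omega>1 + \<epsilon>2 * \<omega>2)))
    \<longleftrightarrow> (\<exists>Z\<in>{1 / (X * Y), X / Y, Y / X, X * Y}. T = q ^ m * Z \<or> 1 / T = q ^ m * Z)"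
proof -
  have nz: "q \<noteq> 0" "X \<noteq> 0" "Y \<noteq> 0" "T \<noteq> 0" by (simp_all add: q_def X_def Y_def T_def qpow_nz)
  have p: "qpow \<eta> (- 1 * (- of_nat m + \<epsilon>1 * \<omega>1 + \<epsilon>2 * \<omega>2)) = q ^ m * (qpow \<eta> (- \<epsilon>1 * \<omega>1) * qpow \<eta> (- \<epsilon>2 * \<omega>2))" for \<epsilon>1 \<epsilon>2
  proof -
    have "- 1 * (- of_nat m + \<epsilon>1 * \<omega>1 + \<epsilon>2 * \<omega>2) = of_nat m + (- \<epsilon>1 * \<omega>1 + - \<epsilon>2 * \<omega>2)" by (simp add: algebra_simps)
    then show ?thesis by (simp only: qpow_add qpow_nat q_def)
  qed
  have s: "T = qpow \<eta> (1 * z) \<longleftrightarrow> 1 / T = qpow \<eta> (- 1 * z)" for z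
    using qpow_nz[of \<eta> z] nz by (auto simp: qpow_minus field_simps)
  have v: "qpow \<eta> (- 1 * \<omega>1) = 1 / X" "qpow \<eta> (- (- 1) * \<omega>1) = X" "qpow \<eta> (- 1 * \<omega>2) = 1 / Y" "qpow \<eta> (- (- 1) * \<omega>2) = Y"
    by (simp_all add: qpow_minus X_def Y_def)
  have "1 / X * (1 / Y) = 1 / (X * Y)" "1 / X * Y = Y / X" "X * (1 / Y) = X / Y" by simp_all
  then show ?thesis
    by (simp only: bex_simps simp_thms s p v) blast
qed

theorem corollary5p18:
  fixes N :: nat and \<eta> \<omega>1 \<omega>2 \<theta> \<delta> s1 s2 b :: complex
  assumes "N \<ge> 1"
    and "qpow \<eta> 1 \<noteq> qpow \<eta> (- 1)"
    and "qnum \<eta> \<omega>1 \<noteq> 0" and "qnum \<eta> (\<omega>1 + 1) \<noteq> 0"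
    and "qnum \<eta> \<omega>2 \<noteq> 0" and "qnum \<eta> (\<omega>2 + 1) \<noteq> 0"
    and "\<delta> = qnum \<eta> 2"
    and "s1 = qnum \<eta> \<omega>1 / qnum \<eta> (\<omega>1 + 1)"
    and "s2 = qnum \<eta> \<omega>2 / qnum \<eta> (\<omega>2 + 1)"
    and "b = b_param N \<eta> \<omega>1 \<omega>2 \<theta>"
  shows "has_complex_dim N \<delta> s1 s2 b (2 ^ N) (W_mod N \<delta> s1 s2 b)
    \<and> (even N \<longrightarrow>
        (btl_irreducible N \<delta> s1 s2 b (W_mod N \<delta> s1 s2 b) \<longleftrightarrow>
          \<not> (\<exists>n \<in> {0..(N - 2) div 2}. \<exists>\<sigma> \<in> {1, -1}. \<exists>\<epsilon>1 \<in> {1, -1}. \<exists>\<epsilon>2 \<in> {1, -1}.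
               qpow \<eta> \<theta> = qpow \<eta> (\<sigma> * (- 2 * of_nat n - 1 + \<epsilon>1 * \<omega>1 + \<epsilon>2 * \<omega>2)))))
    \<and> (odd N \<longrightarrow>
        (btl_irreducible N \<delta> s1 s2 b (W_mod N \<delta> s1 s2 b) \<longleftrightarrow>
          \<not> ((\<exists>\<sigma> \<in> {1, -1}. \<exists>\<epsilon> \<in> {1, -1}. qpow \<eta> \<theta> = qpow \<eta> (\<sigma> * (\<omega>1 + \<epsilon> * \<omega>2)))
             \<or> (\<exists>n \<in> {1..(N - 1) div 2}. \<exists>\<sigma> \<in> {1, -1}. \<exists>\<epsilon>1 \<in> {1, -1}. \<exists>\<epsilon>2 \<in> {1, -1}.
                  qpow \<eta> \<theta> = qpow \<eta> (\<sigma> * (- 2 * of_nat n + \<epsilon>1 * \<omega>1 + \<epsilon>2 * \<omega>2))))))"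
proof -
  define q X Y T where "q = qpow \<eta> 1" and "X = qpow \<eta> \<omega>1" and "Y = qpow \<eta> \<omega>2" and "T = qpow \<eta> \<theta>"
  \<comment> \<open>These are \<open>[\<omega>1 + 1]\<close> and \<open>[\<omega>2 + 1]\<close>
    times \<open>q - 1 / q\<close>.\<close>
  define D1 D2 where "D1 = X * q - 1 / (X * q)" and "D2 = Y * q - 1 / (Y * q)"
  have nonzero: "q \<noteq> 0" "X \<noteq> 0" "Y \<noteq> 0" "T \<noteq> 0" by (simp_all add: q_def X_def Y_def T_def qpow_nz)
  have q1: "q - 1 / q \<noteq> 0" using assms(2) by (simp add: q_def qpow_minus)
  have qn: "qnum \<eta> x = (qpow \<eta> x - 1 / qpow \<eta> x) / (q - 1 / q)" for x
    by (simp add: qnum_def q_def qpow_minus)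
  have Dn: "qnum \<eta> (\<omega>1 + 1) = D1 / (q - 1 / q)" "qnum \<eta> (\<omega>2 + 1) = D2 / (q - 1 / q)"
    by (simp_all add: qn qpow_add D1_def D2_def X_def Y_def q_def)
  have D: "D1 \<noteq> 0" "D2 \<noteq> 0" using assms(4,6) q1 by (auto simp: Dn)
  \<comment> \<open>The two summands are \<open>a1\<close> and \<open>d1\<close>, the solution of
    the linear system \<open>a1 + d1 = s1\<close>, \<open>a1 / q + q * d1 = 1\<close>; likewise for
    \<open>s2\<close>.\<close>
  have s1: "s1 = - 1 / (X * D1) + X / D1" and s2: "s2 = - 1 / (Y * D2) + Y / D2"
    unfolding assms(8,9) Dn unfolding qn X_def[symmetric] Y_def[symmetric]
    using nonzero D q1 by (simp_all add: divide_simps)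
  have "s1 \<noteq> 0" using assms(3,4,8) by simp
  have \<delta>: "\<delta> = q + 1 / q"
  proof -
    have "qpow \<eta> 2 = q * q" using qpow_add[of \<eta> 1 1] by (simp add: q_def)
    then have "\<delta> = (q * q - 1 / (q * q)) / (q - 1 / q)" by (simp add: assms(7) qn)
    also have "q * q - 1 / (q * q) = (q + 1 / q) * (q - 1 / q)" using nonzero(1) by (simp add: field_simps)
    finally show ?thesis using q1 by simp
  qed
  have q2: "q\<^sup>2 \<noteq> 1" using q1 nonzero(1) by (auto simp: field_simps power2_eq_square)
  have bd: "- 1 / (X * D1) / q + q * (X / D1) = 1" "- 1 / (Y * D2) / q + q * (Y / D2) = 1"
  proof -
    have h: "- 1 / (Z * E) / q + q * (Z / E) = (Z * q - 1 / (Z * q)) / E" if "Z \<noteq> 0" "E \<noteq> 0" for Z E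
      using that nonzero(1) by (simp add: field_simps)
    show "- 1 / (X * D1) / q + q * (X / D1) = 1" "- 1 / (Y * D2) / q + q * (Y / D2) = 1"
      by (rule trans[OF h[OF nonzero(2) D(1), folded D1_def] divide_self[OF D(1)]]
          trans[OF h[OF nonzero(3) D(2), folded D2_def] divide_self[OF D(2)]])+
  qed
  have s1_nz: "- 1 / (X * D1) + X / D1 \<noteq> 0" using \<open>s1 \<noteq> 0\<close> unfolding s1 .
  interpret spin_param N q X D1 Y D2
  proof (intro spin_param.intro spin_family.intro spin_param_axioms.intro)
    show "- 1 / (X * D1) \<noteq> 0" "X / D1 \<noteq> 0" "- 1 / (Y * D2) \<noteq> 0" "Y / D2 \<noteq> 0" using nonzero D by simp_all
  qed (rule assms(1) nonzero D q2 bd s1_nz)+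
  have t: "tX T \<noteq> 0" using nonzero by simp
  have b: "b = bt (tX T)"
  proof -
    \<comment> \<open>The product of two \<open>qnum\<close> at half arguments is a difference
      without halves; \<open>E\<close> belongs to the argument free of
      \<open>\<theta>\<close>.\<close>
    define E where "E = qpow \<eta> (if even N then \<omega>1 + \<omega>2 + 1 else \<omega>1 - \<omega>2)"
    have E: "E = (if even N then X * Y * q else X / Y)"
      using qpow_add[of \<eta> \<omega>1 "- \<omega>2"] by (simp add: E_def X_def Y_def q_def qpow_add qpow_minus)
    have "b = (if even N then 1 else - 1) * ((E + 1 / E - T - 1 / T) / (q - 1 / q)\<^sup>2 / (D1 / (q - 1 / q) * (D2 / (q - 1 / q))))"
      unfolding assms(10) b_param_def qnum_halves Dn E_def T_def q_def qpow_minus by simp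
    also have "\<dots> = (if even N then 1 else - 1) * ((E + 1 / E - T - 1 / T) / (D1 * D2))"
      using q1 D by (simp add: divide_simps power2_eq_square)
    also have "\<dots> = bt (tX T)"
      unfolding bfun_def E using nonzero D by (simp add: divide_simps) (simp add: algebra_simps power2_eq_square)
    finally show ?thesis .
  qed
  \<comment> \<open>The second solution of the quadratic equation is the first one at
    \<open>- \<theta>\<close>.\<close>
  have swap: "X / D1 * (Y / D2) / (- 1 / (X * D1) * (- 1 / (Y * D2)) * tX T) = tX (1 / T)"
    using nonzero D by (cases "even N") (simp_all add: field_simps)
  have irr: "btl_irreducible N \<delta> s1 s2 b (W_mod N \<delta> s1 s2 b) \<longleftrightarrow> reg (tX T) \<and> reg (tX (1 / T))"
    unfolding \<delta> s1 s2 b irreducible_iff[OF t] swap ..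
  have T': "1 / T \<noteq> 0" using nonzero by simp
  let ?S = "{1 / (X * Y), X / Y, Y / X, X * Y}"
  have ex: "(\<exists>\<sigma>\<in>{1, -1}. \<exists>\<epsilon>1\<in>{1, -1}. \<exists>\<epsilon>2\<in>{1, -1}. T = qpow \<eta> (\<sigma> * (- of_nat m + \<epsilon>1 * \<omega>1 + \<epsilon>2 * \<omega>2)))
    \<longleftrightarrow> (\<exists>Z\<in>?S. T = q ^ m * Z \<or> 1 / T = q ^ m * Z)" for m
    unfolding q_def X_def Y_def T_def by (rule exceptional_exponents)
  have "has_complex_dim N \<delta> s1 s2 b (2 ^ N) (W_mod N \<delta> s1 s2 b)"
    unfolding \<delta> s1 s2 b by (rule dqr_inj.W_dim[OF dqr_inj[OF t]])
  moreover have "btl_irreducible N \<delta> s1 s2 b (W_mod N \<delta> s1 s2 b) \<longleftrightarrow>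
      \<not> (\<exists>n \<in> {0..(N - 2) div 2}. \<exists>\<sigma> \<in> {1, -1}. \<exists>\<epsilon>1 \<in> {1, -1}. \<exists>\<epsilon>2 \<in> {1, -1}.
           T = qpow \<eta> (\<sigma> * (- 2 * of_nat n - 1 + \<epsilon>1 * \<omega>1 + \<epsilon>2 * \<omega>2)))" if "even N"
  proof -
    obtain M where M: "N = 2 * M" using \<open>even N\<close> by (auto elim: evenE)
    have e: "- 2 * of_nat n - 1 = - (of_nat (2 * n + 1) :: complex)" for n by simp
    \<comment> \<open>An even \<open>N \<ge> 1\<close> is at least 2, so the natural number
      subtraction is exact.\<close>
    have "{0..(N - 2) div 2} = {..<M}" using M assms(1) by auto
    then show ?thesis
      unfolding irr reg_even[OF nonzero(4) M] reg_even[OF T' M] e ex by blast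
  qed
  moreover have "btl_irreducible N \<delta> s1 s2 b (W_mod N \<delta> s1 s2 b) \<longleftrightarrow>
      \<not> ((\<exists>\<sigma> \<in> {1, -1}. \<exists>\<epsilon> \<in> {1, -1}. T = qpow \<eta> (\<sigma> * (\<omega>1 + \<epsilon> * \<omega>2)))
         \<or> (\<exists>n \<in> {1..(N - 1) div 2}. \<exists>\<sigma> \<in> {1, -1}. \<exists>\<epsilon>1 \<in> {1, -1}. \<exists>\<epsilon>2 \<in> {1, -1}.
              T = qpow \<eta> (\<sigma> * (- 2 * of_nat n + \<epsilon>1 * \<omega>1 + \<epsilon>2 * \<omega>2))))" if "odd N"
  proof -
    obtain M where M: "N = 2 * M + 1" using \<open>odd N\<close> by (auto elim: oddE)
    have e: "- 2 * of_nat n = - (of_nat (2 * n) :: complex)" for n by simp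
    have n: "{1..(N - 1) div 2} = {n. 0 < n \<and> n \<le> M}" using M by auto
    have z: "(\<exists>\<sigma> \<in> {1, -1}. \<exists>\<epsilon> \<in> {1, -1}. T = qpow \<eta> (\<sigma> * (\<omega>1 + \<epsilon> * \<omega>2)))
        \<longleftrightarrow> T = 1 / (X * Y) \<or> T = Y / X \<or> 1 / T = 1 / (X * Y) \<or> 1 / T = Y / X"
    proof -
      have p: "qpow \<eta> (1 * (\<omega>1 + 1 * \<omega>2)) = X * Y" "qpow \<eta> (- 1 * (\<omega>1 + 1 * \<omega>2)) = 1 / (X * Y)"
        "qpow \<eta> (1 * (\<omega>1 + - 1 * \<omega>2)) = X / Y" "qpow \<eta> (- 1 * (\<omega>1 + - 1 * \<omega>2)) = Y / X"
        using qpow_add[of \<eta> \<omega>1 "- \<omega>2"] qpow_add[of \<eta> "- \<omega>1" \<omega>2] qpow_add[of \<eta> \<omega>1 \<omega>2] qpow_add[of \<eta> "- \<omega>1" "- \<omega>2"]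
        by (simp_all add: X_def Y_def qpow_minus)
      have "1 / T = 1 / (X * Y) \<longleftrightarrow> T = X * Y" "1 / T = Y / X \<longleftrightarrow> T = X / Y" using nonzero by (auto simp: field_simps)
      then show ?thesis by (simp only: bex_simps p) blast
    qed
    show ?thesis
      unfolding irr reg_odd[OF nonzero(4) M] reg_odd[OF T' M] e ex n z by blast
  qed
  ultimately show ?thesis unfolding T_def by blast
qed

end
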